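(* Let $n$ be a positive integer and $V_n$ the elementary abelian $2$-group of order $2^n$. There is a short exact sequence of $GL_n(\mathbb{F}_2)$-modules $$0\to\mathsf{S}^2(V_n^* )\to H^3(V_n,k^\times)\xrightarrow{\;\pi\;}{\bigwedge}^3(V_n^* )\to 0 .$$
   Context: $k$ is an algebraically closed field of characteristic $0$. $V_n$ is viewed as an $n$-dimensional $\mathbb{F}_2$-vector space, $\mathsf{Aut}(V_n)=GL_n(\mathbb{F}_2)$, $V_n^*=\mathrm{Hom}(V_n,\mathbb{F}_2)$. $\mathsf{S}^2$ and $\bigwedge^3$ denote graded components of the symmetric and exterior algebras over $\mathbb{F}_2$. $H^3(V_n,k^\times)$ is group cohomology with trivial action on $k^\times$, with $GL_n(\mathbb{F}_2)$ acting through its action on $V_n$. *)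

theory Defs
  imports
    "HOL-Library.Z2"
    "HOL-Computational_Algebra.Polynomial"
    "HOL-Algebra.Bij"
    "HOL-Algebra.Product_Groups"
    "HOL-Analysis.Cartesian_Space"
begin

text \<open>
  Abelian groups are HOL-Algebra monoid records, written multiplicatively.  An
  \<open>\<bbbF>\<^sub>2\<close>-vector space is regarded as an abelian group: for \<open>\<bbbF>\<^sub>2\<close>-vector spaces, subspaces are
  the same as subgroups and linear maps the same as homomorphisms.
\<close>

section \<open>Modules over a group\<close>

definition group_module ::
    "('g, 'c) monoid_scheme \<Rightarrow> ('a, 'd) monoid_scheme \<Rightarrow> ('g \<Rightarrow> 'a \<Rightarrow> 'a) \<Rightarrow> bool" where
  "group_module G M \<phi> \<longleftrightarrow> group G \<and> comm_group M \<and> \<phi> \<in> hom G (AutoGroup M)"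

definition equivariant_on ::
    "('g, 'c) monoid_scheme \<Rightarrow> ('a, 'd) monoid_scheme \<Rightarrow> ('g \<Rightarrow> 'a \<Rightarrow> 'a) \<Rightarrow> ('g \<Rightarrow> 'b \<Rightarrow> 'b)
      \<Rightarrow> ('a \<Rightarrow> 'b) \<Rightarrow> bool" where
  "equivariant_on G M \<phi> \<psi> f \<longleftrightarrow> (\<forall>g\<in>carrier G. \<forall>x\<in>carrier M. f (\<phi> g x) = \<psi> g (f x))"

text \<open>
  \<open>0 \<rightarrow> A \<rightarrow> B \<rightarrow> C \<rightarrow> 0\<close> is a short exact sequence of \<open>G\<close>-modules.  The predicate
  \<open>short_exact_sequence\<close> of HOL-Algebra is not usable here, since it requires all
  groups in the sequence to have the same element type.
\<close>

definition short_exact_sequence_of_modules ::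
    "('g, 'x) monoid_scheme
      \<Rightarrow> ('a, 'y) monoid_scheme \<Rightarrow> ('g \<Rightarrow> 'a \<Rightarrow> 'a)
      \<Rightarrow> ('b, 'z) monoid_scheme \<Rightarrow> ('g \<Rightarrow> 'b \<Rightarrow> 'b)
      \<Rightarrow> ('c, 'w) monoid_scheme \<Rightarrow> ('g \<Rightarrow> 'c \<Rightarrow> 'c)
      \<Rightarrow> ('a \<Rightarrow> 'b) \<Rightarrow> ('b \<Rightarrow> 'c) \<Rightarrow> bool" where
  "short_exact_sequence_of_modules G A \<alpha> B \<beta> C \<gamma> i p \<longleftrightarrow>
     group_module G A \<alpha> \<and> group_module G B \<beta> \<and> group_module G C \<gamma> \<and>
     i \<in> mon A B \<and> equivariant_on G A \<alpha> \<beta> i \<and>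
     p \<in> epi B C \<and> equivariant_on G B \<beta> \<gamma> p \<and>
     i ` carrier A = kernel B C p"

text \<open>The action on a quotient of \<open>M\<close> induced by an action on \<open>M\<close>: cosets are mapped elementwise.\<close>

definition quotient_action ::
    "('q set, 'c) monoid_scheme \<Rightarrow> ('g \<Rightarrow> 'q \<Rightarrow> 'q) \<Rightarrow> 'g \<Rightarrow> 'q set \<Rightarrow> 'q set" where
  "quotient_action Q \<phi> g = (\<lambda>X\<in>carrier Q. \<phi> g ` X)"

section \<open>Words\<close>

definition words :: "nat \<Rightarrow> 'a set \<Rightarrow> 'a list set" where
  "words d A = {ws \<in> lists A. length ws = d}"

definition precomp :: "nat \<Rightarrow> 'a set \<Rightarrow> ('a \<Rightarrow> 'a) \<Rightarrow> ('a list \<Rightarrow> 'b) \<Rightarrow> 'a list \<Rightarrow> 'b" where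
  "precomp d A h c = (\<lambda>ws\<in>words d A. c (map h ws))"

section \<open>Symmetric and exterior powers over the field with two elements\<close>

definition additive_F2 :: "bit monoid" where
  "additive_F2 = \<lparr>carrier = UNIV, monoid.mult = (+), one = 0\<rparr>"

text \<open>The free \<open>\<bbbF>\<^sub>2\<close>-vector space on the words of length \<open>d\<close> in \<open>W\<close>, and its basis vectors.\<close>

definition free_words :: "nat \<Rightarrow> ('w, 'c) monoid_scheme \<Rightarrow> ('w list \<Rightarrow> bit) monoid" where
  "free_words d W = sum_group (words d (carrier W)) (\<lambda>_. additive_F2)"

definition word_basis :: "nat \<Rightarrow> ('w, 'c) monoid_scheme \<Rightarrow> 'w list \<Rightarrow> 'w list \<Rightarrow> bit" where
  "word_basis d W ws = (\<lambda>us\<in>words d (carrier W). if us = ws then 1 else 0)"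

text \<open>
  Let \<open>W\<close> be an \<open>\<bbbF>\<^sub>2\<close>-vector space.  The word \<open>w\<^sub>1\<dots>w\<^sub>d\<close> represents \<open>w\<^sub>1 \<otimes> \<dots> \<otimes> w\<^sub>d\<close>, and the
  quotient of \<open>free_words d W\<close> by the subspace spanned by \<open>tensor_relations d W\<close> is the
  \<open>d\<close>-th tensor power of \<open>W\<close>.  Homogeneity under scalars is a consequence of additivity,
  the scalars being \<open>0\<close> and \<open>1\<close>.
\<close>

definition tensor_relations :: "nat \<Rightarrow> ('w, 'c) monoid_scheme \<Rightarrow> ('w list \<Rightarrow> bit) set" where
  "tensor_relations d W =
     {word_basis d W (us @ [x \<otimes>\<^bsub>W\<^esub> y] @ vs)
        \<otimes>\<^bsub>free_words d W\<^esub> inv\<^bsub>free_words d W\<^esub>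
          (word_basis d W (us @ [x] @ vs) \<otimes>\<^bsub>free_words d W\<^esub> word_basis d W (us @ [y] @ vs))
      | us x y vs. us @ [x] @ vs \<in> words d (carrier W) \<and> y \<in> carrier W}"

text \<open>
  The symmetric (exterior) algebra is the quotient of the tensor algebra by the two-sided
  ideal generated by all \<open>x \<otimes> y - y \<otimes> x\<close> (all \<open>x \<otimes> x\<close>).  The following are spanning sets
  of the degree \<open>d\<close> components of these ideals, modulo the tensor relations.
\<close>

definition symmetric_relations :: "nat \<Rightarrow> ('w, 'c) monoid_scheme \<Rightarrow> ('w list \<Rightarrow> bit) set" where
  "symmetric_relations d W =
     {word_basis d W (us @ [x, y] @ vs)
        \<otimes>\<^bsub>free_words d W\<^esub> inv\<^bsub>free_words d W\<^esub> word_basis d W (us @ [y, x] @ vs)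
      | us x y vs. us @ [x, y] @ vs \<in> words d (carrier W)}"

definition exterior_relations :: "nat \<Rightarrow> ('w, 'c) monoid_scheme \<Rightarrow> ('w list \<Rightarrow> bit) set" where
  "exterior_relations d W =
     {word_basis d W (us @ [x, x] @ vs) | us x vs. us @ [x, x] @ vs \<in> words d (carrier W)}"

definition symmetric_power :: "nat \<Rightarrow> ('w, 'c) monoid_scheme \<Rightarrow> ('w list \<Rightarrow> bit) set monoid" where
  "symmetric_power d W =
     free_words d W Mod generate (free_words d W) (tensor_relations d W \<union> symmetric_relations d W)"

definition exterior_power :: "nat \<Rightarrow> ('w, 'c) monoid_scheme \<Rightarrow> ('w list \<Rightarrow> bit) set monoid" where
  "exterior_power d W =
     free_words d W Mod generate (free_words d W) (tensor_relations d W \<union> exterior_relations d W)"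

text \<open>
  If \<open>G\<close> acts on \<open>W\<close> by \<open>\<rho>\<close>, then \<open>g\<close> maps the basis vector of \<open>w\<^sub>1\<dots>w\<^sub>d\<close> to that of
  \<open>(g w\<^sub>1)\<dots>(g w\<^sub>d)\<close>; on coefficient functions this is precomposition with \<open>g\<^sup>-\<^sup>1\<close>.
\<close>

definition free_words_action ::
    "('g, 'x) monoid_scheme \<Rightarrow> nat \<Rightarrow> ('w, 'c) monoid_scheme \<Rightarrow> ('g \<Rightarrow> 'w \<Rightarrow> 'w)
      \<Rightarrow> 'g \<Rightarrow> ('w list \<Rightarrow> bit) \<Rightarrow> 'w list \<Rightarrow> bit" where
  "free_words_action G d W \<rho> g = precomp d (carrier W) (\<rho> (inv\<^bsub>G\<^esub> g))"

definition symmetric_power_action ::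
    "('g, 'x) monoid_scheme \<Rightarrow> nat \<Rightarrow> ('w, 'c) monoid_scheme \<Rightarrow> ('g \<Rightarrow> 'w \<Rightarrow> 'w)
      \<Rightarrow> 'g \<Rightarrow> ('w list \<Rightarrow> bit) set \<Rightarrow> ('w list \<Rightarrow> bit) set" where
  "symmetric_power_action G d W \<rho> =
     quotient_action (symmetric_power d W) (free_words_action G d W \<rho>)"

definition exterior_power_action ::
    "('g, 'x) monoid_scheme \<Rightarrow> nat \<Rightarrow> ('w, 'c) monoid_scheme \<Rightarrow> ('g \<Rightarrow> 'w \<Rightarrow> 'w)
      \<Rightarrow> 'g \<Rightarrow> ('w list \<Rightarrow> bit) set \<Rightarrow> ('w list \<Rightarrow> bit) set" where
  "exterior_power_action G d W \<rho> =
     quotient_action (exterior_power d W) (free_words_action G d W \<rho>)"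

section \<open>Group cohomology with trivial coefficients in the units of a field\<close>

definition field_units :: "'k::field monoid" where
  "field_units = \<lparr>carrier = - {0}, monoid.mult = (*), one = 1\<rparr>"

text \<open>
  Inhomogeneous cochains on the additive group of a type; the arguments \<open>x\<^sub>1, \<dots>, x\<^sub>n\<close> of an
  \<open>n\<close>-cochain form a list of length \<open>n\<close>.
\<close>

definition cochains :: "nat \<Rightarrow> ('v::group_add list \<Rightarrow> 'k::field) monoid" where
  "cochains n = product_group (words n UNIV) (\<lambda>_. field_units)"

definition merge_at :: "nat \<Rightarrow> 'v::group_add list \<Rightarrow> 'v list" where
  "merge_at i xs = take i xs @ [xs ! i + xs ! Suc i] @ drop (Suc (Suc i)) xs"

text \<open>
  The differential \<open>C\<^sup>n \<rightarrow> C\<^sup>n\<^sup>+\<^sup>1\<close> in multiplicative notation.  List positions start at \<open>0\<close>, so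
  adding \<open>x\<^sub>i\<close> and \<open>x\<^sub>i\<^sub>+\<^sub>1\<close>, which has sign \<open>(-1)\<^sup>i\<close>, is \<open>merge_at (i - 1)\<close>.
\<close>

definition coboundary ::
    "nat \<Rightarrow> ('v::group_add list \<Rightarrow> 'k::field) \<Rightarrow> 'v list \<Rightarrow> 'k" where
  "coboundary n c = (\<lambda>xs\<in>words (Suc n) UNIV.
     c (tl xs)
     * (\<Prod>i<n. c (merge_at i xs) powi ((-1) ^ Suc i))
     * c (butlast xs) powi ((-1) ^ Suc n))"

definition cocycles :: "nat \<Rightarrow> ('v::group_add list \<Rightarrow> 'k::field) set" where
  "cocycles n = kernel (cochains n) (cochains (Suc n)) (coboundary n)"

definition coboundaries :: "nat \<Rightarrow> ('v::group_add list \<Rightarrow> 'k::field) set" where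
  "coboundaries n =
     (case n of 0 \<Rightarrow> {\<one>\<^bsub>cochains 0\<^esub>} | Suc m \<Rightarrow> coboundary m ` carrier (cochains m))"

definition cohomology :: "nat \<Rightarrow> ('v::group_add list \<Rightarrow> 'k::field) set monoid" where
  "cohomology n = (cochains n)\<lparr>carrier := cocycles n\<rparr> Mod coboundaries n"

text \<open>\<open>(g c)(x\<^sub>1, \<dots>, x\<^sub>n) = c(g\<^sup>-\<^sup>1 x\<^sub>1, \<dots>, g\<^sup>-\<^sup>1 x\<^sub>n)\<close> for \<open>G\<close> acting on \<open>'v\<close> by \<open>\<rho>\<close>.\<close>

definition cohomology_action ::
    "('g, 'x) monoid_scheme \<Rightarrow> nat \<Rightarrow> ('g \<Rightarrow> 'v \<Rightarrow> 'v)
      \<Rightarrow> 'g \<Rightarrow> ('v::group_add list \<Rightarrow> 'k::field) set \<Rightarrow> ('v list \<Rightarrow> 'k) set" where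
  "cohomology_action G n \<rho> =
     quotient_action (cohomology n) (\<lambda>g. precomp n UNIV (\<rho> (inv\<^bsub>G\<^esub> g)))"

section \<open>The elementary abelian 2-group and its automorphisms\<close>

text \<open>
  The elementary abelian 2-group \<open>V\<^sub>n\<close> of order \<open>2\<^sup>n\<close> is the additive group of \<open>bit ^ 'n\<close>, where
  \<open>n = CARD('n) \<ge> 1\<close>.
\<close>

definition GL_F2 :: "(bit ^ 'n::finite ^ 'n) monoid" where
  "GL_F2 = \<lparr>carrier = {A. invertible A}, monoid.mult = (**), one = mat 1\<rparr>"

definition dual_F2 :: "(bit ^ 'n::finite \<Rightarrow> bit) monoid" where
  "dual_F2 = \<lparr>carrier = {f. Vector_Spaces.linear (*s) (*) f},
     monoid.mult = (\<lambda>f g v. f v + g v), one = (\<lambda>_. 0)\<rparr>"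

definition dual_action :: "bit ^ 'n::finite ^ 'n \<Rightarrow> (bit ^ 'n \<Rightarrow> bit) \<Rightarrow> bit ^ 'n \<Rightarrow> bit" where
  "dual_action g f = (\<lambda>v. f ((inv\<^bsub>GL_F2\<^esub> g) *v v))"

end

theory Submission
  imports Defs
begin

text \<open>
  Write \<open>V\<close> for \<open>V\<^sub>n\<close>. A word \<open>u v w\<close> of linear forms gives the \<open>3\<close>-cocycle \<open>(-1)\<close> to the power
  \<open>u \<union> v \<union> w\<close>, and every class in \<open>H\<^sup>3(V, k\<^sup>\<times>)\<close> comes from a sum of words: if \<open>p\<close> is the
  projection of \<open>V\<close> along the \<open>i\<close>-th basis vector, then a cocycle \<open>c\<close> is cohomologous to \<open>c \<circ> p\<close>
  times \<open>(-1)\<close> to the power \<open>f \<union> x\<^sub>i\<close> for some \<open>f \<in> Z\<^sup>2(V, \<bbbF>\<^sub>2)\<close>, and the same argument one degree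
  lower makes \<open>f\<close> bilinear. So \<open>H\<^sup>3\<close> is a quotient of the free space on words of length \<open>3\<close>, and
  \<open>\<pi>\<close> sends a word to its class in the exterior power, while \<open>\<iota>\<close> sends \<open>u v\<close> to the class of \<open>u u v\<close>.

  If a sum of words gives a coboundary, then its alternation vanishes, so it is zero in the exterior
  power: \<open>\<pi>\<close> is well defined. Likewise the value of a coboundary at \<open>(v, v, v)\<close> is the inverse of its
  value at \<open>(v, 0, v)\<close>, which detects the quadratic form of a sum of words \<open>u u v\<close>: \<open>\<iota>\<close> is injective.
  Since \<open>u \<union> v\<close> and \<open>v \<union> u\<close> are cohomologous, the exterior relations \<open>u u v\<close> and \<open>v u u\<close> both
  represent \<open>\<iota>(u v)\<close>, whence the exactness in the middle.
\<close>

text \<open>Squaring on the units of k presents \<open>H\<^sup>3(V, k\<^sup>\<times>)\<close> as the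
  quotient of \<open>H\<^sup>3(V, \<bbbF>\<^sub>2)\<close>, the cubic polynomials in linear forms,
  by the elements u^2 v + u v^2. That relation makes \<iota> symmetric. It fails over
  \<open>\<bbbF>\<^sub>2\<close>, so a primitive with bit values cannot exist, and a square root of
  -1 has to be used. Square roots in k enter a second time: splitting off a coordinate first yields
  a cocycle on which a translation acts by inversion, and only halving a suitable cochain brings its
  values into {1, -1}. Characteristic 0 is what separates -1 from 1. The obstacle to a direct
  construction is equivariance: splitting off coordinates and reducing to normal forms both depend
  on a basis, which GL does not preserve. Hence the modules are presented by all words in all linear
  forms, on which the group acts by substitution. Bases appear only in proofs that a representative
  exists or that an element lies in the span of the relations. Everything is done with explicit
  cochains, without computing any cohomology group or dimension.\<close>

declare add_bit_eq_xor [simp del] mult_bit_eq_and [simp del]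

lemma bit_add_self [simp]: "(a::bit) + a = 0"
  by (cases a) auto

text \<open>The bit is lifted to the integer 0 or 1 before it multiplies \<open>a\<close>. This is
  additive in \<open>b\<close> only when \<open>a + a = 0\<close>, so over a general abelian group
  the signs below cannot be dropped.\<close>

definition scale_bit :: "bit \<Rightarrow> 'a::zero \<Rightarrow> 'a" where
  "scale_bit b a = (if b = 1 then a else 0)"

lemma scale_bit_simps [simp]:
  "scale_bit 0 a = 0" "scale_bit 1 a = a" "scale_bit b 0 = 0"
  by (auto simp: scale_bit_def)

section \<open>Splitting off a character\<close>

text \<open>\<open>p\<close> is the projection onto the kernel of \<open>\<eta>\<close> along
  \<open>e\<close>. It is kept free of coordinates so that the steps in degrees 2 and 3 share
  it.\<close>

locale character_splitting =
  fixes \<eta> :: "'v::ab_group_add \<Rightarrow> bit" and e :: 'v and p :: "'v \<Rightarrow> 'v"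
  assumes exponent_two: "\<And>v::'v. v + v = 0"
    and character_add: "\<And>x y. \<eta> (x + y) = \<eta> x + \<eta> y"
    and character_e: "\<eta> e = 1"
    and p_def: "\<And>x. p x = x + scale_bit (\<eta> x) e"
begin

lemma p_add: "p (x + y) = p x + p y"
  using exponent_two[of e]
  by (cases "\<eta> x"; cases "\<eta> y") (auto simp: p_def character_add algebra_simps)

lemma p_diff: "p (x - y) = p x - p y"
  by (metis add_diff_cancel_right' diff_add_cancel p_add)

lemma character_p: "\<eta> (p x) = 0"
  by (cases "\<eta> x") (auto simp: p_def character_add character_e)

lemma p_p: "p (p x) = p x"
  using character_p[of x] by (simp add: p_def[of "p x"])

lemma p_fixed: "\<eta> w = 0 \<Longrightarrow> p w = w"
  by (simp add: p_def)

text \<open>Without the demand of invariance, \<open>C\<close> is simply the coboundary of a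
  homotopy term; the work lies in restoring invariance. The price is a cup product of
  \<open>D\<close> with the integral cochain \<open>\<eta> x2 - \<eta> x3\<close>. Translation by
  \<open>e\<close> turns the lift h of a character value into 1 - h, so it changes the sign of both
  factors and the product is invariant although \<open>D\<close> is not.\<close>

lemma homogeneous_degree_3:
  fixes C :: "'v \<Rightarrow> 'v \<Rightarrow> 'v \<Rightarrow> 'v \<Rightarrow> 'a::ab_group_add"
  assumes inv: "\<And>v x0 x1 x2 x3. C (x0+v) (x1+v) (x2+v) (x3+v) = C x0 x1 x2 x3"
    and cocycle: "\<And>x0 x1 x2 x3 x4.
      C x1 x2 x3 x4 - C x0 x2 x3 x4 + C x0 x1 x3 x4 - C x0 x1 x2 x4 + C x0 x1 x2 x3 = 0"
    and vanish: "\<And>x0 x1 x2 x3. C (p x0) (p x1) (p x2) (p x3) = 0"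
  obtains G D where
    "\<And>v x0 x1 x2. G (x0+v) (x1+v) (x2+v) = G x0 x1 x2"
    "\<And>v x0 x1 x2. \<eta> v = 0 \<Longrightarrow> D (x0+v) (x1+v) (x2+v) = D x0 x1 x2"
    "\<And>x0 x1 x2. D (x0+e) (x1+e) (x2+e) = - D x0 x1 x2"
    "\<And>x0 x1 x2 x3. D x1 x2 x3 - D x0 x2 x3 + D x0 x1 x3 - D x0 x1 x2 = 0"
    "\<And>x0 x1 x2 x3. C x0 x1 x2 x3 = G x1 x2 x3 - G x0 x2 x3 + G x0 x1 x3 - G x0 x1 x2
       + scale_bit (\<eta> x2) (D x0 x1 x2) - scale_bit (\<eta> x3) (D x0 x1 x2)"
proof -
  define dC where "dC x0 x1 x2 x3 x4 =
    C x1 x2 x3 x4 - C x0 x2 x3 x4 + C x0 x1 x3 x4 - C x0 x1 x2 x4 + C x0 x1 x2 x3" for x0 x1 x2 x3 x4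
  \<comment> \<open>\<open>B\<close> is the prism homotopy from the identity to \<open>p\<close>. It is invariant only under the kernel of
    the character, and \<open>D\<close> measures the failure of invariance under \<open>e\<close>.\<close>
  define B where "B x0 x1 x2 =
    C x0 x1 (p x1) (p x2) - C x0 (p x0) (p x1) (p x2) - C x0 x1 x2 (p x2)" for x0 x1 x2
  define D where "D x0 x1 x2 = B (x0+e) (x1+e) (x2+e) - B x0 x1 x2" for x0 x1 x2
  \<comment> \<open>Under a translation with character 1, \<open>B\<close> gains \<open>D\<close>,
    while \<open>D\<close> becomes \<open>-D\<close> and the lift h of \<open>\<eta> x2\<close>
    becomes 1 - h. As D - (1 - h) D = h D, the sum \<open>G\<close> is unchanged.\<close>
  define G where "G x0 x1 x2 = B x0 x1 x2 + scale_bit (\<eta> x2) (D x0 x1 x2)" for x0 x1 x2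
  have dC0: "dC x0 x1 x2 x3 x4 = 0" for x0 x1 x2 x3 x4
    unfolding dC_def by (rule cocycle)
  have dB: "B x1 x2 x3 - B x0 x2 x3 + B x0 x1 x3 - B x0 x1 x2 = C x0 x1 x2 x3" for x0 x1 x2 x3
  proof -
    \<comment> \<open>The prism over the simplex (x0, x1, x2, x3) consists of four 4-simplices. The
      right side is the cocycle condition on each of them, up to sign, together with the end face in
      the image of \<open>p\<close>.\<close>
    have "B x1 x2 x3 - B x0 x2 x3 + B x0 x1 x3 - B x0 x1 x2 - C x0 x1 x2 x3 =
      dC x0 x1 x2 (p x2) (p x3) - dC x0 x1 (p x1) (p x2) (p x3) - dC x0 x1 x2 x3 (p x3)
      + dC x0 (p x0) (p x1) (p x2) (p x3) - C (p x0) (p x1) (p x2) (p x3)"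
      unfolding B_def dC_def by (simp add: algebra_simps)
    then show ?thesis by (simp add: dC0 vanish)
  qed
  have B_inv: "B (x0+v) (x1+v) (x2+v) = B x0 x1 x2" if "\<eta> v = 0" for v x0 x1 x2
    unfolding B_def by (simp add: p_add p_fixed[OF that] inv)
  \<comment> \<open>The vector \<open>v + e\<close> lies in the kernel of the character, and
    translating by \<open>e\<close> and then by \<open>v + e\<close> is translating by
    \<open>v\<close>.\<close>
  have B_shift: "B (x0+v) (x1+v) (x2+v) = B (x0+e) (x1+e) (x2+e)" if "\<eta> v = 1" for v x0 x1 x2
    using B_inv[of "v + e" "x0+e" "x1+e" "x2+e"] that
    by (simp add: character_add character_e exponent_two add.assoc add.left_commute[of e v] flip: add.assoc[of e e])
  have D_inv: "D (x0+v) (x1+v) (x2+v) = D x0 x1 x2" if "\<eta> v = 0" for v x0 x1 x2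
    using B_inv[OF that, of "x0+e" "x1+e" "x2+e"] B_inv[OF that, of "x0" "x1" "x2"]
    by (simp add: D_def add_ac)
  have D_e: "D (x0+e) (x1+e) (x2+e) = - D x0 x1 x2" for x0 x1 x2
    by (simp add: D_def add.assoc exponent_two)
  have D_shift: "D (x0+v) (x1+v) (x2+v) = - D x0 x1 x2" if "\<eta> v = 1" for v x0 x1 x2
    using D_inv[of "v + e" "x0+e" "x1+e" "x2+e"] that D_e[of x0 x1 x2]
    by (simp add: character_add character_e exponent_two add.assoc add.left_commute[of e v] flip: add.assoc[of e e])
  show thesis
  proof (rule that[of G D])
    show "G (x0+v) (x1+v) (x2+v) = G x0 x1 x2" for v x0 x1 x2
    proof (cases "\<eta> v = 0")
      case True
      then show ?thesis using B_inv D_inv by (simp add: G_def character_add)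
    next
      case False
      then have "\<eta> v = 1" by simp
      then have "B (x0+v) (x1+v) (x2+v) = D x0 x1 x2 + B x0 x1 x2"
          "D (x0+v) (x1+v) (x2+v) = - D x0 x1 x2"
        using B_shift D_shift by (simp_all add: D_def)
      with \<open>\<eta> v = 1\<close> show ?thesis
        by (cases "\<eta> x2") (auto simp: G_def character_add)
    qed
    show dD: "D x1 x2 x3 - D x0 x2 x3 + D x0 x1 x3 - D x0 x1 x2 = 0" for x0 x1 x2 x3
    proof -
      have "D x1 x2 x3 - D x0 x2 x3 + D x0 x1 x3 - D x0 x1 x2
          = C (x0+e) (x1+e) (x2+e) (x3+e) - C x0 x1 x2 x3"
        unfolding dB[symmetric] D_def by (simp add: algebra_simps)
      then show ?thesis by (simp add: inv)
    qed
    show "C x0 x1 x2 x3 = G x1 x2 x3 - G x0 x2 x3 + G x0 x1 x3 - G x0 x1 x2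
       + scale_bit (\<eta> x2) (D x0 x1 x2) - scale_bit (\<eta> x3) (D x0 x1 x2)" for x0 x1 x2 x3
    proof -
      have D: "D x1 x2 x3 = D x0 x1 x2 + D x0 x2 x3 - D x0 x1 x3"
        using dD[of x1 x2 x3 x0] by (simp add: algebra_simps)
      show ?thesis
        unfolding dB[symmetric] G_def D by (cases "\<eta> x3") (simp_all add: algebra_simps)
    qed
  qed (use D_inv D_e in auto)
qed


text \<open>Divisibility by two turns the twisted \<open>D\<close> into one of order two. There
  \<open>-D = D\<close>, so the twist disappears, \<open>D\<close> is invariant under all
  translations, and the integral factor \<open>\<eta> x2 - \<eta> x3\<close> may be replaced by the
  bit \<open>\<eta> (x2 + x3)\<close>.\<close>

lemma homogeneous_degree_3_torsion:
  fixes C :: "'v \<Rightarrow> 'v \<Rightarrow> 'v \<Rightarrow> 'v \<Rightarrow> 'a::ab_group_add"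
  assumes inv: "\<And>v x0 x1 x2 x3. C (x0+v) (x1+v) (x2+v) (x3+v) = C x0 x1 x2 x3"
    and cocycle: "\<And>x0 x1 x2 x3 x4.
      C x1 x2 x3 x4 - C x0 x2 x3 x4 + C x0 x1 x3 x4 - C x0 x1 x2 x4 + C x0 x1 x2 x3 = 0"
    and vanish: "\<And>x0 x1 x2 x3. C (p x0) (p x1) (p x2) (p x3) = 0"
    and divisible: "\<And>a::'a. \<exists>b. b + b = a"
  obtains G D where
    "\<And>v x0 x1 x2. G (x0+v) (x1+v) (x2+v) = G x0 x1 x2"
    "\<And>v x0 x1 x2. D (x0+v) (x1+v) (x2+v) = D x0 x1 x2"
    "\<And>x0 x1 x2. D x0 x1 x2 + D x0 x1 x2 = 0"
    "\<And>x0 x1 x2 x3. D x1 x2 x3 - D x0 x2 x3 + D x0 x1 x3 - D x0 x1 x2 = 0"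
    "\<And>x0 x1 x2 x3. C x0 x1 x2 x3 = G x1 x2 x3 - G x0 x2 x3 + G x0 x1 x3 - G x0 x1 x2
       + scale_bit (\<eta> (x2 + x3)) (D x0 x1 x2)"
proof -
  obtain G0 D0 where
    G0: "\<And>v x0 x1 x2. G0 (x0+v) (x1+v) (x2+v) = G0 x0 x1 x2"
    and D0_inv: "\<And>v x0 x1 x2. \<eta> v = 0 \<Longrightarrow> D0 (x0+v) (x1+v) (x2+v) = D0 x0 x1 x2"
    and D0_e: "\<And>x0 x1 x2. D0 (x0+e) (x1+e) (x2+e) = - D0 x0 x1 x2"
    and D0_cocycle: "\<And>x0 x1 x2 x3. D0 x1 x2 x3 - D0 x0 x2 x3 + D0 x0 x1 x3 - D0 x0 x1 x2 = 0"
    and C_eq: "\<And>x0 x1 x2 x3. C x0 x1 x2 x3 = G0 x1 x2 x3 - G0 x0 x2 x3 + G0 x0 x1 x3 - G0 x0 x1 x2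
       + scale_bit (\<eta> x2) (D0 x0 x1 x2) - scale_bit (\<eta> x3) (D0 x0 x1 x2)"
    using homogeneous_degree_3[OF inv cocycle vanish] by blast
  have D0_shift: "D0 (x0+v) (x1+v) (x2+v) = - D0 x0 x1 x2" if "\<eta> v = 1" for v x0 x1 x2
    using D0_inv[of "v + e" "x0+e" "x1+e" "x2+e"] that D0_e[of x0 x1 x2]
    by (simp add: character_add character_e exponent_two add.assoc add.left_commute[of e v] flip: add.assoc[of e e])
  define dD where "dD x0 x1 x2 x3 = D0 x1 x2 x3 - D0 x0 x2 x3 + D0 x0 x1 x3 - D0 x0 x1 x2" for x0 x1 x2 x3
  have dD: "dD x0 x1 x2 x3 = 0" for x0 x1 x2 x3
    unfolding dD_def by (rule D0_cocycle)
  \<comment> \<open>Translation by \<open>e\<close> is homotopic to the identity, but acts on \<open>D0\<close> by \<open>-1\<close>; hence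
    \<open>D0 + D0\<close> is the coboundary of \<open>P\<close>, and halving \<open>P\<close> makes \<open>D0\<close> 2-torsion.\<close>
  define P where "P x0 x1 = D0 x0 x1 (x1+e) - D0 x0 (x0+e) (x1+e)" for x0 x1
  have P_inv: "P (x0+v) (x1+v) = P x0 x1" if "\<eta> v = 0" for v x0 x1
    using D0_inv[OF that, of x0 x1 "x1+e"] D0_inv[OF that, of x0 "x0+e" "x1+e"]
    by (simp add: P_def add_ac)
  have P_shift: "P (x0+v) (x1+v) = - P x0 x1" if "\<eta> v = 1" for v x0 x1
    using D0_shift[OF that, of x0 x1 "x1+e"] D0_shift[OF that, of x0 "x0+e" "x1+e"]
    by (simp add: P_def add_ac)
  have dP: "P x1 x2 - P x0 x2 + P x0 x1 = D0 x0 x1 x2 + D0 x0 x1 x2" for x0 x1 x2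
  proof -
    have "P x1 x2 - P x0 x2 + P x0 x1 - D0 x0 x1 x2 + D0 (x0+e) (x1+e) (x2+e)
      = dD x0 x1 x2 (x2+e) - dD x0 x1 (x1+e) (x2+e) + dD x0 (x0+e) (x1+e) (x2+e)"
      unfolding P_def dD_def by (simp add: algebra_simps)
    then have "P x1 x2 - P x0 x2 + P x0 x1 - D0 x0 x1 x2 - D0 x0 x1 x2 = 0"
      unfolding dD D0_e by simp
    then show ?thesis by (simp add: algebra_simps)
  qed
  obtain half :: "'a \<Rightarrow> 'a" where half: "half a + half a = a" for a
    using divisible by metis
  \<comment> \<open>Halving \<open>P\<close> pointwise could destroy its equivariance, since
    \<open>half\<close> is an arbitrary choice. So it is applied only to the representative
    \<open>(0, x0 + x1)\<close> of the orbit of \<open>(x0, x1)\<close>, which translation by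
    \<open>x0\<close> reaches, and the sign of \<open>x0\<close> extends the result.\<close>
  define E where "E x0 x1 = (if \<eta> x0 = 0 then half (P 0 (x0 + x1)) else - half (P 0 (x0 + x1)))"
    for x0 x1
  have minus_half: "- half a - half a = - a" for a
    by (metis half minus_add_distrib uminus_add_conv_diff)
  have EE: "E x0 x1 + E x0 x1 = P x0 x1" for x0 x1
    using P_inv[of x0 x0 x1] P_shift[of x0 x0 x1]
    by (cases "\<eta> x0 = 0") (auto simp: E_def half minus_half exponent_two add.commute)
  have add_shift: "x0 + v + (x1 + v) = x0 + x1" for x0 x1 v :: 'v
  proof -
    have "x0 + v + (x1 + v) = x0 + x1 + (v + v)" by (simp add: add_ac)
    then show ?thesis by (simp add: exponent_two)
  qed
  have E_inv: "E (x0+v) (x1+v) = (if \<eta> v = 0 then E x0 x1 else - E x0 x1)" for v x0 x1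
    by (cases "\<eta> v"; cases "\<eta> x0") (auto simp: E_def add_shift character_add)
  define D where "D x0 x1 x2 = D0 x0 x1 x2 - (E x1 x2 - E x0 x2 + E x0 x1)" for x0 x1 x2
  have DD: "D x0 x1 x2 + D x0 x1 x2 = 0" for x0 x1 x2
  proof -
    have "D x0 x1 x2 + D x0 x1 x2 = D0 x0 x1 x2 + D0 x0 x1 x2
      - ((E x1 x2 + E x1 x2) - (E x0 x2 + E x0 x2) + (E x0 x1 + E x0 x1))"
      unfolding D_def by (simp add: algebra_simps)
    then show ?thesis by (simp add: EE dP)
  qed
  then have D_minus: "- D x0 x1 x2 = D x0 x1 x2" for x0 x1 x2
    by (simp add: minus_unique)
  \<comment> \<open>\<open>K\<close> is the cup product of \<open>E\<close> with the integral
    cochain \<open>\<eta> x2 - \<eta> x1\<close>. Its coboundary absorbs the part of the cup product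
    with \<open>D0\<close> that comes from the coboundary of \<open>E\<close>.\<close>
  define K where "K x0 x1 x2 = scale_bit (\<eta> x2) (E x0 x1) - scale_bit (\<eta> x1) (E x0 x1)" for x0 x1 x2
  show thesis
  proof (rule that[of "\<lambda>x0 x1 x2. G0 x0 x1 x2 - K x0 x1 x2" D])
    show "G0 (x0+v) (x1+v) (x2+v) - K (x0+v) (x1+v) (x2+v) = G0 x0 x1 x2 - K x0 x1 x2" for v x0 x1 x2
      by (cases "\<eta> v"; cases "\<eta> x1"; cases "\<eta> x2")
        (auto simp: K_def G0 E_inv character_add)
    show "D (x0+v) (x1+v) (x2+v) = D x0 x1 x2" for v x0 x1 x2
    proof (cases "\<eta> v = 0")
      case True
      then show ?thesis by (simp add: D_def D0_inv E_inv)
    next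
      case False
      then have "D (x0+v) (x1+v) (x2+v) = - D x0 x1 x2"
        by (simp add: D_def D0_shift E_inv)
      then show ?thesis by (simp add: D_minus)
    qed
    show "D x1 x2 x3 - D x0 x2 x3 + D x0 x1 x3 - D x0 x1 x2 = 0" for x0 x1 x2 x3
    proof -
      have "D x1 x2 x3 - D x0 x2 x3 + D x0 x1 x3 - D x0 x1 x2 = dD x0 x1 x2 x3"
        unfolding D_def dD_def by (simp add: algebra_simps)
      then show ?thesis by (simp add: dD)
    qed
    show "C x0 x1 x2 x3 = (G0 x1 x2 x3 - K x1 x2 x3) - (G0 x0 x2 x3 - K x0 x2 x3)
      + (G0 x0 x1 x3 - K x0 x1 x3) - (G0 x0 x1 x2 - K x0 x1 x2)
       + scale_bit (\<eta> (x2 + x3)) (D x0 x1 x2)" for x0 x1 x2 x3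
    proof -
      have D0: "D0 x0 x1 x2 = D x0 x1 x2 + (E x1 x2 - E x0 x2 + E x0 x1)"
        by (simp add: D_def)
      have twisted: "scale_bit (\<eta> (x2 + x3)) (D x0 x1 x2) =
          scale_bit (\<eta> x2) (D x0 x1 x2) - scale_bit (\<eta> x3) (D x0 x1 x2)"
        by (cases "\<eta> x2"; cases "\<eta> x3") (simp_all add: character_add D_minus)
      have dK: "K x1 x2 x3 - K x0 x2 x3 + K x0 x1 x3 - K x0 x1 x2
        = scale_bit (\<eta> x3) (E x1 x2 - E x0 x2 + E x0 x1)
          - scale_bit (\<eta> x2) (E x1 x2 - E x0 x2 + E x0 x1)"
        unfolding K_def
        by (cases "\<eta> x1"; cases "\<eta> x2"; cases "\<eta> x3") (simp_all add: algebra_simps)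
      have "C x0 x1 x2 x3 - scale_bit (\<eta> (x2 + x3)) (D x0 x1 x2)
        - (G0 x1 x2 x3 - G0 x0 x2 x3 + G0 x0 x1 x3 - G0 x0 x1 x2)
        = - (K x1 x2 x3 - K x0 x2 x3 + K x0 x1 x3 - K x0 x1 x2)"
        unfolding dK C_eq twisted D0
        by (cases "\<eta> x2"; cases "\<eta> x3") (simp_all add: algebra_simps)
      then show ?thesis
        by (simp add: algebra_simps)
    qed
  qed (rule DD)
qed

end

section \<open>Inhomogeneous cochains in additive notation\<close>

definition d1 :: "('v::plus \<Rightarrow> 'a::ab_group_add) \<Rightarrow> 'v \<Rightarrow> 'v \<Rightarrow> 'a" where
  "d1 g x y = g y - g (x + y) + g x"

definition d2 :: "('v::plus \<Rightarrow> 'v \<Rightarrow> 'a::ab_group_add) \<Rightarrow> 'v \<Rightarrow> 'v \<Rightarrow> 'v \<Rightarrow> 'a" where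
  "d2 g x y z = g y z - g (x + y) z + g x (y + z) - g x y"

definition d3 :: "('v::plus \<Rightarrow> 'v \<Rightarrow> 'v \<Rightarrow> 'a::ab_group_add) \<Rightarrow> 'v \<Rightarrow> 'v \<Rightarrow> 'v \<Rightarrow> 'v \<Rightarrow> 'a" where
  "d3 c x y z w = c y z w - c (x + y) z w + c x (y + z) w - c x y (z + w) + c x y z"

text \<open>Evaluating \<open>c\<close> on successive differences gives a homogeneous cochain that
  is invariant by construction. After the pullback along \<open>p\<close> is subtracted it vanishes
  on the image of \<open>p\<close>, because \<open>p\<close> is idempotent. The inhomogeneous
  \<open>f\<close> and \<open>g\<close> are read off at \<open>(0, x, x + y)\<close>.\<close>

lemma (in character_splitting) cocycle_3_step:
  fixes c :: "'v \<Rightarrow> 'v \<Rightarrow> 'v \<Rightarrow> 'a::ab_group_add"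
  assumes divisible: "\<And>a::'a. \<exists>b. b + b = a"
    and cocycle: "\<And>x y z w. d3 c x y z w = 0"
  obtains f g where "\<And>x y. f x y + f x y = 0" "\<And>x y z. d2 f x y z = 0"
    "\<And>x y z. c x y z = c (p x) (p y) (p z) + d2 g x y z + scale_bit (\<eta> z) (f x y)"
proof -
  define C where "C x0 x1 x2 x3 = c (x1-x0) (x2-x1) (x3-x2) - c (p (x1-x0)) (p (x2-x1)) (p (x3-x2))"
    for x0 x1 x2 x3
  have inv: "C (x0+v) (x1+v) (x2+v) (x3+v) = C x0 x1 x2 x3" for v x0 x1 x2 x3
    by (simp add: C_def)
  have cocycle': "C x1 x2 x3 x4 - C x0 x2 x3 x4 + C x0 x1 x3 x4 - C x0 x1 x2 x4 + C x0 x1 x2 x3 = 0"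
    for x0 x1 x2 x3 x4
  proof -
    have "C x1 x2 x3 x4 - C x0 x2 x3 x4 + C x0 x1 x3 x4 - C x0 x1 x2 x4 + C x0 x1 x2 x3
      = d3 c (x1-x0) (x2-x1) (x3-x2) (x4-x3) - d3 c (p (x1-x0)) (p (x2-x1)) (p (x3-x2)) (p (x4-x3))"
      unfolding C_def d3_def by (simp add: p_add[symmetric] algebra_simps)
    then show ?thesis by (simp add: cocycle)
  qed
  have vanish: "C (p x0) (p x1) (p x2) (p x3) = 0" for x0 x1 x2 x3
    by (simp add: C_def p_diff p_p)
  obtain G D where G: "\<And>v x0 x1 x2. G (x0+v) (x1+v) (x2+v) = G x0 x1 x2"
    and D: "\<And>v x0 x1 x2. D (x0+v) (x1+v) (x2+v) = D x0 x1 x2"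
    and DD: "\<And>x0 x1 x2. D x0 x1 x2 + D x0 x1 x2 = 0"
    and D_cocycle: "\<And>x0 x1 x2 x3. D x1 x2 x3 - D x0 x2 x3 + D x0 x1 x3 - D x0 x1 x2 = 0"
    and C_eq: "\<And>x0 x1 x2 x3. C x0 x1 x2 x3 = G x1 x2 x3 - G x0 x2 x3 + G x0 x1 x3 - G x0 x1 x2
       + scale_bit (\<eta> (x2 + x3)) (D x0 x1 x2)"
    using homogeneous_degree_3_torsion[OF inv cocycle' vanish divisible] by blast
  show thesis
  proof
    show "d2 (\<lambda>x y. D 0 x (x + y)) x y z = 0" for x y z
      using D_cocycle[of x "x+y" "x+y+z" 0] D[of 0 x y "y+z"]
      by (simp add: d2_def add_ac)
    show "c x y z = c (p x) (p y) (p z) + d2 (\<lambda>x y. G 0 x (x + y)) x y z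
      + scale_bit (\<eta> z) (D 0 x (x + y))" for x y z
    proof -
      have "\<eta> (x + y + (x + y + z)) = \<eta> z"
        by (metis add.assoc add.left_neutral exponent_two)
      then show ?thesis
        using C_eq[of 0 x "x+y" "x+y+z"] G[of 0 x y "y+z"]
        by (simp add: d2_def C_def algebra_simps)
    qed
  qed (use DD in auto)
qed

lemma bit_add_left_self [simp]: "(a::bit) + (a + b) = b"
  by (simp flip: add.assoc)

text \<open>The same homotopy one degree lower, where signs are invisible. Now \<open>D\<close> is
  an invariant 1-cocycle, hence a homomorphism in the difference of its arguments; this is why
  \<open>f\<close> comes out additive.\<close>

lemma (in character_splitting) cocycle_2_step:
  fixes c :: "'v \<Rightarrow> 'v \<Rightarrow> bit"
  assumes cocycle: "\<And>x y z. d2 c x y z = 0"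
  obtains f g where "\<And>x y. f (x + y) = f x + f y"
    "\<And>x y. c x y = c (p x) (p y) + d1 g x y + f x * \<eta> y"
proof -
  define C where "C x0 x1 x2 = c (x1-x0) (x2-x1) + c (p (x1-x0)) (p (x2-x1))" for x0 x1 x2
  have inv: "C (x0+v) (x1+v) (x2+v) = C x0 x1 x2" for v x0 x1 x2
    by (simp add: C_def)
  define dC where "dC x0 x1 x2 x3 = C x1 x2 x3 + C x0 x2 x3 + C x0 x1 x3 + C x0 x1 x2" for x0 x1 x2 x3
  have dC: "dC x0 x1 x2 x3 = 0" for x0 x1 x2 x3
  proof -
    have "dC x0 x1 x2 x3
      = d2 c (x1-x0) (x2-x1) (x3-x2) + d2 c (p (x1-x0)) (p (x2-x1)) (p (x3-x2))"
      unfolding C_def dC_def d2_def by (simp add: p_add[symmetric] ac_simps)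
    then show ?thesis by (simp add: cocycle)
  qed
  have vanish: "C (p x0) (p x1) (p x2) = 0" for x0 x1 x2
    by (simp add: C_def p_diff p_p)
  define B where "B x0 x1 = C x0 x1 (p x1) + C x0 (p x0) (p x1)" for x0 x1
  define D where "D x0 x1 = B (x0+e) (x1+e) + B x0 x1" for x0 x1
  define G where "G x0 x1 = B x0 x1 + \<eta> x1 * D x0 x1" for x0 x1
  have dB: "B x1 x2 + B x0 x2 + B x0 x1 = C x0 x1 x2" for x0 x1 x2
  proof -
    have "B x1 x2 + B x0 x2 + B x0 x1 + C x0 x1 x2 =
      dC x0 x1 x2 (p x2) + dC x0 x1 (p x1) (p x2) + dC x0 (p x0) (p x1) (p x2)
      + C (p x0) (p x1) (p x2)"
      unfolding B_def dC_def by (simp add: ac_simps)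
    then have "B x1 x2 + B x0 x2 + B x0 x1 + C x0 x1 x2 = 0"
      by (simp add: dC vanish)
    then show ?thesis by (metis add_diff_cancel_right' add_0 bit_add_self)
  qed
  have B_inv: "B (x0+v) (x1+v) = B x0 x1" if "\<eta> v = 0" for v x0 x1
    unfolding B_def by (simp add: p_add p_fixed[OF that] inv)
  have B_shift: "B (x0+v) (x1+v) = B (x0+e) (x1+e)" if "\<eta> v = 1" for v x0 x1
    using B_inv[of "v + e" "x0+e" "x1+e"] that
    by (simp add: character_add character_e exponent_two add.assoc add.left_commute[of e v] flip: add.assoc[of e e])
  have D_inv: "D (x0+v) (x1+v) = D x0 x1" for v x0 x1
  proof (cases "\<eta> v = 0")
    case True
    then show ?thesis
      using B_inv[OF True, of "x0+e" "x1+e"] B_inv[OF True, of "x0" "x1"]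
      by (simp add: D_def add_ac)
  next
    case False
    then have "\<eta> v = 1" "\<eta> (v + e) = 0" by (simp_all add: character_add character_e)
    then show ?thesis
      using B_shift[of v x0 x1] B_inv[of "v + e" x0 x1] by (simp add: D_def add_ac)
  qed
  have D_cocycle: "D x1 x2 + D x0 x2 + D x0 x1 = 0" for x0 x1 x2
  proof -
    have "D x1 x2 + D x0 x2 + D x0 x1 = C (x0+e) (x1+e) (x2+e) + C x0 x1 x2"
      unfolding dB[symmetric] D_def by (simp add: ac_simps)
    then show ?thesis by (simp add: inv)
  qed
  have G_inv: "G (x0+v) (x1+v) = G x0 x1" for v x0 x1
  proof (cases "\<eta> v = 0")
    case True
    then show ?thesis by (simp add: G_def B_inv D_inv character_add)
  next
    case False
    then have "\<eta> v = 1" by simp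
    then show ?thesis
      using B_shift[of v x0 x1] by (cases "\<eta> x1") (simp_all add: G_def D_inv character_add, simp_all add: D_def ac_simps)
  qed
  have C_eq: "C x0 x1 x2 = G x1 x2 + G x0 x2 + G x0 x1 + \<eta> (x1 + x2) * D x0 x1" for x0 x1 x2
  proof -
    have "D x1 x2 = D x0 x2 + D x0 x1"
      using D_cocycle[of x1 x2 x0] by (metis add_diff_cancel_right' add_0 bit_add_self add.assoc)
    then show ?thesis
      unfolding dB[symmetric] G_def
      by (cases "\<eta> x1"; cases "\<eta> x2") (simp_all add: character_add ac_simps)
  qed
  show thesis
  proof
    show "D 0 (x + y) = D 0 x + D 0 y" for x y
      using D_cocycle[of x "x + y" 0] D_inv[of 0 x y]
      by (simp add: add_ac) (metis add_diff_cancel_right' add_0 bit_add_self add.assoc add.commute)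
    show "c x y = c (p x) (p y) + d1 (G 0) x y + D 0 x * \<eta> y" for x y
    proof -
      have "\<eta> (x + (x + y)) = \<eta> y"
        by (metis add.assoc add.left_neutral exponent_two)
      then have "C 0 x (x + y) = G 0 y + G 0 (x + y) + G 0 x + \<eta> y * D 0 x"
        using C_eq[of 0 x "x+y"] G_inv[of 0 x y] by (simp add: add_ac)
      then have "c x y + c (p x) (p y) = d1 (G 0) x y + D 0 x * \<eta> y"
        by (simp add: d1_def C_def mult.commute)
      then show ?thesis
        by (metis (no_types, lifting) add.assoc add.commute add.right_neutral bit_add_self)
    qed
  qed
qed

section \<open>Multilinear representatives\<close>

lemma vec_bit_add_self [simp]: "(v :: bit ^ 'n) + v = 0"
  by (simp add: vec_eq_iff)

text \<open>The composite of the projections along the basis vectors in \<open>S\<close>. The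
  inductions below enlarge \<open>S\<close> by one coordinate at a time; at \<open>UNIV\<close> only
  the value at zero is left.\<close>

definition mask :: "'n set \<Rightarrow> bit ^ 'n \<Rightarrow> bit ^ 'n::finite" where
  "mask S v = vec_lambda (\<lambda>i. if i \<in> S then 0 else v $ i)"

lemma mask_nth [simp]: "mask S v $ i = (if i \<in> S then 0 else v $ i)"
  by (simp add: mask_def)

lemma mask_add: "mask S (v + w) = mask S v + mask S w"
  by (simp add: vec_eq_iff)

lemma mask_empty [simp]: "mask {} v = v"
  by (simp add: vec_eq_iff)

lemma mask_UNIV [simp]: "mask UNIV v = 0"
  by (simp add: vec_eq_iff)

lemma mask_single: "mask {i} v = v + scale_bit (v $ i) (axis i 1)"
  by (cases "v $ i") (auto simp: vec_eq_iff axis_def)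

lemma character_splitting_coordinate:
  "character_splitting (\<lambda>v :: bit ^ 'n::finite. v $ i) (axis i 1) (mask {i})"
  by unfold_locales (simp_all add: mask_single)

lemma mask_mask: "mask S (mask T v) = mask (S \<union> T) v"
  by (simp add: vec_eq_iff)

lemma cocycle_2_bilinear:
  fixes c :: "bit ^ 'n::finite \<Rightarrow> bit ^ 'n \<Rightarrow> bit"
  assumes cocycle: "\<And>x y z. d2 c x y z = 0"
  obtains f g where "\<And>i x y. f i (x + y) = f i x + f i y"
    "\<And>x y. c x y = d1 g x y + (\<Sum>i\<in>UNIV. f i x * y $ i)"
proof -
  have "finite S \<Longrightarrow> \<exists>f g. (\<forall>i x y. f i (x + y) = f i x + f i y) \<and>
    (\<forall>x y. c x y = c (mask S x) (mask S y) + d1 g x y + (\<Sum>i\<in>S. f i x * y $ i))" for S :: "'n set"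
  proof (induction S rule: finite_induct)
    case empty
    show ?case
      by (rule exI[of _ "\<lambda>_ _. 0"], rule exI[of _ "\<lambda>_. 0"]) (simp add: d1_def)
  next
    case (insert i S)
    obtain f g where f: "\<And>i x y. f i (x + y) = f i x + f i y"
      and c: "\<And>x y. c x y = c (mask S x) (mask S y) + d1 g x y + (\<Sum>i\<in>S. f i x * y $ i)"
      using insert.IH by blast
    interpret character_splitting "\<lambda>v :: bit ^ 'n. v $ i" "axis i 1" "mask {i}"
      by (rule character_splitting_coordinate)
    have "d2 (\<lambda>x y. c (mask S x) (mask S y)) x y z = 0" for x y z
      using cocycle[of "mask S x" "mask S y" "mask S z"] by (simp add: d2_def mask_add)
    from cocycle_2_step[OF this]
    obtain f' g' where f': "\<And>x y. f' (x + y) = f' x + f' y"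
      and c': "\<And>x y. c (mask S x) (mask S y) =
        c (mask S (mask {i} x)) (mask S (mask {i} y)) + d1 g' x y + f' x * y $ i"
      by blast
    show ?case
    proof (intro exI conjI allI)
      show "(f(i := f')) j (x + y) = (f(i := f')) j x + (f(i := f')) j y" for j x y
        by (simp add: f f')
      show "c x y = c (mask (insert i S) x) (mask (insert i S) y) + d1 (\<lambda>x. g x + g' x) x y
          + (\<Sum>j\<in>insert i S. (f(i := f')) j x * y $ j)" for x y
      proof -
        have "(\<Sum>j\<in>insert i S. (f(i := f')) j x * y $ j) = f' x * y $ i + (\<Sum>i\<in>S. f i x * y $ i)"
          using insert.hyps by (auto intro!: sum.cong)
        then show ?thesis
          unfolding c[of x y] c'[of x y] by (simp add: mask_mask d1_def ac_simps)
      qed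
    qed
  qed
  from this[of UNIV] obtain f g where f: "\<And>i x y. f i (x + y) = f i x + f i y"
    and c: "\<And>x y. c x y = c 0 0 + d1 g x y + (\<Sum>i\<in>UNIV. f i x * y $ i)"
    by auto
  show thesis
  \<comment> \<open>The cocycle condition at zero is void in degree 2, so \<open>c 0 0\<close> may
    be nonzero. A constant is its own image under \<open>d1\<close>, which lets \<open>g\<close>
    absorb it.\<close>
  proof (rule that[of f "\<lambda>x. g x + c 0 0"])
    show "c x y = d1 (\<lambda>x. g x + c 0 0) x y + (\<Sum>i\<in>UNIV. f i x * y $ i)" for x y
      by (subst c) (simp add: d1_def ac_simps)
  qed (rule f)
qed

text \<open>Splitting off a coordinate leaves a 2-cocycle \<open>b\<close> with
  \<open>b + b = 0\<close>, whose values are therefore \<open>0\<close> or \<open>t\<close>. It can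
  be read as a cocycle of bits and made bilinear by \<open>cocycle_2_bilinear\<close>; its cup
  product with the coordinate is then trilinear up to a coboundary.\<close>

lemma cocycle_3_trilinear:
  fixes c :: "bit ^ 'n::finite \<Rightarrow> bit ^ 'n \<Rightarrow> bit ^ 'n \<Rightarrow> 'a::ab_group_add"
  assumes divisible: "\<And>a::'a. \<exists>b. b + b = a"
    and torsion: "\<And>a::'a. a + a = 0 \<longleftrightarrow> a = 0 \<or> a = t"
    and t: "t \<noteq> 0"
    and cocycle: "\<And>x y z w. d3 c x y z w = 0"
  obtains f g where "\<And>i j x y. f i j (x + y) = f i j x + f i j y"
    "\<And>x y z. c x y z = d2 g x y z + scale_bit (\<Sum>i\<in>UNIV. \<Sum>j\<in>UNIV. f i j x * y $ j * z $ i) t"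
proof -
  have tt [simp]: "t + t = 0" using torsion by blast
  then have t_minus [simp]: "- t = t" by (simp add: minus_unique)
  have scale_add: "scale_bit (a + b) t = scale_bit a t + scale_bit b t" for a b
    by (cases a; cases b) auto
  have scale_minus: "- scale_bit a t = scale_bit a t" for a
    by (cases a) auto
  have scale_diff: "a - scale_bit b t = a + scale_bit b t" for a b
    by (metis diff_conv_add_uminus scale_minus)
  have "finite S \<Longrightarrow> \<exists>f g. (\<forall>i j x y. f i j (x + y) = f i j x + f i j y) \<and>
    (\<forall>x y z. c x y z = c (mask S x) (mask S y) (mask S z) + d2 g x y z
      + scale_bit (\<Sum>i\<in>S. \<Sum>j\<in>UNIV. f i j x * y $ j * z $ i) t)" for S :: "'n set"
  proof (induction S rule: finite_induct)
    case empty
    show ?case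
      by (rule exI[of _ "\<lambda>_ _ _. 0"], rule exI[of _ "\<lambda>_ _. 0"]) (simp add: d2_def)
  next
    case (insert i S)
    obtain f g where f: "\<And>i j x y. f i j (x + y) = f i j x + f i j y"
      and c: "\<And>x y z. c x y z = c (mask S x) (mask S y) (mask S z) + d2 g x y z
        + scale_bit (\<Sum>i\<in>S. \<Sum>j\<in>UNIV. f i j x * y $ j * z $ i) t"
      using insert.IH by blast
    interpret character_splitting "\<lambda>v :: bit ^ 'n. v $ i" "axis i 1" "mask {i}"
      by (rule character_splitting_coordinate)
    have "d3 (\<lambda>x y z. c (mask S x) (mask S y) (mask S z)) x y z w = 0" for x y z w
      using cocycle[of "mask S x" "mask S y" "mask S z" "mask S w"] by (simp add: d3_def mask_add)
    from cocycle_3_step[OF divisible this]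
    obtain b g' where b: "\<And>x y. b x y + b x y = 0" "\<And>x y z. d2 b x y z = 0"
      and c': "\<And>x y z. c (mask S x) (mask S y) (mask S z) =
        c (mask S (mask {i} x)) (mask S (mask {i} y)) (mask S (mask {i} z)) + d2 g' x y z
        + scale_bit (z $ i) (b x y)"
      by blast
    define b' where "b' x y = (if b x y = 0 then 0 else 1 :: bit)" for x y
    have b': "b x y = scale_bit (b' x y) t" for x y
      using b(1)[of x y] torsion by (auto simp: b'_def)
    have "d2 b' x y z = 0" for x y z
    proof -
      have "scale_bit (d2 b' x y z) t = d2 b x y z"
        by (simp add: d2_def b' scale_add scale_minus flip: add_uminus_conv_diff)
      then show ?thesis
        using t b(2) by (cases "d2 b' x y z") auto
    qed
    then obtain h k where h: "\<And>j x y. h j (x + y) = h j x + h j y"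
      and b'_eq: "\<And>x y. b' x y = d1 k x y + (\<Sum>j\<in>UNIV. h j x * y $ j)"
      by (rule cocycle_2_bilinear) blast
    \<comment> \<open>The last summand is the cup product of \<open>k\<close> with the coordinate
      \<open>i\<close>. As the coordinate is additive, its coboundary is the cup product of
      \<open>d1 k\<close> with that coordinate, the error made by passing to the bilinear
      representative.\<close>
    let ?g = "\<lambda>x y. g x y + g' x y + scale_bit (k x * y $ i) t"
    show ?case
    proof (intro exI conjI allI)
      show "(f(i := h)) l j (x + y) = (f(i := h)) l j x + (f(i := h)) l j y" for l j x y
        by (simp add: f h)
      show "c x y z = c (mask (insert i S) x) (mask (insert i S) y) (mask (insert i S) z) + d2 ?g x y z
          + scale_bit (\<Sum>l\<in>insert i S. \<Sum>j\<in>UNIV. (f(i := h)) l j x * y $ j * z $ l) t" for x y z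
      proof -
        have sum: "(\<Sum>l\<in>insert i S. \<Sum>j\<in>UNIV. (f(i := h)) l j x * y $ j * z $ l) =
          (\<Sum>j\<in>UNIV. h j x * y $ j) * z $ i + (\<Sum>l\<in>S. \<Sum>j\<in>UNIV. f l j x * y $ j * z $ l)"
          using insert.hyps by (auto intro!: sum.cong simp: sum_distrib_right)
        have b_eq: "scale_bit (z $ i) (b x y) =
          scale_bit ((\<Sum>j\<in>UNIV. h j x * y $ j) * z $ i) t + scale_bit (d1 k x y * z $ i) t"
          unfolding b' b'_eq by (cases "z $ i") (simp_all add: scale_add add.commute)
        have g_eq: "d2 ?g x y z = d2 g x y z + d2 g' x y z + scale_bit (d1 k x y * z $ i) t"
        proof -
          have "d2 ?g x y z = d2 g x y z + d2 g' x y z + d2 (\<lambda>x y. scale_bit (k x * y $ i) t) x y z"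
            by (simp add: d2_def algebra_simps)
          also have "d2 (\<lambda>x y. scale_bit (k x * y $ i) t) x y z = scale_bit (d1 k x y * z $ i) t"
            by (simp add: d2_def d1_def scale_diff distrib_left distrib_right ac_simps flip: scale_add)
          finally show ?thesis .
        qed
        show ?thesis
          unfolding c[of x y z] c'[of x y z] sum b_eq g_eq by (simp add: mask_mask scale_add ac_simps)
      qed
    qed
  qed
  from this[of UNIV] obtain f g where f: "\<And>i j x y. f i j (x + y) = f i j x + f i j y"
    and c: "\<And>x y z. c x y z = c 0 0 0 + d2 g x y z
      + scale_bit (\<Sum>i\<in>UNIV. \<Sum>j\<in>UNIV. f i j x * y $ j * z $ i) t"
    by auto
  \<comment> \<open>At zero the five terms of the cocycle condition alternate in sign and leave one,
    so in contrast to degree 2 no constant has to be absorbed.\<close>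
  have "c 0 0 0 = 0"
    using cocycle[of 0 0 0 0] by (simp add: d3_def)
  with f c show thesis
    by (intro that[of f g]) auto
qed

text \<open>A term containing a sum of two arguments is symmetric in them by commutativity, so it
  occurs for two orders of opposite sign; the remaining terms cancel in pairs as well.\<close>

lemma d2_alternating_sum:
  fixes g :: "'v::ab_semigroup_add \<Rightarrow> 'v \<Rightarrow> 'a::ab_group_add"
  shows "d2 g x y z - d2 g y x z + d2 g y z x - d2 g z y x + d2 g z x y - d2 g x z y = 0"
  by (simp add: d2_def algebra_simps)

text \<open>For a \<open>g\<close> normalised at zero both terms vanish separately. In general the
  first is \<open>g v 0 - g 0 v\<close>, and the value at \<open>(v, 0, v)\<close> is its
  negative.\<close>

lemma d2_diagonal:
  fixes g :: "'v::ab_group_add \<Rightarrow> 'v \<Rightarrow> 'a::ab_group_add"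
  assumes "v + v = 0"
  shows "d2 g v v v + d2 g v 0 v = 0"
  using assms by (simp add: d2_def)

lemma d3_d2: "d3 (d2 g) x y z w = (0 :: 'a::ab_group_add)" for x :: "'v::ab_semigroup_add"
  by (simp add: d3_def d2_def algebra_simps)

section \<open>Quotient modules and their exact sequences\<close>

text \<open>Weaker than \<open>group_module\<close> for \<open>M\<close> itself: the action has to
  obey its laws on the carrier but need not be extensional there. The restriction inside
  \<open>quotient_action\<close> supplies extensionality on the quotient.\<close>

locale quotient_module =
  G: group G + M: comm_group M + N: subgroup N M
  for G (structure) and M (structure) and N +
  fixes \<phi> :: "'g \<Rightarrow> 'm \<Rightarrow> 'm"
  assumes action_hom: "g \<in> carrier G \<Longrightarrow> \<phi> g \<in> hom M M"
    and action_mult: "\<lbrakk>g \<in> carrier G; h \<in> carrier G; x \<in> carrier M\<rbrakk> \<Longrightarrow> \<phi> (g \<otimes>\<^bsub>G\<^esub> h) x = \<phi> g (\<phi> h x)"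
    and action_one: "x \<in> carrier M \<Longrightarrow> \<phi> \<one>\<^bsub>G\<^esub> x = x"
    and action_stable: "\<lbrakk>g \<in> carrier G; x \<in> N\<rbrakk> \<Longrightarrow> \<phi> g x \<in> N"
begin

abbreviation proj :: "'m \<Rightarrow> 'm set" where
  "proj x \<equiv> N #>\<^bsub>M\<^esub> x"

lemma normal: "N \<lhd> M"
  using M.subgroup_imp_normal N.subgroup_axioms by blast

lemma carrier_Mod: "carrier (M Mod N) = proj ` carrier M"
  by (rule carrier_FactGroup)

lemma proj_mult: "\<lbrakk>x \<in> carrier M; y \<in> carrier M\<rbrakk> \<Longrightarrow> proj x \<otimes>\<^bsub>M Mod N\<^esub> proj y = proj (x \<otimes>\<^bsub>M\<^esub> y)"
  by (simp add: normal.rcos_sum[OF normal])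

lemma proj_eq_iff:
  assumes "x \<in> carrier M" "y \<in> carrier M"
  shows "proj x = proj y \<longleftrightarrow> x \<otimes>\<^bsub>M\<^esub> inv\<^bsub>M\<^esub> y \<in> N"
  by (metis M.group_axioms M.rcos_self M.repr_independence N.rcos_module N.subgroup_axioms assms)

lemma proj_one_iff: "x \<in> carrier M \<Longrightarrow> proj x = \<one>\<^bsub>M Mod N\<^esub> \<longleftrightarrow> x \<in> N"
  using proj_eq_iff[of x "\<one>\<^bsub>M\<^esub>"] by (simp add: M.coset_mult_one N.subset)

lemma comm_group_Mod: "comm_group (M Mod N)"
  using M.abelian_FactGroup N.subgroup_axioms by blast

lemma action_closed: "\<lbrakk>g \<in> carrier G; x \<in> carrier M\<rbrakk> \<Longrightarrow> \<phi> g x \<in> carrier M"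
  using action_hom by (auto simp: hom_def)

lemma action_image:
  assumes "g \<in> carrier G" "x \<in> carrier M"
  shows "\<phi> g ` proj x = proj (\<phi> g x)"
proof
  show "\<phi> g ` proj x \<subseteq> proj (\<phi> g x)"
    using assms action_stable hom_mult[OF action_hom] N.subset
    by (fastforce simp: r_coset_def)
  show "proj (\<phi> g x) \<subseteq> \<phi> g ` proj x"
  proof
    fix y assume "y \<in> proj (\<phi> g x)"
    then obtain n where n: "n \<in> N" "y = n \<otimes>\<^bsub>M\<^esub> \<phi> g x"
      by (auto simp: r_coset_def)
    have "\<phi> g (\<phi> (inv\<^bsub>G\<^esub> g) n) = n"
      using n assms N.subset action_mult[of g "inv\<^bsub>G\<^esub> g" n] action_one[of n] by auto
    moreover have *: "\<phi> (inv\<^bsub>G\<^esub> g) n \<in> N"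
      using n assms action_stable by auto
    ultimately have "y = \<phi> g (\<phi> (inv\<^bsub>G\<^esub> g) n \<otimes>\<^bsub>M\<^esub> x)"
      using n assms N.subset hom_mult[OF action_hom] by (metis subsetD)
    with * show "y \<in> \<phi> g ` proj x"
      by (auto simp: r_coset_def)
  qed
qed

lemma quotient_action_proj:
  "\<lbrakk>g \<in> carrier G; x \<in> carrier M\<rbrakk> \<Longrightarrow> quotient_action (M Mod N) \<phi> g (proj x) = proj (\<phi> g x)"
  by (auto simp: quotient_action_def carrier_Mod action_image)

lemma group_module: "group_module G (M Mod N) (quotient_action (M Mod N) \<phi>)"
  unfolding group_module_def
proof (intro conjI G.group_axioms comm_group_Mod)
  let ?Q = "M Mod N" and ?\<psi> = "quotient_action (M Mod N) \<phi>"
  have closed: "?\<psi> g X \<in> carrier ?Q" if "g \<in> carrier G" "X \<in> carrier ?Q" for g X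
    using that by (auto simp: carrier_Mod quotient_action_proj action_closed)
  have inverse: "?\<psi> (inv\<^bsub>G\<^esub> g) (?\<psi> g X) = X" "?\<psi> g (?\<psi> (inv\<^bsub>G\<^esub> g) X) = X"
    if "g \<in> carrier G" "X \<in> carrier ?Q" for g X
    using that by (auto simp: carrier_Mod quotient_action_proj action_closed action_one
      simp flip: action_mult)
  have ext: "?\<psi> g \<in> extensional (carrier ?Q)" for g
    by (simp add: quotient_action_def)
  have "bij_betw (?\<psi> g) (carrier ?Q) (carrier ?Q)" if "g \<in> carrier G" for g
    by (rule bij_betw_byWitness[where f' = "?\<psi> (inv\<^bsub>G\<^esub> g)"])
      (use that inverse closed in auto)
  then have bij: "?\<psi> g \<in> Bij (carrier ?Q)" if "g \<in> carrier G" for g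
    using that ext by (simp add: Bij_def)
  have hom: "?\<psi> g \<in> hom ?Q ?Q" if "g \<in> carrier G" for g
  proof (rule homI)
    show "?\<psi> g (X \<otimes>\<^bsub>?Q\<^esub> Y) = ?\<psi> g X \<otimes>\<^bsub>?Q\<^esub> ?\<psi> g Y"
      if "X \<in> carrier ?Q" "Y \<in> carrier ?Q" for X Y
      using that \<open>g \<in> carrier G\<close> hom_mult[OF action_hom, of g]
      by (auto simp: carrier_Mod quotient_action_proj action_closed proj_mult simp del: mult_FactGroup)
  qed (use that closed in auto)
  show "?\<psi> \<in> hom G (AutoGroup ?Q)"
  proof (rule homI)
    show "?\<psi> g \<in> carrier (AutoGroup ?Q)" if "g \<in> carrier G" for g
      using that bij hom by (simp add: AutoGroup_def auto_def)
    show "?\<psi> (g \<otimes>\<^bsub>G\<^esub> h) = ?\<psi> g \<otimes>\<^bsub>AutoGroup ?Q\<^esub> ?\<psi> h"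
      if "g \<in> carrier G" "h \<in> carrier G" for g h
    proof -
      have "?\<psi> (g \<otimes>\<^bsub>G\<^esub> h) = compose (carrier ?Q) (?\<psi> g) (?\<psi> h)"
      proof (rule extensionalityI[OF ext compose_extensional])
        show "?\<psi> (g \<otimes>\<^bsub>G\<^esub> h) X = compose (carrier ?Q) (?\<psi> g) (?\<psi> h) X" if "X \<in> carrier ?Q" for X
          using that \<open>g \<in> carrier G\<close> \<open>h \<in> carrier G\<close>
          by (auto simp: compose_def carrier_Mod quotient_action_proj action_closed action_mult)
      qed
      then show ?thesis
        using that bij by (simp add: AutoGroup_def BijGroup_def)
    qed
  qed
qed

end

text \<open>Reduces the exact sequence to statements about representatives. The map \<iota> is
  induced by \<open>\<Phi>\<close> after \<open>\<delta>\<close>. The map \<pi> runs against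
  \<open>\<Phi>\<close>: a class in \<open>M Mod B\<close> is represented by some
  \<open>\<Phi> x\<close>, and \<pi> returns the class of \<open>x\<close>. So \<pi> needs
  \<open>generates\<close> and \<open>kernel_\<Phi>\<close>, injectivity of \<iota> is one half of
  \<open>kernel_\<Phi>_\<delta>\<close>, and exactness in the middle is \<open>\<delta>_R\<close>
  with \<open>R_\<delta>\<close>.\<close>

lemma short_exact_sequence_from_presentation:
  fixes \<Phi> :: "'a \<Rightarrow> 'm" and \<delta> :: "'b \<Rightarrow> 'a"
  assumes M: "quotient_module G M B \<beta>"
    and F: "quotient_module G F R \<alpha>"
    and E: "quotient_module G E S \<epsilon>"
    and \<Phi>: "\<Phi> \<in> hom F M" and \<delta>: "\<delta> \<in> hom E F"
    and \<Phi>_equivariant: "\<And>g x. \<lbrakk>g \<in> carrier G; x \<in> carrier F\<rbrakk> \<Longrightarrow> \<Phi> (\<alpha> g x) = \<beta> g (\<Phi> x)"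
    and \<delta>_equivariant: "\<And>g x. \<lbrakk>g \<in> carrier G; x \<in> carrier E\<rbrakk> \<Longrightarrow> \<delta> (\<epsilon> g x) = \<alpha> g (\<delta> x)"
    and generates: "\<And>m. m \<in> carrier M \<Longrightarrow> \<exists>x\<in>carrier F. m \<otimes>\<^bsub>M\<^esub> inv\<^bsub>M\<^esub> \<Phi> x \<in> B"
    and kernel_\<Phi>: "\<And>x. \<lbrakk>x \<in> carrier F; \<Phi> x \<in> B\<rbrakk> \<Longrightarrow> x \<in> R"
    and kernel_\<Phi>_\<delta>: "\<And>x. x \<in> carrier E \<Longrightarrow> \<Phi> (\<delta> x) \<in> B \<longleftrightarrow> x \<in> S"
    and \<delta>_R: "\<And>x. x \<in> carrier E \<Longrightarrow> \<delta> x \<in> R"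
    and R_\<delta>: "\<And>x. x \<in> R \<Longrightarrow> \<exists>y\<in>carrier E. \<Phi> x \<otimes>\<^bsub>M\<^esub> inv\<^bsub>M\<^esub> \<Phi> (\<delta> y) \<in> B"
  shows "\<exists>\<iota> \<pi>. short_exact_sequence_of_modules G
    (E Mod S) (quotient_action (E Mod S) \<epsilon>) (M Mod B) (quotient_action (M Mod B) \<beta>)
    (F Mod R) (quotient_action (F Mod R) \<alpha>) \<iota> \<pi>"
proof -
  interpret M: quotient_module G M B \<beta> by (rule M)
  interpret F: quotient_module G F R \<alpha> by (rule F)
  interpret E: quotient_module G E S \<epsilon> by (rule E)
  interpret \<Phi>: group_hom F M \<Phi>
    using F.M.group_axioms M.M.group_axioms \<Phi> by (simp add: group_hom_def group_hom_axioms_def)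
  interpret \<delta>: group_hom E F \<delta>
    using E.M.group_axioms F.M.group_axioms \<delta> by (simp add: group_hom_def group_hom_axioms_def)
  define q where "q x = M.proj (\<Phi> x)" for x
  have q_cases: "\<exists>x\<in>carrier F. X = q x" if "X \<in> carrier (M Mod B)" for X
    using that generates by (auto simp: q_def M.carrier_Mod M.proj_eq_iff)
  have q_eq_iff: "q x = q y \<longleftrightarrow> \<Phi> (x \<otimes>\<^bsub>F\<^esub> inv\<^bsub>F\<^esub> y) \<in> B" if "x \<in> carrier F" "y \<in> carrier F" for x y
    using that by (simp add: q_def M.proj_eq_iff)
  have q_closed: "q x \<in> carrier (M Mod B)" if "x \<in> carrier F" for x
    using that by (simp add: q_def M.carrier_Mod)
  have q_mult: "q x \<otimes>\<^bsub>M Mod B\<^esub> q y = q (x \<otimes>\<^bsub>F\<^esub> y)" if "x \<in> carrier F" "y \<in> carrier F" for x y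
    using that by (simp add: q_def M.proj_mult del: mult_FactGroup)
  have q_action: "quotient_action (M Mod B) \<beta> g (q x) = q (\<alpha> g x)" if "g \<in> carrier G" "x \<in> carrier F" for g x
    using that by (simp add: q_def M.quotient_action_proj \<Phi>_equivariant)
  \<comment> \<open>Independence of the chosen representative, which is exactly what lets \<pi> be
    obtained by factoring the projection of \<open>F\<close> through \<open>q\<close>.\<close>
  have "F.proj x = F.proj y" if "x \<in> carrier F" "y \<in> carrier F" "q x = q y" for x y
    using that kernel_\<Phi> by (simp add: F.proj_eq_iff q_eq_iff)
  then obtain \<pi> where \<pi>: "\<pi> (q x) = F.proj x" if "x \<in> carrier F" for x
    using function_factors_left_gen[of "\<lambda>x. x \<in> carrier F" q F.proj] by metis
  have "q (\<delta> x) = q (\<delta> y)" if "x \<in> carrier E" "y \<in> carrier E" "E.proj x = E.proj y" for x y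
    using that kernel_\<Phi>_\<delta>[of "x \<otimes>\<^bsub>E\<^esub> inv\<^bsub>E\<^esub> y"] by (simp add: E.proj_eq_iff q_eq_iff)
  then obtain \<iota> where \<iota>: "\<iota> (E.proj x) = q (\<delta> x)" if "x \<in> carrier E" for x
    using function_factors_left_gen[of "\<lambda>x. x \<in> carrier E" E.proj "\<lambda>x. q (\<delta> x)"] by metis
  note simps = E.quotient_action_proj E.action_closed F.quotient_action_proj F.action_closed
    E.proj_mult F.proj_mult q_closed q_mult q_action
  have \<iota>_hom: "\<iota> \<in> hom (E Mod S) (M Mod B)"
    by (rule homI) (auto simp: E.carrier_Mod \<iota> simps simp del: mult_FactGroup)
  have \<pi>_hom: "\<pi> \<in> hom (M Mod B) (F Mod R)"
  proof (rule homI)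
    show "\<pi> X \<in> carrier (F Mod R)" if "X \<in> carrier (M Mod B)" for X
      using q_cases[OF that] by (auto simp: \<pi> F.carrier_Mod)
    show "\<pi> (X \<otimes>\<^bsub>M Mod B\<^esub> Y) = \<pi> X \<otimes>\<^bsub>F Mod R\<^esub> \<pi> Y"
      if "X \<in> carrier (M Mod B)" "Y \<in> carrier (M Mod B)" for X Y
      using q_cases[OF that(1)] q_cases[OF that(2)] by (auto simp: \<pi> simps simp del: mult_FactGroup)
  qed
  have "inj_on \<iota> (carrier (E Mod S))"
  proof (rule inj_onI)
    fix X Y assume "X \<in> carrier (E Mod S)" "Y \<in> carrier (E Mod S)" and eq: "\<iota> X = \<iota> Y"
    then obtain x y where xy: "x \<in> carrier E" "y \<in> carrier E" "X = E.proj x" "Y = E.proj y"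
      by (auto simp: E.carrier_Mod)
    then show "X = Y"
      using eq kernel_\<Phi>_\<delta>[of "x \<otimes>\<^bsub>E\<^esub> inv\<^bsub>E\<^esub> y"] by (simp add: \<iota> q_eq_iff E.proj_eq_iff)
  qed
  with \<iota>_hom have "\<iota> \<in> mon (E Mod S) (M Mod B)"
    by (simp add: mon_def)
  moreover have "F.proj x \<in> \<pi> ` carrier (M Mod B)" if "x \<in> carrier F" for x
    using that \<pi>[of x] q_closed[of x] by (metis imageI)
  then have "\<pi> ` carrier (M Mod B) = carrier (F Mod R)"
    using \<pi>_hom by (auto simp: hom_def F.carrier_Mod)
  with \<pi>_hom have "\<pi> \<in> epi (M Mod B) (F Mod R)"
    by (simp add: epi_def)
  moreover have "equivariant_on G (E Mod S) (quotient_action (E Mod S) \<epsilon>) (quotient_action (M Mod B) \<beta>) \<iota>"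
    by (auto simp: equivariant_on_def E.carrier_Mod \<iota> simps \<delta>_equivariant)
  moreover have "equivariant_on G (M Mod B) (quotient_action (M Mod B) \<beta>) (quotient_action (F Mod R) \<alpha>) \<pi>"
    unfolding equivariant_on_def using q_cases by (metis F.action_closed F.quotient_action_proj \<pi> q_action)
  moreover have "\<iota> ` carrier (E Mod S) = kernel (M Mod B) (F Mod R) \<pi>"
  proof (intro equalityI subsetI)
    fix X assume "X \<in> \<iota> ` carrier (E Mod S)"
    then obtain y where "y \<in> carrier E" "X = q (\<delta> y)"
      by (auto simp: E.carrier_Mod \<iota>)
    then show "X \<in> kernel (M Mod B) (F Mod R) \<pi>"
      using \<delta>_R F.proj_one_iff[of "\<delta> y"] by (simp add: kernel_def q_closed \<pi>)
  next
    fix X assume X: "X \<in> kernel (M Mod B) (F Mod R) \<pi>"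
    then obtain x where x: "x \<in> carrier F" "X = q x"
      using q_cases by (auto simp: kernel_def)
    with X have "x \<in> R"
      using F.proj_one_iff[of x] by (simp add: kernel_def \<pi>)
    then obtain y where y: "y \<in> carrier E" "\<Phi> x \<otimes>\<^bsub>M\<^esub> inv\<^bsub>M\<^esub> \<Phi> (\<delta> y) \<in> B"
      using R_\<delta> by blast
    then have "X = \<iota> (E.proj y)"
      using x by (simp add: \<iota> q_def M.proj_eq_iff)
    with y show "X \<in> \<iota> ` carrier (E Mod S)"
      by (auto simp: E.carrier_Mod)
  qed
  ultimately show ?thesis
    unfolding short_exact_sequence_of_modules_def
    using E.group_module M.group_module F.group_module by blast
qed

section \<open>Modules generated by words\<close>

lemma Cons_in_words [simp]: "x # xs \<in> words (Suc d) A \<longleftrightarrow> x \<in> A \<and> xs \<in> words d A"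
  by (auto simp: words_def)

lemma in_words_0 [simp]: "xs \<in> words 0 A \<longleftrightarrow> xs = []"
  by (auto simp: words_def)

lemma map_in_words: "(\<And>x. x \<in> A \<Longrightarrow> f x \<in> B) \<Longrightarrow> ws \<in> words d A \<Longrightarrow> map f ws \<in> words d B"
  by (auto simp: words_def)

lemma finite_words: "finite A \<Longrightarrow> finite (words d A)"
  using finite_lists_length_eq[of A d] by (simp add: words_def lists_eq_set)

instance bit :: finite
proof
  have "(UNIV :: bit set) = {0, 1}"
    by (auto intro: bit.exhaust)
  then show "finite (UNIV :: bit set)"
    by (metis finite.emptyI finite.insertI)
qed

lemma comm_group_additive_F2: "comm_group additive_F2"
proof (rule comm_groupI)
  show "\<exists>y\<in>carrier additive_F2. y \<otimes>\<^bsub>additive_F2\<^esub> x = \<one>\<^bsub>additive_F2\<^esub>" for x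
    by (rule bexI[of _ x]) (simp_all add: additive_F2_def)
qed (simp_all add: additive_F2_def ac_simps)

lemma group_additive_F2 [simp]: "group additive_F2"
  using comm_group_additive_F2 by (rule comm_group.axioms)

lemma additive_F2_simps [simp]:
  "carrier additive_F2 = UNIV" "x \<otimes>\<^bsub>additive_F2\<^esub> y = x + y" "\<one>\<^bsub>additive_F2\<^esub> = 0"
  by (simp_all add: additive_F2_def)

context
  fixes d :: nat and W :: "('w, 'c) monoid_scheme"
begin

abbreviation "FW \<equiv> free_words d W"
abbreviation "WS \<equiv> words d (carrier W)"

lemma carrier_free_words:
  "carrier FW = {F. F \<in> extensional WS \<and> finite {ws \<in> WS. F ws = 1}}"
  by (simp add: free_words_def carrier_sum_group PiE_def)

lemma free_words_mult: "F \<otimes>\<^bsub>FW\<^esub> H = (\<lambda>ws\<in>WS. F ws + H ws)"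
  by (simp add: free_words_def)

lemma free_words_one: "\<one>\<^bsub>FW\<^esub> = (\<lambda>ws\<in>WS. 0)"
  by (simp add: free_words_def)

lemma comm_group_free_words: "comm_group FW"
proof (rule group.group_comm_groupI)
  show "group FW" by (simp add: free_words_def)
qed (simp add: free_words_mult add.commute)

lemma group_free_words: "group FW"
  using comm_group_free_words by (rule comm_group.axioms)

lemma free_words_square: "F \<otimes>\<^bsub>FW\<^esub> F = \<one>\<^bsub>FW\<^esub>"
  by (simp add: free_words_mult free_words_one)

lemma free_words_inv: "F \<in> carrier FW \<Longrightarrow> inv\<^bsub>FW\<^esub> F = F"
  using group.inv_equality[OF group_free_words free_words_square] by blast

lemma word_basis_carrier: "word_basis d W ws \<in> carrier FW"
proof -
  have "{us \<in> WS. word_basis d W ws us = 1} \<subseteq> {ws}"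
    by (auto simp: word_basis_def)
  then show ?thesis
    unfolding carrier_free_words using finite_subset by (auto simp: word_basis_def)
qed

text \<open>The extension principle by which identities between homomorphisms are verified on single
  words. The induction runs over the support of \<open>F\<close>.\<close>

lemma free_words_hom_eq:
  assumes h: "h \<in> hom FW Q" and h': "h' \<in> hom FW Q" and Q: "group Q"
    and basis: "\<And>ws. ws \<in> WS \<Longrightarrow> h (word_basis d W ws) = h' (word_basis d W ws)"
    and F: "F \<in> carrier FW"
  shows "h F = h' F"
proof -
  interpret h: group_hom FW Q h
    using h Q group_free_words by (simp add: group_hom_def group_hom_axioms_def)
  interpret h': group_hom FW Q h'
    using h' Q group_free_words by (simp add: group_hom_def group_hom_axioms_def)
  have *: "finite S \<Longrightarrow> F \<in> carrier FW \<Longrightarrow> {ws \<in> WS. F ws = 1} = S \<Longrightarrow> h F = h' F" for S F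
  proof (induction S arbitrary: F rule: finite_induct)
    case empty
    then have "F ws = \<one>\<^bsub>FW\<^esub> ws" for ws
      by (cases "ws \<in> WS") (auto simp: free_words_one carrier_free_words extensional_def)
    then have "F = \<one>\<^bsub>FW\<^esub>" by auto
    then show ?case by simp
  next
    case (insert ws S)
    \<comment> \<open>Every element has order at most two, so multiplying by this basis vector
      removes \<open>ws\<close> from the support, and multiplying once more restores
      \<open>F\<close>.\<close>
    define H where "H = F \<otimes>\<^bsub>FW\<^esub> word_basis d W ws"
    have ws: "ws \<in> WS" using insert.prems by auto
    have H: "H \<in> carrier FW"
      unfolding H_def using insert.prems word_basis_carrier by auto
    have F_ws: "F ws = 1" using insert.prems(2) by blast
    have "H us = (if us = ws then 0 else F us)" if "us \<in> WS" for us
      using that F_ws by (simp add: H_def free_words_mult word_basis_def)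
    then have "{us \<in> WS. H us = 1} = {us \<in> WS. F us = 1} - {ws}"
      by (auto split: if_splits)
    then have "{us \<in> WS. H us = 1} = S"
      using insert.hyps(2) insert.prems(2) by simp
    then have IH: "h H = h' H" using insert.IH H by blast
    have "F = H \<otimes>\<^bsub>FW\<^esub> word_basis d W ws"
      unfolding H_def using insert.prems word_basis_carrier
      by (simp add: h.G.m_assoc free_words_square)
    with H IH basis[OF ws] word_basis_carrier show ?case by simp
  qed
  have "finite {ws \<in> WS. F ws = 1}"
    using F by (simp add: carrier_free_words)
  from *[OF this F refl] show ?thesis .
qed

lemma tensor_relations_carrier: "tensor_relations d W \<subseteq> carrier FW"
  by (auto simp: tensor_relations_def free_words_inv group.is_monoid[OF group_free_words]
      word_basis_carrier intro!: monoid.m_closed group.inv_closed[OF group_free_words])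

lemma symmetric_relations_carrier: "symmetric_relations d W \<subseteq> carrier FW"
  by (auto simp: symmetric_relations_def free_words_inv group.is_monoid[OF group_free_words]
      word_basis_carrier intro!: monoid.m_closed group.inv_closed[OF group_free_words])

lemma exterior_relations_carrier: "exterior_relations d W \<subseteq> carrier FW"
  by (auto simp: exterior_relations_def word_basis_carrier)

end

section \<open>Induced actions on sums of words and on their quotients\<close>

locale group_action_on_group =
  G: group G + W: comm_group W for G (structure) and W (structure) +
  fixes \<rho> :: "'g \<Rightarrow> 'w \<Rightarrow> 'w"
  assumes hom: "g \<in> carrier G \<Longrightarrow> \<rho> g \<in> hom W W"
    and mult: "\<lbrakk>g \<in> carrier G; h \<in> carrier G; x \<in> carrier W\<rbrakk> \<Longrightarrow> \<rho> (g \<otimes>\<^bsub>G\<^esub> h) x = \<rho> g (\<rho> h x)"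
    and one: "x \<in> carrier W \<Longrightarrow> \<rho> \<one>\<^bsub>G\<^esub> x = x"
begin

lemma closed: "\<lbrakk>g \<in> carrier G; x \<in> carrier W\<rbrakk> \<Longrightarrow> \<rho> g x \<in> carrier W"
  using hom by (auto simp: hom_def)

lemma map_closed: "\<lbrakk>g \<in> carrier G; ws \<in> words d (carrier W)\<rbrakk> \<Longrightarrow> map (\<rho> g) ws \<in> words d (carrier W)"
  using closed map_in_words by metis

lemma map_mult:
  "\<lbrakk>g \<in> carrier G; h \<in> carrier G; ws \<in> words d (carrier W)\<rbrakk>
    \<Longrightarrow> map (\<rho> (g \<otimes>\<^bsub>G\<^esub> h)) ws = map (\<rho> g) (map (\<rho> h) ws)"
  by (auto simp: words_def mult)

lemma map_one: "ws \<in> words d (carrier W) \<Longrightarrow> map (\<rho> \<one>\<^bsub>G\<^esub>) ws = ws"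
  by (auto simp: words_def one intro!: map_idI)

lemma map_inv:
  assumes "g \<in> carrier G" "ws \<in> words d (carrier W)"
  shows "map (\<rho> (inv\<^bsub>G\<^esub> g)) (map (\<rho> g) ws) = ws" "map (\<rho> g) (map (\<rho> (inv\<^bsub>G\<^esub> g)) ws) = ws"
  using assms map_mult[of "inv\<^bsub>G\<^esub> g" g ws d] map_mult[of g "inv\<^bsub>G\<^esub> g" ws d] map_one[of ws d]
  by auto

abbreviation "act d \<equiv> free_words_action G d W \<rho>"

lemma act_apply: "ws \<in> words d (carrier W) \<Longrightarrow> act d g F ws = F (map (\<rho> (inv\<^bsub>G\<^esub> g)) ws)"
  by (simp add: free_words_action_def precomp_def)

lemma act_carrier:
  assumes "g \<in> carrier G" "F \<in> carrier (free_words d W)"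
  shows "act d g F \<in> carrier (free_words d W)"
proof -
  have "{ws \<in> words d (carrier W). act d g F ws = 1}
      \<subseteq> map (\<rho> g) ` {ws \<in> words d (carrier W). F ws = 1}"
  proof
    fix ws assume "ws \<in> {ws \<in> words d (carrier W). act d g F ws = 1}"
    then show "ws \<in> map (\<rho> g) ` {ws \<in> words d (carrier W). F ws = 1}"
      using map_inv(2)[OF assms(1), of ws d] map_closed[of "inv\<^bsub>G\<^esub> g" ws d] assms(1)
      by (auto simp: act_apply intro!: image_eqI[of ws _ "map (\<rho> (inv\<^bsub>G\<^esub> g)) ws"])
  qed
  moreover have "finite {ws \<in> words d (carrier W). F ws = 1}"
    using assms(2) by (simp add: carrier_free_words)
  ultimately have "finite {ws \<in> words d (carrier W). act d g F ws = 1}"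
    by (meson finite_imageI finite_subset)
  then show ?thesis
    by (simp add: carrier_free_words free_words_action_def precomp_def)
qed

lemma act_hom: "g \<in> carrier G \<Longrightarrow> act d g \<in> hom (free_words d W) (free_words d W)"
proof (rule homI)
  fix F H assume "g \<in> carrier G"
  show "act d g (F \<otimes>\<^bsub>free_words d W\<^esub> H) = act d g F \<otimes>\<^bsub>free_words d W\<^esub> act d g H"
    using map_closed[of "inv\<^bsub>G\<^esub> g" _ d] \<open>g \<in> carrier G\<close>
    by (auto simp: free_words_mult act_apply free_words_action_def precomp_def intro!: restrict_ext)
qed (rule act_carrier)

lemma act_basis:
  assumes "g \<in> carrier G" "ws \<in> words d (carrier W)"
  shows "act d g (word_basis d W ws) = word_basis d W (map (\<rho> g) ws)"
  unfolding free_words_action_def precomp_def word_basis_def[of d W "map (\<rho> g) ws"]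
proof (rule restrict_ext)
  fix us assume us: "us \<in> words d (carrier W)"
  have "map (\<rho> (inv\<^bsub>G\<^esub> g)) us = ws \<longleftrightarrow> us = map (\<rho> g) ws"
    using assms us map_inv by metis
  then show "word_basis d W ws (map (\<rho> (inv\<^bsub>G\<^esub> g)) us) = (if us = map (\<rho> g) ws then 1 else 0)"
    using assms us map_closed[of "inv\<^bsub>G\<^esub> g" us d] by (simp add: word_basis_def)
qed

lemma act_mult_apply:
  assumes "g \<in> carrier G" "h \<in> carrier G"
  shows "act d (g \<otimes>\<^bsub>G\<^esub> h) F = act d g (act d h F)"
  unfolding free_words_action_def precomp_def
proof (rule restrict_ext)
  fix ws assume ws: "ws \<in> words d (carrier W)"
  then show "F (map (\<rho> (inv\<^bsub>G\<^esub> (g \<otimes>\<^bsub>G\<^esub> h))) ws)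
      = (\<lambda>ws\<in>words d (carrier W). F (map (\<rho> (inv\<^bsub>G\<^esub> h)) ws)) (map (\<rho> (inv\<^bsub>G\<^esub> g)) ws)"
    using assms map_closed[of "inv\<^bsub>G\<^esub> g" ws d] map_mult[of "inv\<^bsub>G\<^esub> h" "inv\<^bsub>G\<^esub> g" ws d]
    by (simp add: G.inv_mult_group del: map_map)
qed

lemma act_one:
  assumes "F \<in> carrier (free_words d W)"
  shows "act d \<one>\<^bsub>G\<^esub> F = F"
proof
  show "act d \<one>\<^bsub>G\<^esub> F ws = F ws" for ws
    using assms map_one[of ws d]
    by (cases "ws \<in> words d (carrier W)")
      (auto simp: free_words_action_def precomp_def carrier_free_words extensional_def)
qed

text \<open>The image of a span is the span of the image, so stability has to be checked only on the
  relations themselves.\<close>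

lemma quotient_module_generate:
  assumes R: "R \<subseteq> carrier (free_words d W)"
    and stable: "\<And>g x. \<lbrakk>g \<in> carrier G; x \<in> R\<rbrakk> \<Longrightarrow> act d g x \<in> R"
  shows "quotient_module G (free_words d W) (generate (free_words d W) R) (act d)"
proof -
  interpret F: comm_group "free_words d W" by (rule comm_group_free_words)
  show ?thesis
  proof (intro quotient_module.intro quotient_module_axioms.intro)
    show "subgroup (generate (free_words d W) R) (free_words d W)"
      using R by (rule F.generate_is_subgroup)
    show "act d g x \<in> generate (free_words d W) R"
      if "g \<in> carrier G" "x \<in> generate (free_words d W) R" for g x
    proof -
      interpret a: group_hom "free_words d W" "free_words d W" "act d g"
        using act_hom[OF that(1)] F.group_axioms by (simp add: group_hom_def group_hom_axioms_def)
      have "act d g ` R \<subseteq> R" using stable that(1) by auto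
      then show ?thesis
        using a.generate_img[OF R] that(2) F.mono_generate[of "act d g ` R" R] by blast
    qed
  qed (use act_hom act_mult_apply act_one G.group_axioms F.comm_group_axioms in auto)
qed

lemma act_mult_basis:
  assumes "g \<in> carrier G" "x \<in> carrier (free_words d W)" "y \<in> carrier (free_words d W)"
  shows "act d g (x \<otimes>\<^bsub>free_words d W\<^esub> inv\<^bsub>free_words d W\<^esub> y)
    = act d g x \<otimes>\<^bsub>free_words d W\<^esub> inv\<^bsub>free_words d W\<^esub> act d g y"
  using hom_mult[OF act_hom[OF assms(1)]] assms act_carrier by (simp add: free_words_inv)

lemma act_tensor_relations:
  assumes g: "g \<in> carrier G" and "r \<in> tensor_relations d W"
  shows "act d g r \<in> tensor_relations d W"
proof -
  let ?b = "word_basis d W" and ?F = "free_words d W"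
  interpret F: comm_group ?F by (rule comm_group_free_words)
  obtain us x y vs where w: "us @ [x] @ vs \<in> words d (carrier W)" "y \<in> carrier W"
    and r: "r = ?b (us @ [x \<otimes>\<^bsub>W\<^esub> y] @ vs)
        \<otimes>\<^bsub>?F\<^esub> inv\<^bsub>?F\<^esub> (?b (us @ [x] @ vs) \<otimes>\<^bsub>?F\<^esub> ?b (us @ [y] @ vs))"
    using assms(2) by (auto simp: tensor_relations_def)
  have w': "us @ [x \<otimes>\<^bsub>W\<^esub> y] @ vs \<in> words d (carrier W)" "us @ [y] @ vs \<in> words d (carrier W)"
    using w by (auto simp: words_def)
  have xy: "x \<in> carrier W" using w by (auto simp: words_def)
  let ?m = "map (\<rho> g)"
  have "act d g r = ?b (?m us @ [\<rho> g x \<otimes>\<^bsub>W\<^esub> \<rho> g y] @ ?m vs)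
        \<otimes>\<^bsub>?F\<^esub> inv\<^bsub>?F\<^esub> (?b (?m us @ [\<rho> g x] @ ?m vs) \<otimes>\<^bsub>?F\<^esub> ?b (?m us @ [\<rho> g y] @ ?m vs))"
    unfolding r using g w w' hom_mult[OF act_hom[OF g]] hom_mult[OF hom[OF g] xy w(2)]
    by (simp add: act_mult_basis act_basis word_basis_carrier)
  moreover have "?m us @ [\<rho> g x] @ ?m vs \<in> words d (carrier W)" "\<rho> g y \<in> carrier W"
    using map_closed[OF g w(1)] closed[OF g w(2)] by simp_all
  ultimately show ?thesis
    unfolding tensor_relations_def by blast
qed

lemma act_symmetric_relations:
  assumes g: "g \<in> carrier G" and "r \<in> symmetric_relations d W"
  shows "act d g r \<in> symmetric_relations d W"
proof -
  let ?b = "word_basis d W" and ?F = "free_words d W"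
  interpret F: comm_group ?F by (rule comm_group_free_words)
  obtain us x y vs where w: "us @ [x, y] @ vs \<in> words d (carrier W)"
    and r: "r = ?b (us @ [x, y] @ vs) \<otimes>\<^bsub>?F\<^esub> inv\<^bsub>?F\<^esub> ?b (us @ [y, x] @ vs)"
    using assms(2) by (auto simp: symmetric_relations_def)
  have w': "us @ [y, x] @ vs \<in> words d (carrier W)"
    using w by (auto simp: words_def)
  let ?m = "map (\<rho> g)"
  have "act d g r = ?b (?m us @ [\<rho> g x, \<rho> g y] @ ?m vs) \<otimes>\<^bsub>?F\<^esub> inv\<^bsub>?F\<^esub> ?b (?m us @ [\<rho> g y, \<rho> g x] @ ?m vs)"
    unfolding r using g w w' by (simp add: act_mult_basis act_basis word_basis_carrier)
  moreover have "?m us @ [\<rho> g x, \<rho> g y] @ ?m vs \<in> words d (carrier W)"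
    using map_closed[OF g w] by simp
  ultimately show ?thesis
    unfolding symmetric_relations_def by blast
qed

lemma act_exterior_relations:
  assumes g: "g \<in> carrier G" and "r \<in> exterior_relations d W"
  shows "act d g r \<in> exterior_relations d W"
proof -
  obtain us x vs where w: "us @ [x, x] @ vs \<in> words d (carrier W)"
    and r: "r = word_basis d W (us @ [x, x] @ vs)"
    using assms(2) by (auto simp: exterior_relations_def)
  let ?m = "map (\<rho> g)"
  have "act d g r = word_basis d W (?m us @ [\<rho> g x, \<rho> g x] @ ?m vs)"
    unfolding r using g w by (simp add: act_basis)
  moreover have "?m us @ [\<rho> g x, \<rho> g x] @ ?m vs \<in> words d (carrier W)"
    using map_closed[OF g w] by simp
  ultimately show ?thesis
    unfolding exterior_relations_def by blast
qed

end

section \<open>The general linear group and the dual space\<close>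

lemma matrix_inv_mult:
  assumes "invertible (A :: 'a::semiring_1 ^ 'n ^ 'm)"
  shows "A ** matrix_inv A = mat 1" "matrix_inv A ** A = mat 1"
  using someI_ex[OF assms[unfolded invertible_def]] by (simp_all add: matrix_inv_def)

lemma invertible_matrix_inv: "invertible A \<Longrightarrow> invertible (matrix_inv A)"
  using matrix_inv_mult[of A] by (auto simp: invertible_def)

lemma GL_F2_simps:
  "A \<in> carrier GL_F2 \<longleftrightarrow> invertible A" "A \<otimes>\<^bsub>GL_F2\<^esub> B = A ** B" "\<one>\<^bsub>GL_F2\<^esub> = mat 1"
  by (simp_all add: GL_F2_def)

lemma group_GL_F2: "group (GL_F2 :: (bit ^ 'n::finite ^ 'n) monoid)"
proof (rule groupI)
  fix A B C :: "bit ^ 'n ^ 'n"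
  show "\<one>\<^bsub>GL_F2\<^esub> \<in> carrier (GL_F2 :: (bit ^ 'n ^ 'n) monoid)"
    unfolding GL_F2_simps invertible_def by (metis matrix_mul_lid)
  show "A \<otimes>\<^bsub>GL_F2\<^esub> B \<otimes>\<^bsub>GL_F2\<^esub> C = A \<otimes>\<^bsub>GL_F2\<^esub> (B \<otimes>\<^bsub>GL_F2\<^esub> C)"
    unfolding GL_F2_simps by (metis matrix_mul_assoc)
  show "\<one>\<^bsub>GL_F2\<^esub> \<otimes>\<^bsub>GL_F2\<^esub> A = A"
    unfolding GL_F2_simps by (rule matrix_mul_lid)
  show "A \<otimes>\<^bsub>GL_F2\<^esub> B \<in> carrier GL_F2" if "A \<in> carrier GL_F2" "B \<in> carrier GL_F2"
    using that unfolding GL_F2_simps by (rule invertible_mult)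
  show "\<exists>B\<in>carrier GL_F2. B \<otimes>\<^bsub>GL_F2\<^esub> A = \<one>\<^bsub>GL_F2\<^esub>" if "A \<in> carrier GL_F2"
    using that unfolding Bex_def GL_F2_simps
    by (metis invertible_matrix_inv matrix_inv_mult(2))
qed

lemma GL_F2_act:
  "g \<in> carrier GL_F2 \<Longrightarrow> h \<in> carrier GL_F2 \<Longrightarrow> (g \<otimes>\<^bsub>GL_F2\<^esub> h) *v v = g *v (h *v v)"
  "\<one>\<^bsub>GL_F2\<^esub> *v v = v"
  by (simp_all add: GL_F2_simps matrix_vector_mul_assoc)

lemma linear_bit_iff:
  fixes f :: "bit ^ 'n::finite \<Rightarrow> bit"
  shows "Vector_Spaces.linear (*s) (*) f \<longleftrightarrow> (\<forall>x y. f (x + y) = f x + f y)"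
proof
  assume add: "\<forall>x y. f (x + y) = f x + f y"
  then have zero: "f 0 = 0" by (metis add_cancel_right_right)
  have "f (c *s x) = c * f x" for c x
    by (cases c) (simp_all add: zero)
  with add show "Vector_Spaces.linear (*s) (*) f"
    by unfold_locales (auto simp: algebra_simps)
next
  assume "Vector_Spaces.linear (*s) (*) f"
  then interpret Vector_Spaces.linear "(*s)" "(*)" f .
  show "\<forall>x y. f (x + y) = f x + f y"
    by (simp add: add)
qed

lemma dual_F2_simps:
  "f \<in> carrier dual_F2 \<longleftrightarrow> (\<forall>x y. f (x + y) = f x + f y)"
  "f \<otimes>\<^bsub>dual_F2\<^esub> g = (\<lambda>v. f v + g v)" "\<one>\<^bsub>dual_F2\<^esub> = (\<lambda>_. 0)"
  by (simp_all add: dual_F2_def linear_bit_iff)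

lemma comm_group_dual_F2: "comm_group (dual_F2 :: (bit ^ 'n::finite \<Rightarrow> bit) monoid)"
proof (rule comm_groupI)
  show "\<exists>g\<in>carrier dual_F2. g \<otimes>\<^bsub>dual_F2\<^esub> f = \<one>\<^bsub>dual_F2\<^esub>"
    if "f \<in> carrier dual_F2" for f :: "bit ^ 'n \<Rightarrow> bit"
    using that by (intro bexI[of _ f]) (simp_all add: dual_F2_simps)
qed (auto simp: dual_F2_simps ac_simps)

lemma dual_action_module:
  "group_action_on_group (GL_F2 :: (bit ^ 'n::finite ^ 'n) monoid) dual_F2 dual_action"
proof -
  interpret G: group "GL_F2 :: (bit ^ 'n ^ 'n) monoid" by (rule group_GL_F2)
  show ?thesis
    by (intro group_action_on_group.intro group_action_on_group_axioms.intro
        group_GL_F2 comm_group_dual_F2 homI)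
      (auto simp: dual_F2_simps dual_action_def matrix_vector_right_distrib G.inv_mult_group GL_F2_act)
qed

section \<open>Cochains with values in the units\<close>

text \<open>The units are written additively, so that the cochain identities become identities in
  abelian groups, which \<open>algebra_simps\<close> decides.\<close>

typedef (overloaded) 'k additive_units = "{x :: 'k::field. x \<noteq> 0}"
  morphisms unit_value unit_of
  by (rule exI[of _ 1]) simp

setup_lifting type_definition_additive_units

instantiation additive_units :: (field) ab_group_add
begin

lift_definition zero_additive_units :: "'a additive_units" is 1 by simp
lift_definition plus_additive_units :: "'a additive_units \<Rightarrow> 'a additive_units \<Rightarrow> 'a additive_units"
  is "(*)" by simp
lift_definition uminus_additive_units :: "'a additive_units \<Rightarrow> 'a additive_units"
  is inverse by simp
lift_definition minus_additive_units :: "'a additive_units \<Rightarrow> 'a additive_units \<Rightarrow> 'a additive_units"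
  is "(/)" by simp

instance
  by standard (transfer; simp add: field_simps)+

end

lemma unit_value_nonzero [simp]: "unit_value a \<noteq> 0"
  using unit_value by blast

lift_definition minus_one_unit :: "'k::field additive_units" is "- 1" by simp

lemma minus_one_unit_nonzero: "minus_one_unit \<noteq> (0 :: 'k::field_char_0 additive_units)"
  by transfer simp

lemma two_torsion_additive_units:
  fixes a :: "'k::field additive_units"
  shows "a + a = 0 \<longleftrightarrow> a = 0 \<or> a = minus_one_unit"
  by transfer (metis mult_cancel_left2 mult_minus_left mult_minus_right square_eq_1_iff verit_minus_simplify(4))

lemma divisible_additive_units:
  fixes a :: "'k::alg_closed_field additive_units"
  shows "\<exists>b. b + b = a"
proof transfer
  fix a :: 'k assume "a \<noteq> 0"
  obtain b where "b ^ 2 = a"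
    using nth_root_exists[of 2 a] by auto
  with \<open>a \<noteq> 0\<close> show "\<exists>b\<in>{x. x \<noteq> 0}. b * b = a"
    by (intro bexI[of _ b]) (auto simp: power2_eq_square)
qed

lemma words_3_iff: "xs \<in> words 3 A \<longleftrightarrow> (\<exists>x\<in>A. \<exists>y\<in>A. \<exists>z\<in>A. xs = [x, y, z])"
  by (auto simp: words_def numeral_3_eq_3 length_Suc_conv)

lemma words_2_iff: "xs \<in> words 2 A \<longleftrightarrow> (\<exists>x\<in>A. \<exists>y\<in>A. xs = [x, y])"
  by (auto simp: words_def numeral_2_eq_2 length_Suc_conv)

lemma words_4_iff: "xs \<in> words 4 A \<longleftrightarrow> (\<exists>x\<in>A. \<exists>y\<in>A. \<exists>z\<in>A. \<exists>w\<in>A. xs = [x, y, z, w])"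
  by (auto simp: words_def eval_nat_numeral length_Suc_conv)

lemma group_field_units: "group (field_units :: 'k::field monoid)"
proof (rule groupI)
  show "\<exists>y\<in>carrier field_units. y \<otimes>\<^bsub>field_units\<^esub> x = \<one>\<^bsub>field_units\<^esub>"
    if "x \<in> carrier field_units" for x :: 'k
    using that by (intro bexI[of _ "inverse x"]) (auto simp: field_units_def)
qed (auto simp: field_units_def)

lemma comm_group_cochains: "comm_group (cochains n :: ('v::group_add list \<Rightarrow> 'k::field) monoid)"
  by (rule group.group_comm_groupI)
    (auto simp: cochains_def group_field_units, auto simp: field_units_def mult.commute)

text \<open>The bridge between curried, additively written cochains and the extensional functions on
  lists that define the cohomology group. Every 3-cochain has this form by
  \<open>cochain3_cases\<close>, so that cocycles and coboundaries turn into equations for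
  \<open>d3\<close> and \<open>d2\<close>.\<close>

definition cochain3 :: "('v \<Rightarrow> 'v \<Rightarrow> 'v \<Rightarrow> 'k::field additive_units) \<Rightarrow> 'v list \<Rightarrow> 'k" where
  "cochain3 f = (\<lambda>xs\<in>words 3 UNIV. unit_value (f (xs ! 0) (xs ! 1) (xs ! 2)))"

lemma cochain3_apply [simp]: "cochain3 f [x, y, z] = unit_value (f x y z)"
  by (simp add: cochain3_def words_3_iff)

lemma cochain3_carrier: "cochain3 f \<in> carrier (cochains 3)"
  by (simp add: cochains_def cochain3_def field_units_def)

lemma cochain3_cases:
  fixes c :: "'v::group_add list \<Rightarrow> 'k::field"
  assumes "c \<in> carrier (cochains 3)"
  obtains f where "c = cochain3 f"
proof
  show "c = cochain3 (\<lambda>x y z. unit_of (c [x, y, z]))"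
  proof (rule extensionalityI)
    show "c \<in> extensional (words 3 UNIV)"
      using assms by (simp add: cochains_def PiE_def)
    show "cochain3 (\<lambda>x y z. unit_of (c [x, y, z])) \<in> extensional (words 3 UNIV)"
      by (simp add: cochain3_def)
    show "c xs = cochain3 (\<lambda>x y z. unit_of (c [x, y, z])) xs" if "xs \<in> words 3 UNIV" for xs
    proof -
      have "c xs \<noteq> 0"
        using assms that by (auto simp: cochains_def field_units_def PiE_iff)
      with that show ?thesis
        by (auto simp: words_3_iff unit_of_inverse)
    qed
  qed
qed

lemma cochain3_eq_iff: "cochain3 f = cochain3 g \<longleftrightarrow> f = g"
  by (metis (no_types, lifting) cochain3_apply ext unit_value_inject)

lemma cochain3_mult: "cochain3 f \<otimes>\<^bsub>cochains 3\<^esub> cochain3 g = cochain3 (\<lambda>x y z. f x y z + g x y z)"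
  by (auto simp: cochains_def cochain3_def field_units_def plus_additive_units.rep_eq)

lemma cochain3_one: "\<one>\<^bsub>cochains 3\<^esub> = cochain3 (\<lambda>_ _ _. 0)"
  by (auto simp: cochains_def cochain3_def field_units_def zero_additive_units.rep_eq)

lemma cochain3_inv: "inv\<^bsub>cochains 3\<^esub> cochain3 f = cochain3 (\<lambda>x y z. - f x y z)"
proof -
  interpret C: comm_group "cochains 3" by (rule comm_group_cochains)
  show ?thesis
    by (rule C.inv_equality) (auto simp: cochain3_mult cochain3_one cochain3_carrier)
qed

lemma precomp_cochain3: "precomp 3 UNIV h (cochain3 f) = cochain3 (\<lambda>x y z. f (h x) (h y) (h z))"
  by (auto simp: precomp_def cochain3_def words_3_iff intro!: restrict_ext)

lemma cochain3_cocycle_iff: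
  fixes f :: "'v::ab_group_add \<Rightarrow> 'v \<Rightarrow> 'v \<Rightarrow> 'k::field additive_units"
  shows "cochain3 f \<in> cocycles 3 \<longleftrightarrow> (\<forall>x y z w. d3 f x y z w = 0)"
proof -
  have eq: "coboundary 3 (cochain3 f) [x, y, z, w] = unit_value (d3 f x y z w)" for x y z w
    by (simp add: coboundary_def words_4_iff merge_at_def eval_nat_numeral d3_def
        plus_additive_units.rep_eq minus_additive_units.rep_eq field_simps)
  have "cochain3 f \<in> cocycles 3 \<longleftrightarrow> coboundary 3 (cochain3 f) = (\<lambda>xs\<in>words 4 UNIV. 1)"
    by (simp add: cocycles_def kernel_def cochain3_carrier) (simp add: cochains_def field_units_def)
  also have "\<dots> \<longleftrightarrow> (\<forall>xs\<in>words 4 UNIV. coboundary 3 (cochain3 f) xs = 1)"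
    by (auto simp: coboundary_def fun_eq_iff restrict_def)
  also have "\<dots> \<longleftrightarrow> (\<forall>x y z w. unit_value (d3 f x y z w) = 1)"
    unfolding eq[symmetric] by (auto simp: words_4_iff)
  finally show ?thesis
    by (metis unit_value_inject zero_additive_units.rep_eq)
qed

lemma coboundaries_3:
  "coboundaries 3 =
    range (\<lambda>g. cochain3 (d2 g) :: 'v::ab_group_add list \<Rightarrow> 'k::field)"
proof -
  define cochain2 :: "('v \<Rightarrow> 'v \<Rightarrow> 'k additive_units) \<Rightarrow> 'v list \<Rightarrow> 'k"
    where "cochain2 g = (\<lambda>xs\<in>words 2 UNIV. unit_value (g (xs ! 0) (xs ! 1)))" for g
  have apply2: "cochain2 g [x, y] = unit_value (g x y)" for g x y
    by (simp add: cochain2_def words_2_iff)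
  have carrier2: "carrier (cochains 2) = range cochain2"
  proof
    show "range cochain2 \<subseteq> carrier (cochains 2)"
      by (auto simp: cochains_def cochain2_def field_units_def)
    show "carrier (cochains 2) \<subseteq> range cochain2"
    proof
      fix c :: "'v list \<Rightarrow> 'k" assume c: "c \<in> carrier (cochains 2)"
      have "c = cochain2 (\<lambda>x y. unit_of (c [x, y]))"
      proof (rule extensionalityI)
        show "c xs = cochain2 (\<lambda>x y. unit_of (c [x, y])) xs" if "xs \<in> words 2 UNIV" for xs
        proof -
          have "c xs \<noteq> 0"
            using c that by (auto simp: cochains_def field_units_def PiE_iff)
          with that show ?thesis
            by (auto simp: words_2_iff apply2 unit_of_inverse)
        qed
      qed (use c in \<open>auto simp: cochains_def PiE_def cochain2_def\<close>)
      then show "c \<in> range cochain2" by blast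
    qed
  qed
  have cob: "coboundary 2 (cochain2 g) = cochain3 (d2 g)" for g
  proof -
    have "coboundary 2 (cochain2 g) [x, y, z] = unit_value (d2 g x y z)" for x y z
      by (simp add: coboundary_def words_3_iff[unfolded numeral_3_eq_3] merge_at_def eval_nat_numeral
          apply2[unfolded numeral_2_eq_2] d2_def plus_additive_units.rep_eq minus_additive_units.rep_eq field_simps)
    moreover have "coboundary 2 (cochain2 g) \<in> extensional (words 3 UNIV)"
      by (simp add: coboundary_def)
    moreover have "cochain3 (d2 g) \<in> extensional (words 3 UNIV)"
      by (simp add: cochain3_def)
    ultimately show ?thesis
      by (intro extensionalityI[of _ "words 3 UNIV"]) (auto simp: words_3_iff)
  qed
  have "coboundaries 3 = coboundary 2 ` carrier (cochains 2 :: ('v list \<Rightarrow> 'k) monoid)"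
    by (simp add: coboundaries_def numeral_3_eq_3 numeral_2_eq_2)
  then show ?thesis
    by (simp add: carrier2 image_image cob)
qed

lemma cochain3_coboundary_iff:
  fixes f :: "'v::ab_group_add \<Rightarrow> 'v \<Rightarrow> 'v \<Rightarrow> 'k::field additive_units"
  shows "cochain3 f \<in> coboundaries 3 \<longleftrightarrow> (\<exists>g. f = d2 g)"
  by (auto simp: coboundaries_3 cochain3_eq_iff)

lemma quotient_module_cohomology_3:
  fixes G :: "('g, 'x) monoid_scheme" and \<rho> :: "'g \<Rightarrow> 'v \<Rightarrow> 'v::ab_group_add"
  assumes G: "group G"
    and add: "\<And>g x y. g \<in> carrier G \<Longrightarrow> \<rho> g (x + y) = \<rho> g x + \<rho> g y"
    and mult: "\<And>g h x. \<lbrakk>g \<in> carrier G; h \<in> carrier G\<rbrakk> \<Longrightarrow> \<rho> (g \<otimes>\<^bsub>G\<^esub> h) x = \<rho> g (\<rho> h x)"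
    and one: "\<And>x. \<rho> \<one>\<^bsub>G\<^esub> x = x"
  shows "quotient_module G ((cochains 3 :: ('v list \<Rightarrow> 'k::field) monoid)\<lparr>carrier := cocycles 3\<rparr>)
    (coboundaries 3) (\<lambda>g. precomp 3 UNIV (\<rho> (inv\<^bsub>G\<^esub> g)))"
proof -
  let ?C = "cochains 3 :: ('v list \<Rightarrow> 'k) monoid"
  let ?Z = "?C\<lparr>carrier := cocycles 3\<rparr>"
  interpret G: group G by (rule G)
  interpret C: comm_group ?C by (rule comm_group_cochains)
  have cases: "\<exists>f. c = cochain3 f \<and> (\<forall>x y z w. d3 f x y z w = 0)"
    if "c \<in> cocycles 3" for c :: "'v list \<Rightarrow> 'k"
  proof -
    have "c \<in> carrier ?C"
      using that by (simp add: cocycles_def kernel_def)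
    then obtain f where "c = cochain3 f" by (rule cochain3_cases)
    with that show ?thesis by (auto simp: cochain3_cocycle_iff)
  qed
  have d3_add: "d3 (\<lambda>x y z. f x y z + g x y z) x y z w = d3 f x y z w + d3 g x y z w"
    and d3_minus: "d3 (\<lambda>x y z. - f x y z) x y z w = - d3 f x y z w"
    for f g :: "'v \<Rightarrow> 'v \<Rightarrow> 'v \<Rightarrow> 'k additive_units" and x y z w
    by (simp_all add: d3_def algebra_simps)
  have d3_zero: "d3 (\<lambda>_ _ _. 0) x y z w = (0 :: 'k additive_units)" for x y z w :: 'v
    by (simp add: d3_def)
  have Z: "subgroup (cocycles 3) ?C"
  proof (rule C.subgroupI)
    show "cocycles 3 \<subseteq> carrier ?C" by (auto simp: cocycles_def kernel_def)
    show "cocycles 3 \<noteq> ({} :: ('v list \<Rightarrow> 'k) set)"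
      using cochain3_cocycle_iff[of "\<lambda>_ _ _. 0"] by (auto simp: d3_zero)
  qed (auto dest!: cases simp: cochain3_mult cochain3_inv cochain3_cocycle_iff d3_add d3_minus)
  have comm: "comm_group ?Z"
  proof (rule group.group_comm_groupI)
    show "group ?Z" using C.subgroup_imp_group[OF Z] .
    show "x \<otimes>\<^bsub>?Z\<^esub> y = y \<otimes>\<^bsub>?Z\<^esub> x" if "x \<in> carrier ?Z" "y \<in> carrier ?Z" for x y
      using that subgroup.subset[OF Z] by (auto intro: C.m_comm)
  qed
  interpret Z: comm_group ?Z by (rule comm)
  have B_cocycles: "coboundaries 3 \<subseteq> carrier ?Z"
    by (auto simp: coboundaries_3 cochain3_cocycle_iff d3_d2)
  have d2_add: "(\<lambda>x y z. d2 g x y z + d2 h x y z) = d2 (\<lambda>x y. g x y + h x y)"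
    and d2_minus: "(\<lambda>x y z. - d2 g x y z) = d2 (\<lambda>x y. - g x y)"
    for g h :: "'v \<Rightarrow> 'v \<Rightarrow> 'k additive_units"
    by (simp_all add: d2_def fun_eq_iff algebra_simps)
  have B: "subgroup (coboundaries 3) ?Z"
  proof (rule Z.subgroupI[OF B_cocycles])
    show "inv\<^bsub>?Z\<^esub> c \<in> coboundaries 3" if "c \<in> coboundaries 3" for c :: "'v list \<Rightarrow> 'k"
    proof -
      have "inv\<^bsub>?Z\<^esub> c = inv\<^bsub>?C\<^esub> c"
        using C.m_inv_consistent[OF Z, of c] that B_cocycles by auto
      with that show ?thesis
        by (auto simp: coboundaries_3 cochain3_inv d2_minus)
    qed
  qed (auto simp: coboundaries_3 cochain3_mult d2_add)
  show ?thesis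
  proof (intro quotient_module.intro quotient_module_axioms.intro)
    fix g assume g: "g \<in> carrier G"
    note add' = add[OF G.inv_closed[OF g]]
    have d3_precomp: "d3 (\<lambda>x y z. f (\<rho> (inv\<^bsub>G\<^esub> g) x) (\<rho> (inv\<^bsub>G\<^esub> g) y) (\<rho> (inv\<^bsub>G\<^esub> g) z)) x y z w
      = d3 f (\<rho> (inv\<^bsub>G\<^esub> g) x) (\<rho> (inv\<^bsub>G\<^esub> g) y) (\<rho> (inv\<^bsub>G\<^esub> g) z) (\<rho> (inv\<^bsub>G\<^esub> g) w)"
      for f :: "'v \<Rightarrow> 'v \<Rightarrow> 'v \<Rightarrow> 'k additive_units" and x y z w
      by (simp add: d3_def add')
    show "precomp 3 UNIV (\<rho> (inv\<^bsub>G\<^esub> g)) \<in> hom ?Z ?Z"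
      by (rule homI)
        (auto dest!: cases simp: precomp_cochain3 cochain3_mult cochain3_cocycle_iff d3_precomp)
    show "precomp 3 UNIV (\<rho> (inv\<^bsub>G\<^esub> g)) c \<in> coboundaries 3" if "c \<in> coboundaries 3" for c :: "'v list \<Rightarrow> 'k"
    proof -
      have "(\<lambda>x y z. d2 h (\<rho> (inv\<^bsub>G\<^esub> g) x) (\<rho> (inv\<^bsub>G\<^esub> g) y) (\<rho> (inv\<^bsub>G\<^esub> g) z))
        = d2 (\<lambda>x y. h (\<rho> (inv\<^bsub>G\<^esub> g) x) (\<rho> (inv\<^bsub>G\<^esub> g) y))"
        for h :: "'v \<Rightarrow> 'v \<Rightarrow> 'k additive_units"
        by (simp add: d2_def add' fun_eq_iff)
      with that show ?thesis
        by (auto simp: coboundaries_3 precomp_cochain3)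
    qed
  next
    fix g h c assume "g \<in> carrier G" "h \<in> carrier G" "c \<in> carrier ?Z"
    then show "precomp 3 UNIV (\<rho> (inv\<^bsub>G\<^esub> (g \<otimes>\<^bsub>G\<^esub> h))) c
        = precomp 3 UNIV (\<rho> (inv\<^bsub>G\<^esub> g)) (precomp 3 UNIV (\<rho> (inv\<^bsub>G\<^esub> h)) c)"
      by (auto dest!: cases simp: precomp_cochain3 G.inv_mult_group mult)
  next
    fix c assume "c \<in> carrier ?Z"
    then show "precomp 3 UNIV (\<rho> (inv\<^bsub>G\<^esub> \<one>\<^bsub>G\<^esub>)) c = c"
      by (auto dest!: cases simp: precomp_cochain3 one)
  qed (use G comm B in auto)
qed

section \<open>Multilinear maps on the dual space\<close>

definition coordinate :: "'n::finite \<Rightarrow> bit ^ 'n \<Rightarrow> bit" where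
  "coordinate i v = v $ i"

lemma coordinate_dual [simp]: "coordinate i \<in> carrier dual_F2"
  by (simp add: dual_F2_simps coordinate_def)

lemma coordinate_axis: "coordinate i (axis j 1) = (if i = j then 1 else 0)"
  by (simp add: coordinate_def axis_def)

lemma dual_zero: "f \<in> carrier dual_F2 \<Longrightarrow> f 0 = 0"
  by (metis add_cancel_right_right dual_F2_simps(1))

lemma dual_add_closed:
  "f \<in> carrier dual_F2 \<Longrightarrow> g \<in> carrier dual_F2 \<Longrightarrow> (\<lambda>v. f v + g v) \<in> carrier dual_F2"
  by (simp add: dual_F2_simps ac_simps)

text \<open>The coordinates span the dual: f is the sum of the \<open>f (axis i 1)\<close> times
  coordinate \<open>i\<close>. The case of zero covers the empty sum and the vanishing
  coefficients.\<close>

lemma dual_F2_induct [consumes 1, case_names zero coordinate add]: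
  fixes f :: "bit ^ 'n::finite \<Rightarrow> bit"
  assumes f: "f \<in> carrier dual_F2"
    and zero: "P (\<lambda>_. 0)"
    and coordinate: "\<And>i. P (coordinate i)"
    and add: "\<And>f g. \<lbrakk>f \<in> carrier dual_F2; g \<in> carrier dual_F2; P f; P g\<rbrakk> \<Longrightarrow> P (\<lambda>v. f v + g v)"
  shows "P f"
proof -
  have sum: "(\<lambda>v. \<Sum>i\<in>S. f (axis i 1) * v $ i) \<in> carrier dual_F2 \<and> P (\<lambda>v. \<Sum>i\<in>S. f (axis i 1) * v $ i)"
    if "finite S" for S
    using that
  proof (induction S rule: finite_induct)
    case empty
    then show ?case using zero by (simp add: dual_F2_simps)
  next
    case (insert i S)
    have "(\<lambda>v. f (axis i 1) * v $ i) = (if f (axis i 1) = 1 then coordinate i else (\<lambda>_. 0))"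
      by (cases "f (axis i 1)") (auto simp: coordinate_def fun_eq_iff)
    then have "P (\<lambda>v. f (axis i 1) * v $ i)"
      using zero coordinate by auto
    moreover have "(\<lambda>v. f (axis i 1) * v $ i) \<in> carrier dual_F2"
      by (simp add: dual_F2_simps algebra_simps)
    ultimately show ?case
      using insert.hyps insert.IH
        add[of "\<lambda>v. f (axis i 1) * v $ i" "\<lambda>v. \<Sum>i\<in>S. f (axis i 1) * v $ i"]
        dual_add_closed[of "\<lambda>v. f (axis i 1) * v $ i" "\<lambda>v. \<Sum>i\<in>S. f (axis i 1) * v $ i"]
      by simp
  qed
  have "f v = (\<Sum>i\<in>UNIV. f (axis i 1) * v $ i)" for v
  proof -
    have "f (\<Sum>i\<in>S. v $ i *s axis i 1) = (\<Sum>i\<in>S. f (axis i 1) * v $ i)" if "finite S" for S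
      using that
    proof (induction S rule: finite_induct)
      case empty
      then show ?case using dual_zero[OF f] by simp
    next
      case (insert i S)
      have "f (v $ i *s axis i 1) = f (axis i 1) * v $ i"
        using dual_zero[OF f] by (cases "v $ i") auto
      then show ?case
        using f insert by (simp add: dual_F2_simps)
    qed
    then show ?thesis using basis_expansion[of v] by (metis finite)
  qed
  then have "f = (\<lambda>v. \<Sum>i\<in>UNIV. f (axis i 1) * v $ i)" by blast
  with sum[of UNIV] show ?thesis by simp
qed

lemma hom_zero:
  fixes Q :: "('q, 'x) monoid_scheme"
    and m :: "(bit ^ 'n::finite \<Rightarrow> bit) \<Rightarrow> 'q"
  assumes Q: "group Q"
    and closed: "\<And>u. u \<in> carrier dual_F2 \<Longrightarrow> m u \<in> carrier Q"
    and add: "\<And>u v. \<lbrakk>u \<in> carrier dual_F2; v \<in> carrier dual_F2\<rbrakk>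
      \<Longrightarrow> m (\<lambda>x. u x + v x) = m u \<otimes>\<^bsub>Q\<^esub> m v"
  shows "m (\<lambda>_. 0) = \<one>\<^bsub>Q\<^esub>"
proof -
  interpret group Q by (rule Q)
  have z: "(\<lambda>_. 0) \<in> carrier (dual_F2 :: (bit ^ 'n \<Rightarrow> bit) monoid)"
    by (simp add: dual_F2_simps)
  from add[OF z z] closed[OF z] show ?thesis
    by (metis add_0 r_cancel_one')
qed

text \<open>Only adjacent repetitions are required to vanish, since these are what the exterior
  relations supply. The two adjacent swaps generate all permutations and yield the remaining case
  \<open>alternating13\<close>.\<close>

locale trilinear_alternating = Q: comm_group Q for Q (structure) +
  fixes m :: "(bit ^ 'n::finite \<Rightarrow> bit) \<Rightarrow> (bit ^ 'n \<Rightarrow> bit) \<Rightarrow> (bit ^ 'n \<Rightarrow> bit) \<Rightarrow> 'q"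
  assumes closed: "\<lbrakk>u \<in> carrier dual_F2; v \<in> carrier dual_F2; w \<in> carrier dual_F2\<rbrakk> \<Longrightarrow> m u v w \<in> carrier Q"
    and add1: "\<lbrakk>u \<in> carrier dual_F2; u' \<in> carrier dual_F2; v \<in> carrier dual_F2; w \<in> carrier dual_F2\<rbrakk>
      \<Longrightarrow> m (\<lambda>x. u x + u' x) v w = m u v w \<otimes> m u' v w"
    and add2: "\<lbrakk>u \<in> carrier dual_F2; u' \<in> carrier dual_F2; v \<in> carrier dual_F2; w \<in> carrier dual_F2\<rbrakk>
      \<Longrightarrow> m v (\<lambda>x. u x + u' x) w = m v u w \<otimes> m v u' w"
    and add3: "\<lbrakk>u \<in> carrier dual_F2; u' \<in> carrier dual_F2; v \<in> carrier dual_F2; w \<in> carrier dual_F2\<rbrakk>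
      \<Longrightarrow> m v w (\<lambda>x. u x + u' x) = m v w u \<otimes> m v w u'"
    and alternating12: "\<lbrakk>u \<in> carrier dual_F2; w \<in> carrier dual_F2\<rbrakk> \<Longrightarrow> m u u w = \<one>"
    and alternating23: "\<lbrakk>u \<in> carrier dual_F2; w \<in> carrier dual_F2\<rbrakk> \<Longrightarrow> m w u u = \<one>"
begin

text \<open>Polarisation: expand the trivial value with \<open>u + v\<close> in both of the first
  two slots.\<close>

lemma swap12:
  assumes u: "u \<in> carrier dual_F2" and v: "v \<in> carrier dual_F2" and w: "w \<in> carrier dual_F2"
  shows "m v u w = inv (m u v w)"
proof -
  note uv = dual_add_closed[OF u v]
  have "\<one> = m (\<lambda>x. u x + v x) (\<lambda>x. u x + v x) w"
    using alternating12[OF uv w] by simp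
  also have "\<dots> = m u v w \<otimes> m v u w"
    using u v w uv alternating12 closed by (simp add: add1 add2 Q.m_comm)
  finally show ?thesis
    using Q.inv_equality[of "m v u w" "m u v w"] closed[OF u v w] closed[OF v u w] by (simp add: Q.m_comm)
qed

lemma swap23:
  assumes u: "u \<in> carrier dual_F2" and v: "v \<in> carrier dual_F2" and w: "w \<in> carrier dual_F2"
  shows "m w v u = inv (m w u v)"
proof -
  note uv = dual_add_closed[OF u v]
  have "\<one> = m w (\<lambda>x. u x + v x) (\<lambda>x. u x + v x)"
    using alternating23[OF uv w] by simp
  also have "\<dots> = m w u v \<otimes> m w v u"
    using u v w uv alternating23 closed by (simp add: add2 add3 Q.m_comm)
  finally show ?thesis
    using Q.inv_equality[of "m w v u" "m w u v"] closed[OF w u v] closed[OF w v u] by (simp add: Q.m_comm)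
qed

lemma alternating13:
  assumes "u \<in> carrier dual_F2" "v \<in> carrier dual_F2"
  shows "m u v u = \<one>"
  using swap12[of v u u] alternating23[of u v] assms by simp

end

text \<open>Swaps sort a triple of distinct coordinates, and repeated coordinates give the unit on
  both sides; trilinearity does the rest, one slot at a time. The injection \<open>r\<close> stands
  in for an order on the index type.\<close>

lemma trilinear_alternating_eqI:
  fixes m m' :: "(bit ^ 'n::finite \<Rightarrow> bit) \<Rightarrow> (bit ^ 'n \<Rightarrow> bit) \<Rightarrow> (bit ^ 'n \<Rightarrow> bit) \<Rightarrow> 'q"
    and r :: "'n \<Rightarrow> nat"
  assumes "trilinear_alternating Q m" "trilinear_alternating Q m'" and r: "inj r"
    and ordered: "\<And>i j k. \<lbrakk>r i < r j; r j < r k\<rbrakk>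
      \<Longrightarrow> m (coordinate i) (coordinate j) (coordinate k) = m' (coordinate i) (coordinate j) (coordinate k)"
    and u: "u \<in> carrier dual_F2" and v: "v \<in> carrier dual_F2" and w: "w \<in> carrier dual_F2"
  shows "m u v w = m' u v w"
proof -
  interpret m: trilinear_alternating Q m by fact
  interpret m': trilinear_alternating Q m' by fact
  define P where "P i j k \<longleftrightarrow> m (coordinate i) (coordinate j) (coordinate k) = m' (coordinate i) (coordinate j) (coordinate k)"
    for i j k
  have P12: "P i j k \<Longrightarrow> P j i k" and P23: "P i j k \<Longrightarrow> P i k j" for i j k
    by (simp_all add: P_def m.swap12[of "coordinate i" "coordinate j"] m'.swap12[of "coordinate i" "coordinate j"]
        m.swap23[of "coordinate j" "coordinate k"] m'.swap23[of "coordinate j" "coordinate k"])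
  have P_ordered: "r i < r j \<Longrightarrow> r j < r k \<Longrightarrow> P i j k" for i j k
    using ordered by (simp add: P_def)
  have P_eq: "i = j \<or> j = k \<or> i = k \<Longrightarrow> P i j k" for i j k
    by (auto simp: P_def m.alternating12 m.alternating23 m.alternating13
        m'.alternating12 m'.alternating23 m'.alternating13)
  have r_eq: "r i = r j \<longleftrightarrow> i = j" for i j
    using r by (simp add: inj_eq)
  have P: "P i j k" for i j k
  proof (cases "i = j \<or> j = k \<or> i = k")
    case True
    then show ?thesis by (rule P_eq)
  next
    case False
    then have "r i \<noteq> r j" "r j \<noteq> r k" "r i \<noteq> r k"
      using r_eq by auto
    \<comment> \<open>These are the six orders of three distinct ranks; each is sorted by at most
      three adjacent swaps.\<close>
    then consider "r i < r j" "r j < r k" | "r i < r k" "r k < r j" | "r j < r i" "r i < r k"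
      | "r j < r k" "r k < r i" | "r k < r i" "r i < r j" | "r k < r j" "r j < r i"
      by linarith
    then show ?thesis
      by cases (blast intro: P_ordered P12[OF P_ordered] P23[OF P_ordered] P12[OF P23[OF P_ordered]]
          P23[OF P12[OF P_ordered]] P12[OF P23[OF P12[OF P_ordered]]])+
  qed
  have 1: "m u (coordinate j) (coordinate k) = m' u (coordinate j) (coordinate k)" for j k
    using u
  proof (induction u rule: dual_F2_induct)
    case zero
    show ?case
      using hom_zero[of Q "\<lambda>u. m u (coordinate j) (coordinate k)"]
        hom_zero[of Q "\<lambda>u. m' u (coordinate j) (coordinate k)"]
      by (simp add: m.closed m.add1 m'.closed m'.add1)
  qed (use P in \<open>simp_all add: P_def m.add1 m'.add1\<close>)
  have 2: "m u v (coordinate k) = m' u v (coordinate k)" for k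
    using v
  proof (induction v rule: dual_F2_induct)
    case zero
    show ?case
      using hom_zero[of Q "\<lambda>v. m u v (coordinate k)"]
        hom_zero[of Q "\<lambda>v. m' u v (coordinate k)"] u
      by (simp add: m.closed m.add2 m'.closed m'.add2)
  qed (use 1 u in \<open>simp_all add: m.add2 m'.add2\<close>)
  show ?thesis
    using w
  proof (induction w rule: dual_F2_induct)
    case zero
    show ?case
      using hom_zero[of Q "\<lambda>w. m u v w"] hom_zero[of Q "\<lambda>w. m' u v w"] u v
      by (simp add: m.closed m.add3 m'.closed m'.add3)
  qed (use 2 u v in \<open>simp_all add: m.add3 m'.add3\<close>)
qed

text \<open>Additivity in the second argument follows from symmetry.\<close>

locale bilinear_symmetric = Q: comm_group Q for Q (structure) +
  fixes m :: "(bit ^ 'n::finite \<Rightarrow> bit) \<Rightarrow> (bit ^ 'n \<Rightarrow> bit) \<Rightarrow> 'q"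
  assumes closed: "\<lbrakk>u \<in> carrier dual_F2; v \<in> carrier dual_F2\<rbrakk> \<Longrightarrow> m u v \<in> carrier Q"
    and add: "\<lbrakk>u \<in> carrier dual_F2; u' \<in> carrier dual_F2; v \<in> carrier dual_F2\<rbrakk>
      \<Longrightarrow> m (\<lambda>x. u x + u' x) v = m u v \<otimes> m u' v"
    and symmetric: "\<lbrakk>u \<in> carrier dual_F2; v \<in> carrier dual_F2\<rbrakk> \<Longrightarrow> m u v = m v u"

lemma bilinear_symmetric_eqI:
  fixes m m' :: "(bit ^ 'n::finite \<Rightarrow> bit) \<Rightarrow> (bit ^ 'n \<Rightarrow> bit) \<Rightarrow> 'q"
    and r :: "'n \<Rightarrow> nat"
  assumes "bilinear_symmetric Q m" "bilinear_symmetric Q m'"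
    and ordered: "\<And>i j. r i \<le> r j \<Longrightarrow> m (coordinate i) (coordinate j) = m' (coordinate i) (coordinate j)"
    and u: "u \<in> carrier dual_F2" and v: "v \<in> carrier dual_F2"
  shows "m u v = m' u v"
proof -
  interpret m: bilinear_symmetric Q m by fact
  interpret m': bilinear_symmetric Q m' by fact
  have coord: "m (coordinate i) (coordinate j) = m' (coordinate i) (coordinate j)" for i j
    using ordered[of i j] ordered[of j i] m.symmetric[of "coordinate i" "coordinate j"]
      m'.symmetric[of "coordinate i" "coordinate j"] by fastforce
  have 1: "m u (coordinate j) = m' u (coordinate j)" if "u \<in> carrier dual_F2" for u j
    using that
  proof (induction u rule: dual_F2_induct)
    case zero
    show ?case
      using hom_zero[of Q "\<lambda>u. m u (coordinate j)"] hom_zero[of Q "\<lambda>u. m' u (coordinate j)"]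
      by (simp add: m.closed m.add m'.closed m'.add)
  qed (use coord in \<open>simp_all add: m.add m'.add\<close>)
  have "m v u = m' v u"
    using v
  proof (induction v rule: dual_F2_induct)
    case zero
    show ?case
      using hom_zero[of Q "\<lambda>v. m v u"] hom_zero[of Q "\<lambda>v. m' v u"] u
      by (simp add: m.closed m.add m'.closed m'.add)
  next
    case (coordinate i)
    show ?case
      using 1[OF u, of i] u by (simp add: m.symmetric[of "coordinate i"] m'.symmetric[of "coordinate i"])
  qed (use u in \<open>simp_all add: m.add m'.add\<close>)
  with u v show ?thesis
    by (simp add: m.symmetric[of u] m'.symmetric[of u])
qed

lemma finite_dual_words [simp]: "finite (words d (carrier (dual_F2 :: (bit ^ 'n::finite \<Rightarrow> bit) monoid)))"
  by (rule finite_words) simp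

lemma carrier_free_words_dual:
  "carrier (free_words d (dual_F2 :: (bit ^ 'n::finite \<Rightarrow> bit) monoid)) = extensional (words d (carrier dual_F2))"
  by (auto simp: carrier_free_words)

section \<open>The cochain of a sum of words\<close>

lemma words_2_mem [simp]: "[x, y] \<in> words 2 A \<longleftrightarrow> x \<in> A \<and> y \<in> A"
  by (simp add: words_2_iff)

lemma words_3_mem [simp]: "[x, y, z] \<in> words 3 A \<longleftrightarrow> x \<in> A \<and> y \<in> A \<and> z \<in> A"
  by (simp add: words_3_iff)

text \<open>The trilinear form of a sum of words, which is at the same time its cup product cochain
  with bit values.\<close>

definition evaluate3 :: "((bit ^ 'n::finite \<Rightarrow> bit) list \<Rightarrow> bit) \<Rightarrow> bit ^ 'n \<Rightarrow> bit ^ 'n \<Rightarrow> bit ^ 'n \<Rightarrow> bit" where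
  "evaluate3 F x y z = (\<Sum>ws\<in>words 3 (carrier dual_F2). F ws * ((ws ! 0) x * (ws ! 1) y * (ws ! 2) z))"

definition evaluate2 :: "((bit ^ 'n::finite \<Rightarrow> bit) list \<Rightarrow> bit) \<Rightarrow> bit ^ 'n \<Rightarrow> bit ^ 'n \<Rightarrow> bit" where
  "evaluate2 F x y = (\<Sum>ws\<in>words 2 (carrier dual_F2). F ws * ((ws ! 0) x * (ws ! 1) y))"

lemma evaluate3_mult:
  "evaluate3 (F \<otimes>\<^bsub>free_words 3 dual_F2\<^esub> H) x y z = evaluate3 F x y z + evaluate3 H x y z"
  by (simp add: evaluate3_def free_words_mult distrib_right sum.distrib)

lemma evaluate2_mult:
  "evaluate2 (F \<otimes>\<^bsub>free_words 2 dual_F2\<^esub> H) x y = evaluate2 F x y + evaluate2 H x y"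
  by (simp add: evaluate2_def free_words_mult distrib_right sum.distrib)

lemma sum_delta_bit:
  fixes g :: "'a \<Rightarrow> bit"
  assumes "finite A" "a \<in> A"
  shows "(\<Sum>x\<in>A. (if x = a then 1 else 0) * g x) = g a"
proof -
  have "(\<Sum>x\<in>A. (if x = a then 1 else 0) * g x) = (\<Sum>x\<in>A. if x = a then g x else 0)"
    by (rule sum.cong) auto
  with assms show ?thesis by simp
qed

lemma evaluate3_basis:
  assumes "u \<in> carrier dual_F2" "v \<in> carrier dual_F2" "w \<in> carrier dual_F2"
  shows "evaluate3 (word_basis 3 dual_F2 [u, v, w]) x y z = u x * v y * w z"
proof -
  have "[u, v, w] \<in> words 3 (carrier dual_F2)"
    using assms by (simp add: words_3_iff)
  then show ?thesis
    unfolding evaluate3_def word_basis_def by (simp add: sum_delta_bit cong: sum.cong)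
qed

lemma evaluate2_basis:
  assumes "u \<in> carrier dual_F2" "v \<in> carrier dual_F2"
  shows "evaluate2 (word_basis 2 dual_F2 [u, v]) x y = u x * v y"
proof -
  have "[u, v] \<in> words 2 (carrier dual_F2)"
    using assms by (simp add: words_2_iff)
  then show ?thesis
    unfolding evaluate2_def word_basis_def by (simp add: sum_delta_bit cong: sum.cong)
qed

lemma dual_nth_add: "ws \<in> words d (carrier dual_F2) \<Longrightarrow> i < d \<Longrightarrow> (ws ! i) (x + y) = (ws ! i) x + (ws ! i) y"
  by (auto simp: words_def dual_F2_simps in_lists_conv_set)

lemma evaluate2_add:
  "evaluate2 F (x + x') y = evaluate2 F x y + evaluate2 F x' y"
  "evaluate2 F x (y + y') = evaluate2 F x y + evaluate2 F x y'"
  unfolding evaluate2_def sum.distrib[symmetric]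
  by (rule sum.cong; simp add: dual_nth_add algebra_simps)+

lemma evaluate3_zero: "evaluate3 F x 0 z = 0"
proof -
  have "(ws ! 1) 0 = 0" if "ws \<in> words 3 (carrier dual_F2)" for ws :: "(bit ^ 'n \<Rightarrow> bit) list"
    using dual_nth_add[OF that, of 1 0 0] by simp
  then show ?thesis by (auto simp: evaluate3_def intro!: sum.neutral)
qed

text \<open>The linear extension of \<open>[u, v]\<close> to \<open>[u, u, v]\<close>, written as
  the pushforward of coefficients along this injective map of words.\<close>

definition double_first :: "((bit ^ 'n::finite \<Rightarrow> bit) list \<Rightarrow> bit) \<Rightarrow> (bit ^ 'n \<Rightarrow> bit) list \<Rightarrow> bit" where
  "double_first F = (\<lambda>ws\<in>words 3 (carrier dual_F2). if ws ! 0 = ws ! 1 then F (tl ws) else 0)"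

lemma double_first_hom: "double_first \<in> hom (free_words 2 dual_F2) (free_words 3 dual_F2)"
proof (rule homI)
  show "double_first (F \<otimes>\<^bsub>free_words 2 dual_F2\<^esub> H)
      = double_first F \<otimes>\<^bsub>free_words 3 dual_F2\<^esub> double_first H" for F H :: "(bit ^ 'n \<Rightarrow> bit) list \<Rightarrow> bit"
    unfolding double_first_def free_words_mult
    by (rule restrict_ext) (clarsimp simp: words_3_iff)
qed (simp add: carrier_free_words_dual double_first_def)

lemma double_first_basis:
  "double_first (word_basis 2 dual_F2 [u, v]) = word_basis 3 dual_F2 [u, u, v]"
  unfolding double_first_def word_basis_def
  by (rule restrict_ext) (clarsimp simp: words_3_iff, auto)

text \<open>A word stands for the cup product of its letters, and \<open>\<bbbF>\<^sub>2\<close> is embedded into the units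
  as \<open>{1, -1}\<close>.\<close>

definition word_cochain ::
    "((bit ^ 'n::finite \<Rightarrow> bit) list \<Rightarrow> bit) \<Rightarrow> (bit ^ 'n) list \<Rightarrow> 'k::field" where
  "word_cochain F = cochain3 (\<lambda>x y z. scale_bit (evaluate3 F x y z) minus_one_unit)"

lemma minus_one_add [simp]: "minus_one_unit + minus_one_unit = 0"
  using two_torsion_additive_units by blast

lemma scale_minus_one_add:
  "scale_bit (a + b) minus_one_unit = scale_bit a minus_one_unit + scale_bit b minus_one_unit"
  by (cases a; cases b) auto

lemma uminus_minus_one [simp]: "- minus_one_unit = minus_one_unit"
  by (simp add: minus_unique)

lemma scale_minus_one_uminus: "- scale_bit a minus_one_unit = scale_bit a minus_one_unit"
  by (cases a) auto

lemma scale_minus_one_diff: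
  "a - scale_bit b minus_one_unit = a + scale_bit b minus_one_unit"
  by (metis diff_conv_add_uminus scale_minus_one_uminus)

lemma scale_minus_one_eq_0_iff:
  "scale_bit a (minus_one_unit :: 'k::field_char_0 additive_units) = 0 \<longleftrightarrow> a = 0"
  by (cases a) (auto simp: minus_one_unit_nonzero)

lemma d3_scale:
  "d3 (\<lambda>x y z. scale_bit (T x y z) minus_one_unit) x y z w = scale_bit (d3 T x y z w) minus_one_unit"
  by (simp add: d3_def scale_minus_one_add scale_minus_one_diff)

lemma d2_scale:
  "d2 (\<lambda>x y. scale_bit (T x y) minus_one_unit) x y z = scale_bit (d2 T x y z) minus_one_unit"
  by (simp add: d2_def scale_minus_one_add scale_minus_one_diff)

lemma evaluate3_cocycle: "d3 (evaluate3 F) x y z w = 0"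
  unfolding d3_def evaluate3_def sum.distrib[symmetric] minus_bit_def
  by (rule sum.neutral) (simp add: dual_nth_add algebra_simps)

lemma word_cochain_cocycle: "word_cochain F \<in> cocycles 3"
  by (simp add: word_cochain_def cochain3_cocycle_iff d3_scale evaluate3_cocycle)

lemma word_cochain_hom:
  "word_cochain \<in> hom (free_words 3 dual_F2) ((cochains 3)\<lparr>carrier := cocycles 3\<rparr>)"
  by (rule homI)
    (simp_all add: word_cochain_cocycle, simp add: word_cochain_def evaluate3_mult cochain3_mult scale_minus_one_add)

definition alternation :: "('v \<Rightarrow> 'v \<Rightarrow> 'v \<Rightarrow> bit) \<Rightarrow> 'v \<Rightarrow> 'v \<Rightarrow> 'v \<Rightarrow> bit" where
  "alternation T x y z = T x y z + T y x z + T y z x + T z y x + T z x y + T x z y"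

text \<open>On values of order two the signs are invisible, so the alternation is the signed sum of
  \<open>d2_alternating_sum\<close>.\<close>

lemma alternation_coboundary:
  assumes "word_cochain F \<in> (coboundaries 3 :: ((bit ^ 'n::finite) list \<Rightarrow> 'k::field_char_0) set)"
  shows "alternation (evaluate3 F) x y z = 0"
proof -
  from assms obtain g :: "bit ^ 'n \<Rightarrow> bit ^ 'n \<Rightarrow> 'k additive_units"
    where g: "scale_bit (evaluate3 F x y z) minus_one_unit = d2 g x y z" for x y z
    by (auto simp: word_cochain_def cochain3_coboundary_iff fun_eq_iff)
  have "scale_bit (alternation (evaluate3 F) x y z) (minus_one_unit :: 'k additive_units)
    = d2 g x y z - d2 g y x z + d2 g y z x - d2 g z y x + d2 g z x y - d2 g x z y"
    by (simp add: alternation_def scale_minus_one_add scale_minus_one_diff flip: g)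
  then show ?thesis
    by (simp add: d2_alternating_sum scale_minus_one_eq_0_iff)
qed

text \<open>In \<open>d2_diagonal\<close> the value at \<open>(v, 0, v)\<close> allows for a
  primitive that is not normalised. A trilinear form vanishes there, so nothing is left but the
  value on the diagonal.\<close>

lemma diagonal_coboundary:
  assumes "word_cochain F \<in> (coboundaries 3 :: ((bit ^ 'n::finite) list \<Rightarrow> 'k::field_char_0) set)"
  shows "evaluate3 F v v v = 0"
proof -
  from assms obtain g :: "bit ^ 'n \<Rightarrow> bit ^ 'n \<Rightarrow> 'k additive_units"
    where g: "scale_bit (evaluate3 F x y z) minus_one_unit = d2 g x y z" for x y z
    by (auto simp: word_cochain_def cochain3_coboundary_iff fun_eq_iff)
  have "scale_bit (evaluate3 F v v v) minus_one_unit + scale_bit (evaluate3 F v 0 v) minus_one_unit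
    = (0 :: 'k additive_units)"
    unfolding g by (rule d2_diagonal) simp
  then show ?thesis
    by (simp add: evaluate3_zero scale_minus_one_eq_0_iff)
qed

lemma word_cochain_surjective:
  fixes c :: "(bit ^ 'n::finite) list \<Rightarrow> 'k::{alg_closed_field, field_char_0}"
  assumes "c \<in> cocycles 3"
  shows "\<exists>F\<in>carrier (free_words 3 dual_F2). \<exists>g. c = cochain3 (\<lambda>x y z. d2 g x y z + scale_bit (evaluate3 F x y z) minus_one_unit)"
proof -
  interpret F: comm_group "free_words 3 (dual_F2 :: (bit ^ 'n \<Rightarrow> bit) monoid)"
    by (rule comm_group_free_words)
  have "c \<in> carrier (cochains 3)"
    using assms by (simp add: cocycles_def kernel_def)
  then obtain c' where c: "c = cochain3 c'" by (rule cochain3_cases)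
  with assms have "d3 c' x y z w = 0" for x y z w
    by (simp add: cochain3_cocycle_iff)
  from cocycle_3_trilinear[OF divisible_additive_units two_torsion_additive_units minus_one_unit_nonzero this]
  obtain f g where f: "\<And>i j x y. f i j (x + y) = f i j x + f i j y"
    and c': "\<And>x y z. c' x y z = d2 g x y z
      + scale_bit (\<Sum>i\<in>UNIV. \<Sum>j\<in>UNIV. f i j x * y $ j * z $ i) minus_one_unit"
    by blast
  \<comment> \<open>Stated for one index set and an arbitrary family \<open>T\<close>, so that it
    can be applied to each of the two nested sums.\<close>
  have sum: "\<exists>F\<in>carrier (free_words 3 dual_F2). \<forall>x y z. evaluate3 F x y z = (\<Sum>a\<in>A. T a x y z)"
    if "finite A" "\<And>a. a \<in> A \<Longrightarrow> \<exists>F\<in>carrier (free_words 3 dual_F2). \<forall>x y z. evaluate3 F x y z = T a x y z"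
    for A :: "'n set" and T :: "'n \<Rightarrow> bit ^ 'n \<Rightarrow> bit ^ 'n \<Rightarrow> bit ^ 'n \<Rightarrow> bit"
    using that
  proof (induction A rule: finite_induct)
    case empty
    show ?case
      by (rule bexI[of _ "\<one>\<^bsub>free_words 3 dual_F2\<^esub>"]) (simp_all add: evaluate3_def free_words_one carrier_free_words_dual)
  next
    case (insert a A)
    then obtain F where F: "F \<in> carrier (free_words 3 dual_F2)"
      "\<And>x y z. evaluate3 F x y z = (\<Sum>a\<in>A. T a x y z)" by blast
    from insert.prems obtain H where H: "H \<in> carrier (free_words 3 dual_F2)"
      "\<And>x y z. evaluate3 H x y z = T a x y z" by blast
    show ?case
      by (rule bexI[of _ "H \<otimes>\<^bsub>free_words 3 dual_F2\<^esub> F"])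
        (use F H insert.hyps in \<open>simp_all add: evaluate3_mult\<close>)
  qed
  have "\<exists>F\<in>carrier (free_words 3 dual_F2). \<forall>x y z. evaluate3 F x y z = f i j x * y $ j * z $ i" for i j
  proof (rule bexI[OF _ word_basis_carrier])
    show "\<forall>x y z. evaluate3 (word_basis 3 dual_F2 [f i j, coordinate j, coordinate i]) x y z = f i j x * y $ j * z $ i"
      using f by (subst evaluate3_basis) (auto simp: dual_F2_simps coordinate_def)
  qed
  then have "\<exists>F\<in>carrier (free_words 3 dual_F2). \<forall>x y z. evaluate3 F x y z
      = (\<Sum>i\<in>UNIV. \<Sum>j\<in>UNIV. f i j x * y $ j * z $ i)"
    by (intro sum) simp_all
  then obtain F where "F \<in> carrier (free_words 3 dual_F2)"
    "\<And>x y z. evaluate3 F x y z = (\<Sum>i\<in>UNIV. \<Sum>j\<in>UNIV. f i j x * y $ j * z $ i)"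
    by blast
  moreover from this(2) c' have "c' = (\<lambda>x y z. d2 g x y z + scale_bit (evaluate3 F x y z) minus_one_unit)"
    by (simp add: fun_eq_iff)
  ultimately show ?thesis
    using c by blast
qed

section \<open>Normal forms modulo the relations\<close>

lemma quotient_module_symmetric:
  "quotient_module GL_F2 (free_words d dual_F2)
    (generate (free_words d dual_F2) (tensor_relations d dual_F2 \<union> symmetric_relations d dual_F2))
    (free_words_action GL_F2 d (dual_F2 :: (bit ^ 'n::finite \<Rightarrow> bit) monoid) dual_action)"
  using group_action_on_group.quotient_module_generate[OF dual_action_module]
    group_action_on_group.act_tensor_relations[OF dual_action_module]
    group_action_on_group.act_symmetric_relations[OF dual_action_module]
    tensor_relations_carrier symmetric_relations_carrier
  by (metis (no_types, lifting) Un_iff Un_least)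

lemma quotient_module_exterior:
  "quotient_module GL_F2 (free_words d dual_F2)
    (generate (free_words d dual_F2) (tensor_relations d dual_F2 \<union> exterior_relations d dual_F2))
    (free_words_action GL_F2 d (dual_F2 :: (bit ^ 'n::finite \<Rightarrow> bit) monoid) dual_action)"
  using group_action_on_group.quotient_module_generate[OF dual_action_module]
    group_action_on_group.act_tensor_relations[OF dual_action_module]
    group_action_on_group.act_exterior_relations[OF dual_action_module]
    tensor_relations_carrier exterior_relations_carrier
  by (metis (no_types, lifting) Un_iff Un_least)

text \<open>Additivity in an arbitrary slot of a word, for any quotient by at least the tensor
  relations; it serves the symmetric and the exterior power alike.\<close>

lemma proj_tensor_relation:
  fixes W :: "('w, 'c) monoid_scheme"
  assumes "quotient_module G (free_words d W) N \<phi>" and N: "tensor_relations d W \<subseteq> N"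
    and w: "us @ [x] @ vs \<in> words d (carrier W)" "y \<in> carrier W"
  defines "proj \<equiv> r_coset (free_words d W) N" and "b \<equiv> word_basis d W"
  shows "proj (b (us @ [x \<otimes>\<^bsub>W\<^esub> y] @ vs)) =
    proj (b (us @ [x] @ vs)) \<otimes>\<^bsub>free_words d W Mod N\<^esub> proj (b (us @ [y] @ vs))"
proof -
  let ?M = "free_words d W"
  interpret quotient_module G ?M N \<phi> by fact
  have b: "b ws \<in> carrier ?M" for ws
    unfolding b_def by (rule word_basis_carrier)
  have "b (us @ [x \<otimes>\<^bsub>W\<^esub> y] @ vs) \<otimes>\<^bsub>?M\<^esub> inv\<^bsub>?M\<^esub> (b (us @ [x] @ vs) \<otimes>\<^bsub>?M\<^esub> b (us @ [y] @ vs))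
      \<in> tensor_relations d W"
    unfolding tensor_relations_def b_def using w by blast
  then have "proj (b (us @ [x \<otimes>\<^bsub>W\<^esub> y] @ vs)) = proj (b (us @ [x] @ vs) \<otimes>\<^bsub>?M\<^esub> b (us @ [y] @ vs))"
    unfolding proj_def using N b M.m_closed[OF b b] by (subst proj_eq_iff[OF b]) auto
  also have "\<dots> = proj (b (us @ [x] @ vs)) \<otimes>\<^bsub>?M Mod N\<^esub> proj (b (us @ [y] @ vs))"
    unfolding proj_def by (rule proj_mult[OF b b, symmetric])
  finally show ?thesis .
qed

lemma exterior_relationI:
  "us @ [x, x] @ vs \<in> words d (carrier W) \<Longrightarrow> word_basis d W (us @ [x, x] @ vs) \<in> exterior_relations d W"
  unfolding exterior_relations_def by blast

lemma symmetric_relationI: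
  "us @ [x, y] @ vs \<in> words d (carrier W) \<Longrightarrow>
    word_basis d W (us @ [x, y] @ vs)
      \<otimes>\<^bsub>free_words d W\<^esub> inv\<^bsub>free_words d W\<^esub> word_basis d W (us @ [y, x] @ vs) \<in> symmetric_relations d W"
  unfolding symmetric_relations_def by blast

text \<open>The normal form depends only on the alternation, yet it agrees with the argument modulo the
  exterior relations: both are alternating and trilinear in the letters of a word, and they agree
  on increasing words in the coordinates.\<close>

definition normal_form3 :: "('n \<Rightarrow> nat) \<Rightarrow> ((bit ^ 'n::finite \<Rightarrow> bit) list \<Rightarrow> bit) \<Rightarrow> (bit ^ 'n \<Rightarrow> bit) list \<Rightarrow> bit" where
  "normal_form3 r F = (\<lambda>ws\<in>words 3 (carrier dual_F2). \<Sum>(i, j, k)\<in>{(i, j, k). r i < r j \<and> r j < r k}.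
    alternation (evaluate3 F) (axis i 1) (axis j 1) (axis k 1)
      * word_basis 3 dual_F2 [coordinate i, coordinate j, coordinate k] ws)"

lemma alternation_add:
  "alternation (\<lambda>x y z. T x y z + S x y z) x y z = alternation T x y z + alternation S x y z"
  by (simp add: alternation_def ac_simps)

text \<open>The hypothesis concerns only trilinear forms because the lemma is also applied to words
  with a letter \<open>u + u'\<close>, whose basis vectors are not sums of the basis vectors for
  \<open>u\<close> and \<open>u'\<close>.\<close>

lemma normal_form3_add:
  assumes "\<And>x y z. evaluate3 F x y z = evaluate3 F1 x y z + evaluate3 F2 x y z"
  shows "normal_form3 r F = normal_form3 r F1 \<otimes>\<^bsub>free_words 3 dual_F2\<^esub> normal_form3 r F2"
proof -
  have "alternation (evaluate3 F) x y z = alternation (evaluate3 F1) x y z + alternation (evaluate3 F2) x y z" for x y z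
    by (simp add: assms alternation_add[symmetric] alternation_def ac_simps)
  then show ?thesis
    unfolding normal_form3_def free_words_mult
    by (intro restrict_ext) (simp add: case_prod_unfold distrib_right sum.distrib)
qed

lemma normal_form3_carrier: "normal_form3 r F \<in> carrier (free_words 3 dual_F2)"
  by (simp add: normal_form3_def carrier_free_words_dual)

lemma normal_form3_zero:
  assumes "\<And>x y z. alternation (evaluate3 F) x y z = 0"
  shows "normal_form3 r F = \<one>\<^bsub>free_words 3 dual_F2\<^esub>"
  by (simp add: normal_form3_def assms free_words_one case_prod_unfold)

lemma normal_form3_hom: "normal_form3 r \<in> hom (free_words 3 dual_F2) (free_words 3 dual_F2)"
  by (rule homI) (auto intro!: normal_form3_carrier normal_form3_add simp: evaluate3_mult)

text \<open>Two increasing triples can agree only without a permutation, so five of the six terms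
  vanish.\<close>

lemma alternation_coordinates:
  assumes "r i < r j" "r j < r k" "r a < r b" "r b < (r c :: nat)"
  shows "alternation (\<lambda>x y z. coordinate a x * coordinate b y * coordinate c z) (axis i 1) (axis j 1) (axis k 1)
    = (if (i, j, k) = (a, b, c) then 1 else 0)"
  using assms by (auto simp: alternation_def coordinate_axis)

lemma normal_form3_basis:
  assumes "r a < r b" "r b < r c"
  shows "normal_form3 r (word_basis 3 dual_F2 [coordinate a, coordinate b, coordinate c])
    = word_basis 3 dual_F2 [coordinate a, coordinate b, coordinate c]"
proof -
  let ?T = "{(i, j, k). r i < r j \<and> r j < r k}"
  let ?b = "\<lambda>(i, j, k). word_basis 3 dual_F2 [coordinate i, coordinate j, coordinate k]"
  have "(\<Sum>t\<in>?T. (if t = (a, b, c) then 1 else 0) * ?b t ws) = ?b (a, b, c) ws" for ws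
    using assms by (intro sum_delta_bit) auto
  note delta = this
  have alt: "alternation (evaluate3 (word_basis 3 dual_F2 [coordinate a, coordinate b, coordinate c])) x y z =
      alternation (\<lambda>x y z. coordinate a x * coordinate b y * coordinate c z) x y z" for x y z
    by (simp add: alternation_def evaluate3_basis)
  have "normal_form3 r (?b (a, b, c)) ws = (\<Sum>t\<in>?T. (if t = (a, b, c) then 1 else 0) * ?b t ws)"
    if "ws \<in> words 3 (carrier dual_F2)" for ws
    using that assms
    by (auto simp: normal_form3_def alt alternation_coordinates[of r] simp del: prod.inject intro!: sum.cong)
  then show ?thesis
    unfolding delta
    by (intro extensionalityI[of _ "words 3 (carrier dual_F2)"]) (auto simp: normal_form3_def word_basis_def)
qed

text \<open>This is the injectivity of the map from the exterior cube to alternating trilinear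
  forms. The normal form replaces a basis of the quotient and a count of dimensions.\<close>

lemma exterior_relationsI:
  assumes F: "F \<in> carrier (free_words 3 (dual_F2 :: (bit ^ 'n::finite \<Rightarrow> bit) monoid))"
    and alt: "\<And>x y z. alternation (evaluate3 F) x y z = 0"
  shows "F \<in> generate (free_words 3 dual_F2) (tensor_relations 3 dual_F2 \<union> exterior_relations 3 dual_F2)"
proof -
  let ?F = "free_words 3 (dual_F2 :: (bit ^ 'n \<Rightarrow> bit) monoid)"
  let ?b = "word_basis 3 (dual_F2 :: (bit ^ 'n \<Rightarrow> bit) monoid)"
  define R where "R = generate ?F (tensor_relations 3 dual_F2 \<union> exterior_relations 3 dual_F2)"
  interpret X: quotient_module GL_F2 ?F R "free_words_action GL_F2 3 dual_F2 dual_action"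
    unfolding R_def by (rule quotient_module_exterior)
  let ?Q = "?F Mod R"
  have tensor: "tensor_relations 3 dual_F2 \<subseteq> R" and exterior: "exterior_relations 3 dual_F2 \<subseteq> R"
    by (auto simp: R_def intro: generate.incl)
  note rel = proj_tensor_relation[OF X.quotient_module_axioms tensor, unfolded dual_F2_simps(2)]
  obtain r :: "'n \<Rightarrow> nat" where r: "inj r"
    by (metis ex_inj)
  have comm: "comm_group ?Q" by (rule X.comm_group_Mod)
  have closed: "X.proj x \<in> carrier ?Q" if "x \<in> carrier ?F" for x
    using that by (simp add: X.carrier_Mod)
  have 1: "trilinear_alternating ?Q (\<lambda>u v w. X.proj (?b [u, v, w]))"
  proof (intro trilinear_alternating.intro trilinear_alternating_axioms.intro comm closed word_basis_carrier)
    fix u u' v w :: "bit ^ 'n \<Rightarrow> bit"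
    assume u: "u \<in> carrier dual_F2" and u': "u' \<in> carrier dual_F2"
      and v: "v \<in> carrier dual_F2" and w: "w \<in> carrier dual_F2"
    show "X.proj (?b [\<lambda>x. u x + u' x, v, w]) = X.proj (?b [u, v, w]) \<otimes>\<^bsub>?Q\<^esub> X.proj (?b [u', v, w])"
      using rel[of "[]" u "[v, w]" u'] u u' v w by (simp del: mult_FactGroup)
    show "X.proj (?b [v, \<lambda>x. u x + u' x, w]) = X.proj (?b [v, u, w]) \<otimes>\<^bsub>?Q\<^esub> X.proj (?b [v, u', w])"
      using rel[of "[v]" u "[w]" u'] u u' v w by (simp del: mult_FactGroup)
    show "X.proj (?b [v, w, \<lambda>x. u x + u' x]) = X.proj (?b [v, w, u]) \<otimes>\<^bsub>?Q\<^esub> X.proj (?b [v, w, u'])"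
      using rel[of "[v, w]" u "[]" u'] u u' v w by (simp del: mult_FactGroup)
  next
    fix u w :: "bit ^ 'n \<Rightarrow> bit"
    assume u: "u \<in> carrier dual_F2" and w: "w \<in> carrier dual_F2"
    have "?b [u, u, w] \<in> exterior_relations 3 dual_F2" "?b [w, u, u] \<in> exterior_relations 3 dual_F2"
      using exterior_relationI[of "[]" u "[w]" 3 dual_F2] exterior_relationI[of "[w]" u "[]" 3 dual_F2] u w
      by simp_all
    then show "X.proj (?b [u, u, w]) = \<one>\<^bsub>?Q\<^esub>" "X.proj (?b [w, u, u]) = \<one>\<^bsub>?Q\<^esub>"
      using exterior by (auto simp: X.proj_one_iff word_basis_carrier simp del: one_FactGroup)
  qed
  have 2: "trilinear_alternating ?Q (\<lambda>u v w. X.proj (normal_form3 r (?b [u, v, w])))"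
  proof (intro trilinear_alternating.intro trilinear_alternating_axioms.intro comm closed normal_form3_carrier)
    fix u u' v w :: "bit ^ 'n \<Rightarrow> bit"
    assume u: "u \<in> carrier dual_F2" and u': "u' \<in> carrier dual_F2"
      and v: "v \<in> carrier dual_F2" and w: "w \<in> carrier dual_F2"
    note simps = evaluate3_basis u u' v w dual_add_closed distrib_left distrib_right
    show "X.proj (normal_form3 r (?b [\<lambda>x. u x + u' x, v, w]))
        = X.proj (normal_form3 r (?b [u, v, w])) \<otimes>\<^bsub>?Q\<^esub> X.proj (normal_form3 r (?b [u', v, w]))"
      by (subst normal_form3_add[of _ "?b [u, v, w]" "?b [u', v, w]"])
        (simp_all add: simps X.proj_mult normal_form3_carrier del: mult_FactGroup)
    show "X.proj (normal_form3 r (?b [v, \<lambda>x. u x + u' x, w]))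
        = X.proj (normal_form3 r (?b [v, u, w])) \<otimes>\<^bsub>?Q\<^esub> X.proj (normal_form3 r (?b [v, u', w]))"
      by (subst normal_form3_add[of _ "?b [v, u, w]" "?b [v, u', w]"])
        (simp_all add: simps X.proj_mult normal_form3_carrier del: mult_FactGroup)
    show "X.proj (normal_form3 r (?b [v, w, \<lambda>x. u x + u' x]))
        = X.proj (normal_form3 r (?b [v, w, u])) \<otimes>\<^bsub>?Q\<^esub> X.proj (normal_form3 r (?b [v, w, u']))"
      by (subst normal_form3_add[of _ "?b [v, w, u]" "?b [v, w, u']"])
        (simp_all add: simps X.proj_mult normal_form3_carrier del: mult_FactGroup)
  next
    fix u w :: "bit ^ 'n \<Rightarrow> bit"
    assume u: "u \<in> carrier dual_F2" and w: "w \<in> carrier dual_F2"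
    have "normal_form3 r (?b [u, u, w]) = \<one>\<^bsub>?F\<^esub>" "normal_form3 r (?b [w, u, u]) = \<one>\<^bsub>?F\<^esub>"
      by (rule normal_form3_zero; simp add: alternation_def evaluate3_basis u w ac_simps)+
    then show "X.proj (normal_form3 r (?b [u, u, w])) = \<one>\<^bsub>?Q\<^esub>"
      "X.proj (normal_form3 r (?b [w, u, u])) = \<one>\<^bsub>?Q\<^esub>"
      using X.proj_one_iff[of "\<one>\<^bsub>?F\<^esub>"] X.N.one_closed by simp_all
  qed
  have "X.proj F = X.proj (normal_form3 r F)"
  proof (rule free_words_hom_eq[where h = X.proj and Q = ?Q, OF _ _ _ _ F])
    show "X.proj \<in> hom ?F ?Q"
      by (rule normal.r_coset_hom_Mod[OF X.normal])
    then show "(\<lambda>F. X.proj (normal_form3 r F)) \<in> hom ?F ?Q"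
      using hom_compose[OF normal_form3_hom] by (auto simp: comp_def)
    show "group ?Q" using comm by (rule comm_group.axioms)
    show "X.proj (?b ws) = X.proj (normal_form3 r (?b ws))" if ws: "ws \<in> words 3 (carrier dual_F2)" for ws
    proof -
      obtain u v w where uvw: "u \<in> carrier dual_F2" "v \<in> carrier dual_F2" "w \<in> carrier dual_F2" "ws = [u, v, w]"
        using ws by (auto simp: words_3_iff)
      show ?thesis
        unfolding uvw(4)
        by (rule trilinear_alternating_eqI[OF 1 2 r _ uvw(1-3)]) (simp add: normal_form3_basis)
    qed
  qed
  also have "normal_form3 r F = \<one>\<^bsub>?F\<^esub>"
    by (rule normal_form3_zero[OF alt])
  finally show ?thesis
    using F X.proj_eq_iff[of F "\<one>\<^bsub>?F\<^esub>"] unfolding R_def[symmetric] by simp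
qed

text \<open>The coefficients of the quadratic form \<open>T x x\<close> in the coordinates: values
  at basis vectors for the squares, the polar form for the mixed terms. They are additive in
  \<open>T\<close> and do not change when \<open>T\<close> is transposed.\<close>

definition quadratic_coefficient :: "(bit ^ 'n::finite \<Rightarrow> bit ^ 'n \<Rightarrow> bit) \<Rightarrow> 'n \<Rightarrow> 'n \<Rightarrow> bit" where
  "quadratic_coefficient T i j =
    (if i = j then T (axis i 1) (axis i 1) else T (axis i 1) (axis j 1) + T (axis j 1) (axis i 1))"

definition normal_form2 :: "('n \<Rightarrow> nat) \<Rightarrow> ((bit ^ 'n::finite \<Rightarrow> bit) list \<Rightarrow> bit) \<Rightarrow> (bit ^ 'n \<Rightarrow> bit) list \<Rightarrow> bit" where
  "normal_form2 r F = (\<lambda>ws\<in>words 2 (carrier dual_F2). \<Sum>(i, j)\<in>{(i, j). r i \<le> r j}.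
    quadratic_coefficient (evaluate2 F) i j * word_basis 2 dual_F2 [coordinate i, coordinate j] ws)"

lemma normal_form2_add:
  assumes "\<And>x y. evaluate2 F x y = evaluate2 F1 x y + evaluate2 F2 x y"
  shows "normal_form2 r F = normal_form2 r F1 \<otimes>\<^bsub>free_words 2 dual_F2\<^esub> normal_form2 r F2"
proof -
  have "quadratic_coefficient (evaluate2 F) i j
      = quadratic_coefficient (evaluate2 F1) i j + quadratic_coefficient (evaluate2 F2) i j" for i j
    by (simp add: quadratic_coefficient_def assms ac_simps)
  then show ?thesis
    unfolding normal_form2_def free_words_mult
    by (intro restrict_ext) (simp add: case_prod_unfold distrib_right sum.distrib)
qed

lemma normal_form2_carrier: "normal_form2 r F \<in> carrier (free_words 2 dual_F2)"
  by (simp add: normal_form2_def carrier_free_words_dual)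

text \<open>Expanding the diagonal at \<open>x + y\<close> shows that the polar form vanishes as
  well, and with it every mixed coefficient.\<close>

lemma normal_form2_zero:
  assumes "\<And>x. evaluate2 F x x = 0"
  shows "normal_form2 r F = \<one>\<^bsub>free_words 2 dual_F2\<^esub>"
proof -
  have "evaluate2 F x y + evaluate2 F y x = 0" for x y
    using assms[of "x + y"] assms[of x] assms[of y] by (simp add: evaluate2_add ac_simps)
  then have "quadratic_coefficient (evaluate2 F) i j = 0" for i j
    by (simp add: quadratic_coefficient_def assms)
  then show ?thesis
    by (simp add: normal_form2_def free_words_one case_prod_unfold)
qed

lemma normal_form2_hom: "normal_form2 r \<in> hom (free_words 2 dual_F2) (free_words 2 dual_F2)"
  by (rule homI) (auto intro!: normal_form2_carrier normal_form2_add simp: evaluate2_mult)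

lemma normal_form2_basis:
  assumes "r a \<le> r b" "inj r"
  shows "normal_form2 r (word_basis 2 dual_F2 [coordinate a, coordinate b])
    = word_basis 2 dual_F2 [coordinate a, coordinate b]"
proof -
  let ?T = "{(i, j). r i \<le> r j}"
  let ?b = "\<lambda>(i, j). word_basis 2 dual_F2 [coordinate i, coordinate j]"
  have "(\<Sum>t\<in>?T. (if t = (a, b) then 1 else 0) * ?b t ws) = ?b (a, b) ws" for ws
    using assms by (intro sum_delta_bit) auto
  note delta = this
  have coefficient: "quadratic_coefficient (evaluate2 (word_basis 2 dual_F2 [coordinate a, coordinate b])) i j
      = (if (i, j) = (a, b) then 1 else 0)" if "r i \<le> r j" for i j
    using that assms by (auto simp: quadratic_coefficient_def evaluate2_basis coordinate_axis inj_eq)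
  have "normal_form2 r (?b (a, b)) ws = (\<Sum>t\<in>?T. (if t = (a, b) then 1 else 0) * ?b t ws)"
    if "ws \<in> words 2 (carrier dual_F2)" for ws
    using that by (auto simp: normal_form2_def coefficient simp del: prod.inject intro!: sum.cong)
  then show ?thesis
    unfolding delta
    by (intro extensionalityI[of _ "words 2 (carrier dual_F2)"]) (auto simp: normal_form2_def word_basis_def)
qed

text \<open>A homogeneous quadratic polynomial over two elements is determined by its values: a
  square agrees with its linear form as a function, but linear terms do not occur. The proof
  compares with a normal form, as for the exterior cube.\<close>

lemma symmetric_relationsI:
  assumes F: "F \<in> carrier (free_words 2 (dual_F2 :: (bit ^ 'n::finite \<Rightarrow> bit) monoid))"
    and diagonal: "\<And>x. evaluate2 F x x = 0"
  shows "F \<in> generate (free_words 2 dual_F2) (tensor_relations 2 dual_F2 \<union> symmetric_relations 2 dual_F2)"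
proof -
  let ?F = "free_words 2 (dual_F2 :: (bit ^ 'n \<Rightarrow> bit) monoid)"
  let ?b = "word_basis 2 (dual_F2 :: (bit ^ 'n \<Rightarrow> bit) monoid)"
  define R where "R = generate ?F (tensor_relations 2 dual_F2 \<union> symmetric_relations 2 dual_F2)"
  interpret X: quotient_module GL_F2 ?F R "free_words_action GL_F2 2 dual_F2 dual_action"
    unfolding R_def by (rule quotient_module_symmetric)
  let ?Q = "?F Mod R"
  have tensor: "tensor_relations 2 dual_F2 \<subseteq> R" and symmetric: "symmetric_relations 2 dual_F2 \<subseteq> R"
    by (auto simp: R_def intro: generate.incl)
  note rel = proj_tensor_relation[OF X.quotient_module_axioms tensor, unfolded dual_F2_simps(2)]
  obtain r :: "'n \<Rightarrow> nat" where r: "inj r"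
    by (metis ex_inj)
  have comm: "comm_group ?Q" by (rule X.comm_group_Mod)
  have closed: "X.proj x \<in> carrier ?Q" if "x \<in> carrier ?F" for x
    using that by (simp add: X.carrier_Mod)
  have 1: "bilinear_symmetric ?Q (\<lambda>u v. X.proj (?b [u, v]))"
  proof (intro bilinear_symmetric.intro bilinear_symmetric_axioms.intro comm closed word_basis_carrier)
    fix u u' v :: "bit ^ 'n \<Rightarrow> bit"
    assume u: "u \<in> carrier dual_F2" and u': "u' \<in> carrier dual_F2" and v: "v \<in> carrier dual_F2"
    show "X.proj (?b [\<lambda>x. u x + u' x, v]) = X.proj (?b [u, v]) \<otimes>\<^bsub>?Q\<^esub> X.proj (?b [u', v])"
      using rel[of "[]" u "[v]" u'] u u' v by (simp del: mult_FactGroup)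
  next
    fix u v :: "bit ^ 'n \<Rightarrow> bit"
    assume u: "u \<in> carrier dual_F2" and v: "v \<in> carrier dual_F2"
    have "?b [u, v] \<otimes>\<^bsub>?F\<^esub> inv\<^bsub>?F\<^esub> ?b [v, u] \<in> symmetric_relations 2 dual_F2"
      using symmetric_relationI[of "[]" u v "[]" 2 dual_F2] u v by simp
    then show "X.proj (?b [u, v]) = X.proj (?b [v, u])"
      using symmetric by (auto simp: X.proj_eq_iff word_basis_carrier)
  qed
  have 2: "bilinear_symmetric ?Q (\<lambda>u v. X.proj (normal_form2 r (?b [u, v])))"
  proof (intro bilinear_symmetric.intro bilinear_symmetric_axioms.intro comm closed normal_form2_carrier)
    fix u u' v :: "bit ^ 'n \<Rightarrow> bit"
    assume u: "u \<in> carrier dual_F2" and u': "u' \<in> carrier dual_F2" and v: "v \<in> carrier dual_F2"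
    show "X.proj (normal_form2 r (?b [\<lambda>x. u x + u' x, v]))
        = X.proj (normal_form2 r (?b [u, v])) \<otimes>\<^bsub>?Q\<^esub> X.proj (normal_form2 r (?b [u', v]))"
      by (subst normal_form2_add[of _ "?b [u, v]" "?b [u', v]"])
        (simp_all add: evaluate2_basis u u' v dual_add_closed distrib_right X.proj_mult normal_form2_carrier
          del: mult_FactGroup)
  next
    fix u v :: "bit ^ 'n \<Rightarrow> bit"
    assume u: "u \<in> carrier dual_F2" and v: "v \<in> carrier dual_F2"
    have "quadratic_coefficient (evaluate2 (?b [u, v])) i j
        = quadratic_coefficient (evaluate2 (?b [v, u])) i j" for i j
      by (simp add: quadratic_coefficient_def evaluate2_basis u v ac_simps)
    then have "normal_form2 r (?b [u, v]) = normal_form2 r (?b [v, u])"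
      by (simp add: normal_form2_def)
    then show "X.proj (normal_form2 r (?b [u, v])) = X.proj (normal_form2 r (?b [v, u]))"
      by simp
  qed
  have "X.proj F = X.proj (normal_form2 r F)"
  proof (rule free_words_hom_eq[where h = X.proj and Q = ?Q, OF _ _ _ _ F])
    show "X.proj \<in> hom ?F ?Q"
      by (rule normal.r_coset_hom_Mod[OF X.normal])
    then show "(\<lambda>F. X.proj (normal_form2 r F)) \<in> hom ?F ?Q"
      using hom_compose[OF normal_form2_hom] by (auto simp: comp_def)
    show "group ?Q" using comm by (rule comm_group.axioms)
    show "X.proj (?b ws) = X.proj (normal_form2 r (?b ws))" if ws: "ws \<in> words 2 (carrier dual_F2)" for ws
    proof -
      obtain u v where uv: "u \<in> carrier dual_F2" "v \<in> carrier dual_F2" "ws = [u, v]"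
        using ws by (auto simp: words_2_iff)
      show ?thesis
        unfolding uv(3)
        by (rule bilinear_symmetric_eqI[OF 1 2 _ uv(1-2), of r]) (simp add: normal_form2_basis r)
    qed
  qed
  also have "normal_form2 r F = \<one>\<^bsub>?F\<^esub>"
    by (rule normal_form2_zero[OF diagonal])
  finally show ?thesis
    using F X.proj_eq_iff[of F "\<one>\<^bsub>?F\<^esub>"] unfolding R_def[symmetric] by simp
qed

section \<open>The exact sequence\<close>

abbreviation "cocycle_group \<equiv> (cochains 3)\<lparr>carrier := cocycles 3\<rparr>"

lemma quotient_module_cohomology:
  "quotient_module GL_F2 (cocycle_group :: ((bit ^ 'n::finite) list \<Rightarrow> 'k::field) monoid) (coboundaries 3)
    (\<lambda>g. precomp 3 UNIV ((*v) (inv\<^bsub>GL_F2\<^esub> g)))"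
  by (rule quotient_module_cohomology_3) (simp_all add: group_GL_F2 GL_F2_act matrix_vector_right_distrib)

lemma word_cochain_one: "word_cochain \<one>\<^bsub>free_words 3 dual_F2\<^esub> = \<one>\<^bsub>cocycle_group\<^esub>"
  by (simp add: word_cochain_def evaluate3_def free_words_one cochain3_one)

lemma word_cochain_mult:
  "word_cochain (F \<otimes>\<^bsub>free_words 3 dual_F2\<^esub> H) = word_cochain F \<otimes>\<^bsub>cocycle_group\<^esub> word_cochain H"
  by (simp add: word_cochain_def evaluate3_mult cochain3_mult scale_minus_one_add)

lemma word_cochain_inv:
  "inv\<^bsub>cocycle_group\<^esub> (word_cochain F :: (bit ^ 'n::finite) list \<Rightarrow> 'k::field) = word_cochain F"
proof -
  interpret Z: quotient_module GL_F2 "cocycle_group :: ((bit ^ 'n) list \<Rightarrow> 'k) monoid" "coboundaries 3"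
    "\<lambda>g. precomp 3 UNIV ((*v) (inv\<^bsub>GL_F2\<^esub> g))"
    by (rule quotient_module_cohomology)
  have "word_cochain F \<otimes>\<^bsub>cocycle_group\<^esub> word_cochain F = (\<one>\<^bsub>cocycle_group\<^esub> :: (bit ^ 'n) list \<Rightarrow> 'k)"
    by (simp add: word_cochain_def cochain3_mult cochain3_one flip: scale_minus_one_add)
  then show ?thesis
    by (rule Z.M.inv_equality) (simp_all add: word_cochain_cocycle)
qed

text \<open>A primitive with bit values is enough here. It covers all relations except the symmetric
  ones.\<close>

lemma word_cochain_coboundaryI:
  assumes "\<And>x y z. evaluate3 F x y z = d2 k x y z"
  shows "word_cochain F \<in> coboundaries 3"
  unfolding word_cochain_def cochain3_coboundary_iff
  by (rule exI[of _ "\<lambda>x y. scale_bit (k x y) minus_one_unit"]) (simp add: fun_eq_iff d2_scale assms)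

section \<open>Evaluation and doubling of words under the group action\<close>

lemma evaluate3_act:
  fixes F :: "(bit ^ 'n::finite \<Rightarrow> bit) list \<Rightarrow> bit"
  assumes g: "g \<in> carrier GL_F2" and F: "F \<in> carrier (free_words 3 dual_F2)"
  shows "evaluate3 (free_words_action GL_F2 3 dual_F2 dual_action g F) x y z
    = evaluate3 F (inv\<^bsub>GL_F2\<^esub> g *v x) (inv\<^bsub>GL_F2\<^esub> g *v y) (inv\<^bsub>GL_F2\<^esub> g *v z)"
proof -
  interpret A: group_action_on_group GL_F2 "dual_F2 :: (bit ^ 'n \<Rightarrow> bit) monoid" dual_action
    by (rule dual_action_module)
  show ?thesis
  proof (rule free_words_hom_eq[OF _ _ group_additive_F2 _ F])
    show "(\<lambda>F. evaluate3 (A.act 3 g F) x y z) \<in> hom (free_words 3 dual_F2) additive_F2"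
      by (rule homI) (simp_all add: hom_mult[OF A.act_hom[OF g]] evaluate3_mult)
    show "(\<lambda>F. evaluate3 F (inv\<^bsub>GL_F2\<^esub> g *v x) (inv\<^bsub>GL_F2\<^esub> g *v y) (inv\<^bsub>GL_F2\<^esub> g *v z))
        \<in> hom (free_words 3 dual_F2) additive_F2"
      by (rule homI) (simp_all add: evaluate3_mult)
    show "evaluate3 (A.act 3 g (word_basis 3 dual_F2 ws)) x y z = evaluate3 (word_basis 3 dual_F2 ws)
        (inv\<^bsub>GL_F2\<^esub> g *v x) (inv\<^bsub>GL_F2\<^esub> g *v y) (inv\<^bsub>GL_F2\<^esub> g *v z)"
      if ws: "ws \<in> words 3 (carrier dual_F2)" for ws
    proof -
      obtain u v w where uvw: "u \<in> carrier dual_F2" "v \<in> carrier dual_F2" "w \<in> carrier dual_F2" "ws = [u, v, w]"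
        using ws by (auto simp: words_3_iff)
      then show ?thesis
        using A.closed[OF g]
        by (simp add: A.act_basis[OF g] evaluate3_basis) (simp add: dual_action_def)
    qed
  qed
qed

lemma double_first_act:
  fixes F :: "(bit ^ 'n::finite \<Rightarrow> bit) list \<Rightarrow> bit"
  assumes g: "g \<in> carrier GL_F2" and F: "F \<in> carrier (free_words 2 dual_F2)"
  shows "double_first (free_words_action GL_F2 2 dual_F2 dual_action g F)
    = free_words_action GL_F2 3 dual_F2 dual_action g (double_first F)"
proof -
  interpret A: group_action_on_group GL_F2 "dual_F2 :: (bit ^ 'n \<Rightarrow> bit) monoid" dual_action
    by (rule dual_action_module)
  show ?thesis
  proof (rule free_words_hom_eq[OF _ _ group_free_words _ F])
    show "(\<lambda>F. double_first (A.act 2 g F)) \<in> hom (free_words 2 dual_F2) (free_words 3 dual_F2)"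
      using hom_compose[OF A.act_hom[OF g] double_first_hom] by (simp add: comp_def)
    show "(\<lambda>F. A.act 3 g (double_first F)) \<in> hom (free_words 2 dual_F2) (free_words 3 dual_F2)"
      using hom_compose[OF double_first_hom A.act_hom[OF g]] by (simp add: comp_def)
    show "double_first (A.act 2 g (word_basis 2 dual_F2 ws)) = A.act 3 g (double_first (word_basis 2 dual_F2 ws))"
      if "ws \<in> words 2 (carrier dual_F2)" for ws
      using that by (auto simp: words_2_iff A.act_basis[OF g] double_first_basis)
  qed
qed

lemma evaluate3_double_first_mult:
  assumes "F \<in> carrier (free_words 2 dual_F2)" "H \<in> carrier (free_words 2 dual_F2)"
  shows "evaluate3 (double_first (F \<otimes>\<^bsub>free_words 2 dual_F2\<^esub> H)) x y z
    = evaluate3 (double_first F) x y z + evaluate3 (double_first H) x y z"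
  using hom_mult[OF double_first_hom assms] by (simp add: evaluate3_mult)

text \<open>Bits are idempotent, so repeating the first letter does not change the value on the
  diagonal. This turns \<open>diagonal_coboundary\<close> into a statement about quadratic
  forms.\<close>

lemma evaluate3_double_first_diagonal:
  assumes F: "F \<in> carrier (free_words 2 dual_F2)"
  shows "evaluate3 (double_first F) x x x = evaluate2 F x x"
proof (rule free_words_hom_eq[OF _ _ group_additive_F2 _ F])
  show "(\<lambda>F. evaluate3 (double_first F) x x x) \<in> hom (free_words 2 dual_F2) additive_F2"
    by (rule homI) (simp_all add: evaluate3_double_first_mult)
  show "(\<lambda>F. evaluate2 F x x) \<in> hom (free_words 2 dual_F2) additive_F2"
    by (rule homI) (simp_all add: evaluate2_mult)
  show "evaluate3 (double_first (word_basis 2 dual_F2 ws)) x x x = evaluate2 (word_basis 2 dual_F2 ws) x x"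
    if ws: "ws \<in> words 2 (carrier dual_F2)" for ws
  proof -
    obtain u v where "u \<in> carrier dual_F2" "v \<in> carrier dual_F2" "ws = [u, v]"
      using ws by (auto simp: words_2_iff)
    then show ?thesis
      by (cases "u x") (simp_all add: double_first_basis evaluate3_basis evaluate2_basis)
  qed
qed

text \<open>For a word \<open>[u, u, v]\<close> the six permuted values cancel in pairs; the
  alternation criterion carries this over to sums.\<close>

lemma double_first_exterior:
  assumes F: "F \<in> carrier (free_words 2 (dual_F2 :: (bit ^ 'n::finite \<Rightarrow> bit) monoid))"
  shows "double_first F \<in> generate (free_words 3 dual_F2) (tensor_relations 3 dual_F2 \<union> exterior_relations 3 dual_F2)"
proof (rule exterior_relationsI)
  show "double_first F \<in> carrier (free_words 3 dual_F2)"
    using F double_first_hom by (auto simp: hom_def)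
  show "alternation (evaluate3 (double_first F)) x y z = 0" for x y z
  proof (rule free_words_hom_eq[OF _ _ group_additive_F2 _ F])
    show "(\<lambda>F. alternation (evaluate3 (double_first F)) x y z) \<in> hom (free_words 2 dual_F2) additive_F2"
      by (rule homI) (simp_all add: alternation_def evaluate3_double_first_mult ac_simps)
    show "(\<lambda>F. 0) \<in> hom (free_words 2 dual_F2) additive_F2"
      by (rule homI) simp_all
    show "alternation (evaluate3 (double_first (word_basis 2 dual_F2 ws))) x y z = 0"
      if "ws \<in> words 2 (carrier dual_F2)" for ws
      using that by (auto simp: words_2_iff double_first_basis alternation_def evaluate3_basis ac_simps)
  qed
qed

text \<open>Modulo two, the pointwise product of two linear forms has as coboundary the sum of their
  cup products in both orders. The form \<open>w\<close> is carried along as a further cup factor on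
  either side.\<close>

lemma d2_swap:
  fixes u v w :: "'v::ab_group_add \<Rightarrow> bit"
  assumes "\<And>x y. u (x + y) = u x + u y" "\<And>x y. v (x + y) = v x + v y" "\<And>x y. w (x + y) = w x + w y"
  shows "d2 (\<lambda>x y. u x * v x * w y) x y z = u x * v y * w z + v x * u y * w z"
    and "d2 (\<lambda>x y. w x * u y * v y) x y z = w x * u y * v z + w x * v y * u z"
  by (simp_all add: d2_def assms algebra_simps)

text \<open>Two swaps in succession, u v v to v u v to v v u; the middle term cancels.\<close>

lemma d2_reverse:
  fixes u v :: "'v::ab_group_add \<Rightarrow> bit"
  assumes "\<And>x y. u (x + y) = u x + u y" "\<And>x y. v (x + y) = v x + v y"
  shows "d2 (\<lambda>x y. u x * v x * v y + v x * u y * v y) x y z = u x * v y * v z + v x * v y * u z"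
  by (simp add: d2_def assms algebra_simps)

text \<open>The integral cochain \<open>u \<union> v\<close> of the lifts to \<open>{0, 1}\<close> has coboundary
  \<open>2 (u \<union> u \<union> v - u \<union> v \<union> v)\<close>; hence the cochain with values in the fourth roots of
  unity.\<close>

lemma d2_half:
  fixes u v :: "'v::ab_group_add \<Rightarrow> bit" and h :: "'k::field additive_units"
  assumes u: "\<And>x y. u (x + y) = u x + u y" and v: "\<And>x y. v (x + y) = v x + v y"
    and h: "h + h = minus_one_unit"
  shows "d2 (\<lambda>x y. scale_bit (u x * v y) h) x y z
    = scale_bit (u x * u y * v z + u x * v y * v z) minus_one_unit"
proof -
  \<comment> \<open>The carry of binary addition: as integers, the lift of a + b is the sum of the
    lifts minus 2 a b, and twice \<open>h\<close> is \<open>minus_one_unit\<close>.\<close>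
  have half_add: "scale_bit (a + b) h = scale_bit a h + scale_bit b h - scale_bit (a * b) minus_one_unit" for a b
    using h by (cases a; cases b) auto
  have idem: "a * (a * b) = a * b" "a * a = a" for a b :: bit
    by (cases a; simp)+
  show ?thesis
    unfolding d2_def u v distrib_left distrib_right half_add scale_minus_one_add
    by (simp add: scale_minus_one_diff scale_minus_one_uminus idem ac_simps)
qed

section \<open>Cohomology classes of the relations\<close>

lemma words_2_split:
  "us @ [x] @ vs \<in> words 2 A \<Longrightarrow> x \<in> A \<and> ((\<exists>p\<in>A. us = [] \<and> vs = [p]) \<or> (\<exists>p\<in>A. us = [p] \<and> vs = []))"
  by (auto simp: words_2_iff append_eq_Cons_conv Cons_eq_append_conv)

lemma words_3_split:
  "us @ [x] @ vs \<in> words 3 A \<Longrightarrow> x \<in> A \<and> (\<exists>p\<in>A. \<exists>q\<in>A.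
    us = [] \<and> vs = [p, q] \<or> us = [p] \<and> vs = [q] \<or> us = [p, q] \<and> vs = [])"
  by (auto simp: words_3_iff append_eq_Cons_conv Cons_eq_append_conv)

lemma tensor_relations_evaluate3:
  fixes r :: "(bit ^ 'n::finite \<Rightarrow> bit) list \<Rightarrow> bit"
  assumes "r \<in> tensor_relations 3 dual_F2"
  shows "evaluate3 r x y z = 0"
proof -
  interpret F: comm_group "free_words 3 (dual_F2 :: (bit ^ 'n \<Rightarrow> bit) monoid)"
    by (rule comm_group_free_words)
  obtain us u u' vs where w: "us @ [u] @ vs \<in> words 3 (carrier dual_F2)" "u' \<in> carrier dual_F2"
    and r: "r = word_basis 3 dual_F2 (us @ [\<lambda>x. u x + u' x] @ vs)
      \<otimes>\<^bsub>free_words 3 dual_F2\<^esub> inv\<^bsub>free_words 3 dual_F2\<^esub>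
        (word_basis 3 dual_F2 (us @ [u] @ vs) \<otimes>\<^bsub>free_words 3 dual_F2\<^esub> word_basis 3 dual_F2 (us @ [u'] @ vs))"
    using assms unfolding tensor_relations_def dual_F2_simps(2) by blast
  show ?thesis
    unfolding r using words_3_split[OF w(1)] w(2) dual_add_closed[of u u']
    by (auto simp: free_words_inv word_basis_carrier evaluate3_mult evaluate3_basis algebra_simps)
qed

text \<open>This makes \<iota> well defined. Doubling is not linear in the doubled letter: a sum u +
  u' leaves the cross terms u u' p + u' u p, which \<open>d2_swap\<close> bounds. Symmetry passes
  from u u v through u v v to v v u.\<close>

lemma symmetric_relations_coboundary:
  fixes F :: "(bit ^ 'n::finite \<Rightarrow> bit) list \<Rightarrow> bit"
  assumes "F \<in> generate (free_words 2 dual_F2) (tensor_relations 2 dual_F2 \<union> symmetric_relations 2 dual_F2)"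
  shows "word_cochain (double_first F) \<in> (coboundaries 3 :: ((bit ^ 'n) list \<Rightarrow> 'k::{alg_closed_field, field_char_0}) set)"
proof -
  let ?F = "free_words 2 (dual_F2 :: (bit ^ 'n \<Rightarrow> bit) monoid)"
  let ?b = "word_basis 2 (dual_F2 :: (bit ^ 'n \<Rightarrow> bit) monoid)"
  let ?B = "coboundaries 3 :: ((bit ^ 'n) list \<Rightarrow> 'k) set"
  interpret F: comm_group ?F by (rule comm_group_free_words)
  interpret Z: quotient_module GL_F2 "cocycle_group :: ((bit ^ 'n) list \<Rightarrow> 'k) monoid" ?B
    "\<lambda>g. precomp 3 UNIV ((*v) (inv\<^bsub>GL_F2\<^esub> g))"
    by (rule quotient_module_cohomology)
  have R: "tensor_relations 2 dual_F2 \<union> symmetric_relations 2 dual_F2 \<subseteq> carrier ?F"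
    using tensor_relations_carrier symmetric_relations_carrier by blast
  have basis: "evaluate3 (double_first (?b [u, v])) x y z = u x * u y * v z"
    if "u \<in> carrier dual_F2" "v \<in> carrier dual_F2" for u v x y z
    using that by (simp add: double_first_basis evaluate3_basis)
  note mult = evaluate3_double_first_mult free_words_inv word_basis_carrier F.m_closed
  have rel: "word_cochain (double_first r) \<in> ?B"
    if r: "r \<in> tensor_relations 2 dual_F2 \<union> symmetric_relations 2 dual_F2" for r
    using r
  proof
    assume "r \<in> tensor_relations 2 dual_F2"
    then obtain us u u' vs where w: "us @ [u] @ vs \<in> words 2 (carrier dual_F2)" "u' \<in> carrier dual_F2"
      and r: "r = ?b (us @ [\<lambda>x. u x + u' x] @ vs) \<otimes>\<^bsub>?F\<^esub> inv\<^bsub>?F\<^esub> (?b (us @ [u] @ vs) \<otimes>\<^bsub>?F\<^esub> ?b (us @ [u'] @ vs))"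
      unfolding tensor_relations_def dual_F2_simps(2) by blast
    from words_2_split[OF w(1)] have u: "u \<in> carrier dual_F2"
      and cases: "(\<exists>p\<in>carrier dual_F2. us = [] \<and> vs = [p]) \<or> (\<exists>p\<in>carrier dual_F2. us = [p] \<and> vs = [])"
      by auto
    note uu' = dual_add_closed[OF u w(2)]
    from cases show "word_cochain (double_first r) \<in> ?B"
    proof (elim disjE bexE conjE)
      fix p assume p: "p \<in> carrier dual_F2" and "us = []" "vs = [p]"
      then have "evaluate3 (double_first r) x y z = d2 (\<lambda>x y. u x * u' x * p y) x y z" for x y z
        unfolding r using u w(2) p uu'
        by (subst d2_swap) (simp_all add: mult basis dual_F2_simps(1), simp add: algebra_simps)
      then show ?thesis by (rule word_cochain_coboundaryI)
    next
      fix p assume p: "p \<in> carrier dual_F2" and "us = [p]" "vs = []"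
      then have "evaluate3 (double_first r) x y z = d2 (\<lambda>x y. 0) x y z" for x y z
        unfolding r using u w(2) p uu'
        by (simp add: mult basis d2_def, simp add: algebra_simps)
      then show ?thesis by (rule word_cochain_coboundaryI)
    qed
  next
    assume "r \<in> symmetric_relations 2 dual_F2"
    then obtain us u v vs where w: "us @ [u, v] @ vs \<in> words 2 (carrier dual_F2)"
      and r: "r = ?b (us @ [u, v] @ vs) \<otimes>\<^bsub>?F\<^esub> inv\<^bsub>?F\<^esub> ?b (us @ [v, u] @ vs)"
      unfolding symmetric_relations_def by blast
    from w have uv: "u \<in> carrier dual_F2" "v \<in> carrier dual_F2" and "us = []" "vs = []"
      by (auto simp: words_2_iff append_eq_Cons_conv Cons_eq_append_conv)
    then have eval: "evaluate3 (double_first r) x y z = u x * u y * v z + v x * v y * u z" for x y z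
      unfolding r by (simp add: mult basis)
    obtain h :: "'k additive_units" where h: "h + h = minus_one_unit"
      using divisible_additive_units by blast
    \<comment> \<open>Multiplicatively \<open>h\<close> is a square root of -1. The summand with
      \<open>h\<close> exchanges u u v for u v v, the other one moves \<open>u\<close> across the
      pair to give v v u, and the two copies of u v v cancel.\<close>
    have "scale_bit (evaluate3 (double_first r) x y z) minus_one_unit
        = d2 (\<lambda>x y. scale_bit (u x * v y) h + scale_bit (u x * v x * v y + v x * u y * v y) minus_one_unit) x y z"
      for x y z
    proof -
      have "d2 (\<lambda>x y. scale_bit (u x * v y) h + scale_bit (u x * v x * v y + v x * u y * v y) minus_one_unit) x y z
        = d2 (\<lambda>x y. scale_bit (u x * v y) h) x y z
          + d2 (\<lambda>x y. scale_bit (u x * v x * v y + v x * u y * v y) minus_one_unit) x y z"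
        by (simp add: d2_def algebra_simps)
      also have "\<dots> = scale_bit (u x * u y * v z + u x * v y * v z) minus_one_unit
          + scale_bit (u x * v y * v z + v x * v y * u z) minus_one_unit"
        using uv h by (simp add: d2_half d2_scale d2_reverse dual_F2_simps(1))
      also have "\<dots> = scale_bit (u x * u y * v z + v x * v y * u z) minus_one_unit"
        by (simp add: ac_simps flip: scale_minus_one_add)
      finally show ?thesis by (simp add: eval)
    qed
    then show "word_cochain (double_first r) \<in> ?B"
      unfolding word_cochain_def cochain3_coboundary_iff by (intro exI ext)
  qed
  from assms show ?thesis
  proof (induction F rule: generate.induct)
    case one
    have "double_first \<one>\<^bsub>?F\<^esub> = \<one>\<^bsub>free_words 3 dual_F2\<^esub>"
      using hom_one[OF double_first_hom F.group_axioms group_free_words] .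
    then show ?case
      using Z.N.one_closed by (simp add: word_cochain_one)
  next
    case (incl r)
    then show ?case by (rule rel)
  next
    case (inv r)
    then have "inv\<^bsub>?F\<^esub> r = r"
      using R free_words_inv by blast
    with inv rel show ?case by simp
  next
    case (eng r s)
    then have "r \<in> carrier ?F" "s \<in> carrier ?F"
      using F.generate_in_carrier[OF R] by blast+
    then have "word_cochain (double_first (r \<otimes>\<^bsub>?F\<^esub> s))
        = (word_cochain (double_first r) \<otimes>\<^bsub>cocycle_group\<^esub> word_cochain (double_first s) :: (bit ^ 'n) list \<Rightarrow> 'k)"
      by (simp only: hom_mult[OF double_first_hom] word_cochain_mult)
    then show ?case
      using Z.N.m_closed[OF eng.IH] by metis
  qed
qed

text \<open>A witness \<open>H\<close> is found for each generator and then multiplied along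
  products, as doubling and \<open>word_cochain\<close> are homomorphisms. A tensor relation has
  zero trilinear form and takes the unit; an exterior relation in \<open>u\<close> and
  \<open>v\<close> takes the word \<open>[u, v]\<close>.\<close>

lemma exterior_relations_cohomologous:
  fixes F :: "(bit ^ 'n::finite \<Rightarrow> bit) list \<Rightarrow> bit"
  assumes "F \<in> generate (free_words 3 dual_F2) (tensor_relations 3 dual_F2 \<union> exterior_relations 3 dual_F2)"
  shows "\<exists>H\<in>carrier (free_words 2 dual_F2).
    word_cochain F \<otimes>\<^bsub>cocycle_group\<^esub> inv\<^bsub>cocycle_group\<^esub> word_cochain (double_first H)
      \<in> (coboundaries 3 :: ((bit ^ 'n) list \<Rightarrow> 'k::{alg_closed_field, field_char_0}) set)"
proof -
  let ?F = "free_words 3 (dual_F2 :: (bit ^ 'n \<Rightarrow> bit) monoid)"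
  let ?E = "free_words 2 (dual_F2 :: (bit ^ 'n \<Rightarrow> bit) monoid)"
  let ?b = "word_basis 3 (dual_F2 :: (bit ^ 'n \<Rightarrow> bit) monoid)"
  let ?c = "word_basis 2 (dual_F2 :: (bit ^ 'n \<Rightarrow> bit) monoid)"
  let ?B = "coboundaries 3 :: ((bit ^ 'n) list \<Rightarrow> 'k) set"
  interpret F: comm_group ?F by (rule comm_group_free_words)
  interpret E: comm_group ?E by (rule comm_group_free_words)
  interpret Z: quotient_module GL_F2 "cocycle_group :: ((bit ^ 'n) list \<Rightarrow> 'k) monoid" ?B
    "\<lambda>g. precomp 3 UNIV ((*v) (inv\<^bsub>GL_F2\<^esub> g))"
    by (rule quotient_module_cohomology)
  have R: "tensor_relations 3 dual_F2 \<union> exterior_relations 3 dual_F2 \<subseteq> carrier ?F"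
    using tensor_relations_carrier exterior_relations_carrier by blast
  have dc: "double_first H \<in> carrier ?F" if "H \<in> carrier ?E" for H
    using that double_first_hom by (auto simp: hom_def)
  \<comment> \<open>Word cochains have order at most two, so the inverse drops out and the quotient
    is again the cochain of a sum of words.\<close>
  have diff: "(word_cochain F \<otimes>\<^bsub>cocycle_group\<^esub> inv\<^bsub>cocycle_group\<^esub> word_cochain (double_first H) :: (bit ^ 'n) list \<Rightarrow> 'k)
      = word_cochain (F \<otimes>\<^bsub>?F\<^esub> double_first H)" for F H
    by (simp only: word_cochain_inv word_cochain_mult)
  have rel: "\<exists>H\<in>carrier ?E. word_cochain (r \<otimes>\<^bsub>?F\<^esub> double_first H) \<in> ?B"
    if r: "r \<in> tensor_relations 3 dual_F2 \<union> exterior_relations 3 dual_F2" for r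
    using r
  proof
    assume r: "r \<in> tensor_relations 3 dual_F2"
    have "double_first \<one>\<^bsub>?E\<^esub> = \<one>\<^bsub>?F\<^esub>"
      using hom_one[OF double_first_hom E.group_axioms F.group_axioms] .
    moreover have "r \<in> carrier ?F" using R r by blast
    ultimately have "evaluate3 (r \<otimes>\<^bsub>?F\<^esub> double_first \<one>\<^bsub>?E\<^esub>) x y z = d2 (\<lambda>x y. 0) x y z" for x y z
      by (simp add: tensor_relations_evaluate3[OF r] d2_def)
    then have "word_cochain (r \<otimes>\<^bsub>?F\<^esub> double_first \<one>\<^bsub>?E\<^esub>) \<in> ?B"
      by (rule word_cochain_coboundaryI)
    then show ?thesis by blast
  next
    assume "r \<in> exterior_relations 3 dual_F2"
    then obtain us u vs where w: "us @ [u] @ (u # vs) \<in> words 3 (carrier dual_F2)"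
      and r: "r = ?b (us @ [u, u] @ vs)"
      unfolding exterior_relations_def by auto
    from words_3_split[OF w] obtain v where uv: "u \<in> carrier dual_F2" "v \<in> carrier dual_F2"
      and cases: "us = [] \<and> vs = [v] \<or> us = [v] \<and> vs = []"
      by auto
    from cases have "\<exists>k. \<forall>x y z. evaluate3 (r \<otimes>\<^bsub>?F\<^esub> double_first (?c [u, v])) x y z = d2 k x y z"
    proof (elim disjE conjE)
      assume "us = []" "vs = [v]"
      then show ?thesis
        using uv by (intro exI[of _ "\<lambda>x y. 0"])
          (simp add: r evaluate3_mult double_first_basis d2_def)
    next
      assume "us = [v]" "vs = []"
      then show ?thesis
        \<comment> \<open>The cochain of \<open>d2_reverse\<close> with \<open>u\<close> and
          \<open>v\<close> exchanged: it carries \<open>v\<close> across the pair u u.\<close>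
        using uv by (intro exI[of _ "\<lambda>x y. v x * u x * u y + u x * v y * u y"])
          (simp add: r evaluate3_mult double_first_basis evaluate3_basis d2_reverse dual_F2_simps(1))
    qed
    then have "word_cochain (r \<otimes>\<^bsub>?F\<^esub> double_first (?c [u, v])) \<in> ?B"
      using word_cochain_coboundaryI by blast
    then show ?thesis
      using word_basis_carrier by blast
  qed
  from assms show ?thesis
    unfolding diff
  proof (induction F rule: generate.induct)
    case one
    have "double_first \<one>\<^bsub>?E\<^esub> = \<one>\<^bsub>?F\<^esub>"
      using hom_one[OF double_first_hom E.group_axioms F.group_axioms] .
    then have "word_cochain (\<one>\<^bsub>?F\<^esub> \<otimes>\<^bsub>?F\<^esub> double_first \<one>\<^bsub>?E\<^esub>) \<in> ?B"
      using Z.N.one_closed by (simp add: word_cochain_one)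
    then show ?case by blast
  next
    case (incl r)
    then show ?case by (rule rel)
  next
    case (inv r)
    then have "inv\<^bsub>?F\<^esub> r = r"
      using R free_words_inv by blast
    with inv rel show ?case by simp
  next
    case (eng r s)
    then have rs: "r \<in> carrier ?F" "s \<in> carrier ?F"
      using F.generate_in_carrier[OF R] by blast+
    from eng.IH obtain H K where H: "H \<in> carrier ?E" "word_cochain (r \<otimes>\<^bsub>?F\<^esub> double_first H) \<in> ?B"
      and K: "K \<in> carrier ?E" "word_cochain (s \<otimes>\<^bsub>?F\<^esub> double_first K) \<in> ?B"
      by blast
    have "(r \<otimes>\<^bsub>?F\<^esub> s) \<otimes>\<^bsub>?F\<^esub> double_first (H \<otimes>\<^bsub>?E\<^esub> K)
        = (r \<otimes>\<^bsub>?F\<^esub> double_first H) \<otimes>\<^bsub>?F\<^esub> (s \<otimes>\<^bsub>?F\<^esub> double_first K)"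
      using rs H(1) K(1) dc by (simp add: hom_mult[OF double_first_hom] F.m_ac)
    then have "word_cochain ((r \<otimes>\<^bsub>?F\<^esub> s) \<otimes>\<^bsub>?F\<^esub> double_first (H \<otimes>\<^bsub>?E\<^esub> K)) \<in> ?B"
      using Z.N.m_closed[OF H(2) K(2)] by (simp only: word_cochain_mult)
    with H(1) K(1) show ?case by blast
  qed
qed

theorem proposition5p7:
  shows "\<exists>(\<iota> :: ((bit ^ 'n::finite \<Rightarrow> bit) list \<Rightarrow> bit) set
              \<Rightarrow> ((bit ^ 'n) list \<Rightarrow> 'k::{alg_closed_field, field_char_0}) set)
          (\<pi> :: ((bit ^ 'n) list \<Rightarrow> 'k) set \<Rightarrow> ((bit ^ 'n \<Rightarrow> bit) list \<Rightarrow> bit) set).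
    short_exact_sequence_of_modules (GL_F2 :: (bit ^ 'n ^ 'n) monoid)
      (symmetric_power 2 dual_F2) (symmetric_power_action GL_F2 2 dual_F2 dual_action)
      (cohomology 3) (cohomology_action GL_F2 3 (*v))
      (exterior_power 3 dual_F2) (exterior_power_action GL_F2 3 dual_F2 dual_action)
      \<iota> \<pi>"
  unfolding symmetric_power_action_def exterior_power_action_def cohomology_action_def
    symmetric_power_def exterior_power_def cohomology_def
\<comment> \<open>Here \<open>F\<close> and \<open>E\<close> are the sums of words of length 3 and
  2, \<open>\<Phi>\<close> is \<open>word_cochain\<close>, and \<open>\<delta>\<close> doubles the
  first letter.\<close>
proof (rule short_exact_sequence_from_presentation[OF quotient_module_cohomology
      quotient_module_exterior quotient_module_symmetric word_cochain_hom double_first_hom])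
  let ?F = "free_words 3 (dual_F2 :: (bit ^ 'n \<Rightarrow> bit) monoid)"
  let ?E = "free_words 2 (dual_F2 :: (bit ^ 'n \<Rightarrow> bit) monoid)"
  let ?Z = "cocycle_group :: ((bit ^ 'n) list \<Rightarrow> 'k) monoid"
  fix g :: "bit ^ 'n ^ 'n" assume g: "g \<in> carrier GL_F2"
  show "word_cochain (free_words_action GL_F2 3 dual_F2 dual_action g x)
      = (precomp 3 UNIV ((*v) (inv\<^bsub>GL_F2\<^esub> g)) (word_cochain x) :: (bit ^ 'n) list \<Rightarrow> 'k)"
    if "x \<in> carrier ?F" for x
    by (simp add: word_cochain_def precomp_cochain3 evaluate3_act[OF g that])
  show "double_first (free_words_action GL_F2 2 dual_F2 dual_action g x)
      = free_words_action GL_F2 3 dual_F2 dual_action g (double_first x)" if "x \<in> carrier ?E" for x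
    by (rule double_first_act[OF g that])
next
  fix c :: "(bit ^ 'n) list \<Rightarrow> 'k" assume "c \<in> carrier cocycle_group"
  then obtain F g where F: "F \<in> carrier (free_words 3 dual_F2)"
    and c: "c = cochain3 (\<lambda>x y z. d2 g x y z + scale_bit (evaluate3 F x y z) minus_one_unit)"
    using word_cochain_surjective[of c] by auto
  have "c \<otimes>\<^bsub>cocycle_group\<^esub> inv\<^bsub>cocycle_group\<^esub> word_cochain F = cochain3 (d2 g)"
    unfolding word_cochain_inv unfolding c word_cochain_def
    by (simp add: cochain3_mult add.assoc flip: scale_minus_one_add)
  with F show "\<exists>F\<in>carrier (free_words 3 dual_F2).
      c \<otimes>\<^bsub>cocycle_group\<^esub> inv\<^bsub>cocycle_group\<^esub> word_cochain F \<in> coboundaries 3"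
    by (auto simp: cochain3_coboundary_iff intro!: bexI[of _ F])
next
  fix F :: "(bit ^ 'n \<Rightarrow> bit) list \<Rightarrow> bit"
  assume "F \<in> carrier (free_words 3 dual_F2)" "word_cochain F \<in> (coboundaries 3 :: ((bit ^ 'n) list \<Rightarrow> 'k) set)"
  then show "F \<in> generate (free_words 3 dual_F2) (tensor_relations 3 dual_F2 \<union> exterior_relations 3 dual_F2)"
    by (intro exterior_relationsI alternation_coboundary)
next
  fix F :: "(bit ^ 'n \<Rightarrow> bit) list \<Rightarrow> bit"
  assume F: "F \<in> carrier (free_words 2 dual_F2)"
  \<comment> \<open>From left to right, a coboundary vanishes on the diagonal, and for a doubled sum
    this says that its quadratic form is zero, the criterion for lying in the symmetric
    relations.\<close>
  show "word_cochain (double_first F) \<in> (coboundaries 3 :: ((bit ^ 'n) list \<Rightarrow> 'k) set)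
    \<longleftrightarrow> F \<in> generate (free_words 2 dual_F2) (tensor_relations 2 dual_F2 \<union> symmetric_relations 2 dual_F2)"
    using symmetric_relations_coboundary[of F] symmetric_relationsI[OF F]
      diagonal_coboundary[of "double_first F"] evaluate3_double_first_diagonal[OF F]
    by metis
qed (use double_first_exterior exterior_relations_cohomologous in auto)

end
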